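(* Let $\psi$ be a function on $\mathbb{T}$ which admits an analytic continuation to a neighborhood of the unit circle, and let $\phi$ be of Szegő type. Let $\phi=\phi_-\phi_+$ be a canonical Wiener–Hopf factorization of $\phi$. Then there is a constant $\mathfrak{c}>0$ such that, as $N\to\infty$, $$D^B_N[\phi;\psi]=G[\phi]^NE[\phi]\left(F[\phi;\psi]+O(e^{-\mathfrak{c}N})\right),\qquad F[\phi;\psi]=\frac{[\phi_-^{-1}\psi]_0}{[\phi_+]_0}.$$
   Context: $\mathbb{T}=\{z\in\mathbb{C}:|z|=1\}$, positively oriented. For $f\in L^1(\mathbb{T})$, $f_n=[f]_n=\int_{\mathbb{T}}z^{-n}f(z)\frac{dz}{2\pi i z}$ denotes the $n$-th Fourier coefficient. The bordered Toeplitz determinant $D^B_N[\phi;\psi]$, $N>1$, is the determinant of the $N\times N$ matrix whose $(j,k)$ entry ($0\le j,k\le N-1$) is $\phi_{k-j}$ for $k\le N-2$ and $\psi_{N-1-j}$ for $k=N-1$. A symbol $\phi$ is of Szegő type if it is smooth and nonzero on $\mathbb{T}$, has winding number zero, and admits an analytic continuation to a neighborhood of $\mathbb{T}$. $\log\phi$ denotes a continuous logarithm of $\phi$ on $\mathbb{T}$, and $G[\phi]=\exp([\log\phi]_0)$, $E[\phi]=\exp\big(\sum_{n\ge1}n[\log\phi]_n[\log\phi]_{-n}\big)$. A canonical Wiener–Hopf factorization is $\phi(z)=\phi_-(z)\phi_+(z)$, $|z|=1$, where $\phi_+^{\pm1}$ are continuous on $\mathbb{T}$ with vanishing Fourier coefficients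 of negative index and $\phi_-^{\pm1}$ are continuous on $\mathbb{T}$ with vanishing Fourier coefficients of positive index; the factors are unique up to a multiplicative constant, one choice being $\phi_+(z)=\exp\big(\sum_{n\ge0}[\log\phi]_nz^n\big)$, $\phi_-(z)=\exp\big(\sum_{n\ge1}[\log\phi]_{-n}z^{-n}\big)$. *)

theory Defs
  imports "HOL-Complex_Analysis.Complex_Analysis" "HOL-Library.Landau_Symbols"
    "Jordan_Normal_Form.Determinant"
begin

text \<open>
  A function on the unit circle is represented by a total function on the complex plane of which
  only the values on the circle matter: no definition below depends on the values elsewhere.
\<close>

abbreviation unit_circle :: "complex set" where
  "unit_circle \<equiv> sphere 0 1"

definition fourier_coeff :: "(complex \<Rightarrow> complex) \<Rightarrow> int \<Rightarrow> complex" where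
  "fourier_coeff f n =
     contour_integral (circlepath 0 1) (\<lambda>z. z powi (- n) * f z / (2 * of_real pi * \<i> * z))"

text \<open>
  Rows and columns are numbered from 0. The definition is meant for \<open>N > 1\<close>.
\<close>

definition bordered_toeplitz_det ::
    "nat \<Rightarrow> (complex \<Rightarrow> complex) \<Rightarrow> (complex \<Rightarrow> complex) \<Rightarrow> complex" where
  "bordered_toeplitz_det N \<phi> \<psi> =
     Determinant.det (Matrix.mat N N (\<lambda>(j, k).
       if k + 2 \<le> N then fourier_coeff \<phi> (int k - int j)
       else fourier_coeff \<psi> (int N - 1 - int j)))"

definition has_analytic_continuation :: "(complex \<Rightarrow> complex) \<Rightarrow> bool" where
  "has_analytic_continuation f \<longleftrightarrow>
     (\<exists>U g. open U \<and> unit_circle \<subseteq> U \<and> g holomorphic_on U \<and> (\<forall>z\<in>unit_circle. g z = f z))"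

text \<open>
  Smoothness on the circle means that \<open>t \<mapsto> f (cis t)\<close> is infinitely often differentiable;
  \<open>F k\<close> is its derivative of order \<open>k\<close>.
\<close>

definition smooth_on_circle :: "(complex \<Rightarrow> complex) \<Rightarrow> bool" where
  "smooth_on_circle f \<longleftrightarrow>
     (\<exists>F :: nat \<Rightarrow> real \<Rightarrow> complex. F 0 = (\<lambda>t. f (cis t)) \<and>
        (\<forall>k t. (F k has_vector_derivative F (Suc k) t) (at t)))"

definition szego_type :: "(complex \<Rightarrow> complex) \<Rightarrow> bool" where
  "szego_type \<phi> \<longleftrightarrow>
     smooth_on_circle \<phi> \<and> (\<forall>z\<in>unit_circle. \<phi> z \<noteq> 0) \<and>
     winding_number (\<phi> \<circ> circlepath 0 1) 0 = 0 \<and> has_analytic_continuation \<phi>"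

text \<open>
  Any two continuous logarithms on the circle differ by an integer multiple of \<open>2 * pi * \<i>\<close>, so
  neither \<open>szego_G\<close> nor \<open>szego_E\<close> depends on the choice made here. For a symbol of Szego type a
  continuous logarithm exists because the winding number is zero.
\<close>

definition log_symbol :: "(complex \<Rightarrow> complex) \<Rightarrow> complex \<Rightarrow> complex" where
  "log_symbol \<phi> =
     (SOME l. continuous_on unit_circle l \<and> (\<forall>z\<in>unit_circle. exp (l z) = \<phi> z))"

definition szego_G :: "(complex \<Rightarrow> complex) \<Rightarrow> complex" where
  "szego_G \<phi> = exp (fourier_coeff (log_symbol \<phi>) 0)"

text \<open>
  The sum over \<open>n \<ge> 1\<close> is written over all natural numbers; its term at \<open>n = 0\<close> vanishes.
\<close>

definition szego_E :: "(complex \<Rightarrow> complex) \<Rightarrow> complex" where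
  "szego_E \<phi> = exp (\<Sum>n. of_nat n * fourier_coeff (log_symbol \<phi>) (int n)
                              * fourier_coeff (log_symbol \<phi>) (- int n))"

definition canonical_wiener_hopf ::
    "(complex \<Rightarrow> complex) \<Rightarrow> (complex \<Rightarrow> complex) \<Rightarrow> (complex \<Rightarrow> complex) \<Rightarrow> bool" where
  "canonical_wiener_hopf \<phi> \<phi>m \<phi>p \<longleftrightarrow>
     (\<forall>z\<in>unit_circle. \<phi> z = \<phi>m z * \<phi>p z) \<and>
     (\<forall>z\<in>unit_circle. \<phi>m z \<noteq> 0 \<and> \<phi>p z \<noteq> 0) \<and>
     continuous_on unit_circle \<phi>p \<and> continuous_on unit_circle (\<lambda>z. inverse (\<phi>p z)) \<and>
     continuous_on unit_circle \<phi>m \<and> continuous_on unit_circle (\<lambda>z. inverse (\<phi>m z)) \<and>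
     (\<forall>n<0. fourier_coeff \<phi>p n = 0 \<and> fourier_coeff (\<lambda>z. inverse (\<phi>p z)) n = 0) \<and>
     (\<forall>n>0. fourier_coeff \<phi>m n = 0 \<and> fourier_coeff (\<lambda>z. inverse (\<phi>m z)) n = 0)"

text \<open>
  \<open>bordered_F\<close> takes the factors \<open>\<phi>m\<close>, \<open>\<phi>p\<close> instead of \<open>\<phi>\<close>. The factors are unique up to a
  multiplicative constant, which cancels, so the value depends only on \<open>\<phi>\<close> and \<open>\<psi>\<close>.
\<close>

definition bordered_F ::
    "(complex \<Rightarrow> complex) \<Rightarrow> (complex \<Rightarrow> complex) \<Rightarrow> (complex \<Rightarrow> complex) \<Rightarrow> complex" where
  "bordered_F \<phi>m \<phi>p \<psi> =
     fourier_coeff (\<lambda>z. inverse (\<phi>m z) * \<psi> z) 0 / fourier_coeff \<phi>p 0"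

end

(* Reversing rows and columns turns the bordered determinant into the N x N determinant whose first
   column is the vector of the coefficients psi_i and whose other columns are those of the Toeplitz
   matrix of the coefficients phi_{i-j}.  Let P and M be the Taylor series of phi_+ in z and of phi_-
   in 1/z, with M_0 = 1.  Multiplying by the triangular Toeplitz matrices of 1/P and 1/M leaves
   P_0^N times the determinant of an N x N section of a fixed infinite matrix I + A with
   A_ij = O(tau^(i+j)).  Bounding determinants by products of row sums shows that such sections
   converge exponentially fast, with constants that depend only on the decay of the coefficients.

   Border: psi = phi v on nonnegative indices, where v_0 = F.  The terms v_m phi_{i-m} with
   1 <= m < N repeat a column, and the tail is exponentially small, so D^B_N is F D_N up to
   O(G^N tau^N).

   Constant: multiplying phi by 1 - x z turns D_N into the bordered determinant of size N + 1 with
   border x^i, so the bordered asymptotics multiply the limit of D_N / G^N by phi_-(1/x)^(-1).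
   Induction on the roots gives the limit E when phi_+ is a polynomial.  The general case follows by
   truncating P, because all constants are uniform along the truncations. *)
theory Submission
  imports Defs "HOL-Computational_Algebra.Fundamental_Theorem_Algebra"
begin

section \<open>Determinants of matrices close to the identity\<close>

text \<open>A factor 1 - x z multiplies the limit by 1/M(x) = exp(- sum of l_n x^n), where l_n is
  the coefficient of log \<phi> at -n, and -x^n is the n-th coefficient of its logarithmic
  derivative. The limit is therefore exp(sum of l_n [z P'/P]_n), which for P = exp A has the
  exponent sum of n a_n l_n. Using z P'/P in place of log P avoids logarithms of polynomials and
  makes the exponent additive over factors. The obstacle is an exchange of limits: adding linear
  factors one at a time worsens the decay constants, so the induction on the roots gives no rate
  that survives infinitely many factors. Hence one pair \<open>C\<close>, \<open>\<rho>\<close>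
  bounds P, M and their inverses at once, and the estimates needed along the truncations fix their
  constants before the symbol. The truncations share such a pair because P has no zero on a disc of
  radius greater than 1. The given \<open>\<phi>m\<close>, \<open>\<phi>p\<close> are only
  continuous, so they are compared with the exponential factors through uniqueness of Fourier
  coefficients, not by complex analysis off the circle.\<close>

lemma linear_times_geometric_le:
  fixes \<rho> \<tau> :: real
  assumes "0 \<le> \<rho>" "\<rho> < \<tau>"
  obtains K where "K > 0" "\<And>n. real (Suc n) * \<rho> ^ n \<le> K * \<tau> ^ n"
proof -
  define q where "q = \<rho> / \<tau>"
  have q: "norm q < 1" "0 \<le> q" "\<tau> > 0"
    using assms by (auto simp: q_def)
  have "(\<lambda>n. of_nat n * q ^ n + q ^ n) \<longlonglongrightarrow> 0 + 0"
    by (intro tendsto_add powser_times_n_limit_0 LIMSEQ_power_zero q)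
  hence "Bseq (\<lambda>n. of_nat n * q ^ n + q ^ n)"
    by (intro convergent_imp_Bseq) (auto simp: convergent_def)
  then obtain K where K: "K > 0" "\<And>n. norm (of_nat n * q ^ n + q ^ n) \<le> K"
    by (auto simp: Bseq_def)
  show ?thesis
  proof (rule that[of K])
    fix n
    have "real (Suc n) * q ^ n \<le> K"
      using K(2)[of n] by (simp add: algebra_simps abs_le_iff)
    hence "real (Suc n) * q ^ n * \<tau> ^ n \<le> K * \<tau> ^ n"
      using q by (intro mult_right_mono) auto
    thus "real (Suc n) * \<rho> ^ n \<le> K * \<tau> ^ n"
      using q by (simp add: q_def power_divide)
  qed (use K in auto)
qed

lemma sum_geometric_le:
  fixes \<tau> :: real
  assumes "0 \<le> \<tau>" "\<tau> < 1"
  shows "(\<Sum>i<N. \<tau> ^ i) \<le> 1 / (1 - \<tau>)"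
proof -
  have "(\<Sum>i<N. \<tau> ^ i) \<le> (\<Sum>i. \<tau> ^ i)"
    using assms by (intro sum_le_suminf summable_geometric) auto
  also have "\<dots> = 1 / (1 - \<tau>)"
    using assms by (intro suminf_geometric) auto
  finally show ?thesis .
qed

lemma sum_norm_mat_delete_row_le:
  fixes A :: "'a :: real_normed_field mat"
  assumes "A \<in> carrier_mat (Suc n) (Suc n)" "i < Suc n" "j < Suc n" "k < n"
  shows "(\<Sum>l<n. norm (mat_delete A i j $$ (k, l))) \<le> (\<Sum>l<Suc n. norm (A $$ (insert_index i k, l)))"
proof -
  have "(\<Sum>l<n. norm (mat_delete A i j $$ (k, l))) =
        (\<Sum>l<n. norm (A $$ (insert_index i k, insert_index j l)))"
    by (intro sum.cong refl) (use assms in \<open>auto simp: mat_delete_index[symmetric]\<close>)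
  also have "\<dots> = (\<Sum>l\<in>insert_index j ` {..<n}. norm (A $$ (insert_index i k, l)))"
    by (subst sum.reindex) (auto intro: insert_index_inj_on)
  also have "\<dots> \<le> (\<Sum>l<Suc n. norm (A $$ (insert_index i k, l)))"
    by (intro sum_mono2) (auto simp: insert_index_def)
  finally show ?thesis .
qed

text \<open>Expanding along the first row leaves minors whose row sums are at most those of the
  remaining full rows. The bound is cruder than Hadamard's, but for a matrix close to the identity
  the i-th row sum is 1 + O(\<tau>^i), so the product stays bounded.\<close>

lemma norm_det_le_prod_row_sums:
  fixes A :: "'a :: real_normed_field mat"
  assumes "A \<in> carrier_mat n n"
  shows "norm (Determinant.det A) \<le> (\<Prod>i<n. \<Sum>j<n. norm (A $$ (i, j)))"
  using assms
proof (induction n arbitrary: A)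
  case 0
  thus ?case by (simp add: det_dim_zero)
next
  case (Suc n)
  have D: "norm (Determinant.det (mat_delete A 0 j)) \<le> (\<Prod>i<n. \<Sum>l<Suc n. norm (A $$ (Suc i, l)))"
    if "j < Suc n" for j
  proof -
    have "norm (Determinant.det (mat_delete A 0 j)) \<le>
          (\<Prod>i<n. \<Sum>l<n. norm (mat_delete A 0 j $$ (i, l)))"
      by (rule Suc.IH) (use Suc.prems that in \<open>auto intro: mat_delete_carrier[of A "Suc n" "Suc n", simplified]\<close>)
    also have "\<dots> \<le> (\<Prod>i<n. \<Sum>l<Suc n. norm (A $$ (insert_index 0 i, l)))"
      by (intro prod_mono conjI sum_nonneg sum_norm_mat_delete_row_le) (use Suc.prems that in auto)
    finally show ?thesis by simp
  qed
  have "Determinant.det A = (\<Sum>j<Suc n. A $$ (0, j) * cofactor A 0 j)"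
    using Suc.prems by (intro laplace_expansion_row) auto
  also have "norm \<dots> \<le> (\<Sum>j<Suc n. norm (A $$ (0, j) * cofactor A 0 j))"
    by (rule norm_sum)
  also have "\<dots> \<le> (\<Sum>j<Suc n. norm (A $$ (0, j)) * (\<Prod>i<n. \<Sum>l<Suc n. norm (A $$ (Suc i, l))))"
    by (intro sum_mono) (auto simp: norm_mult cofactor_def norm_power intro!: mult_left_mono D simp del: sum.lessThan_Suc)
  also have "\<dots> = (\<Prod>i<Suc n. \<Sum>j<Suc n. norm (A $$ (i, j)))"
    by (simp add: prod.lessThan_Suc_shift sum_distrib_right del: sum.lessThan_Suc prod.lessThan_Suc)
  finally show ?case .
qed

context
  fixes X :: "nat \<Rightarrow> nat \<Rightarrow> complex" and K \<tau> :: real and N :: nat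
  assumes \<tau>: "0 \<le> \<tau>" "\<tau> < 1"
    and X: "\<And>i j. i < N \<Longrightarrow> j < N \<Longrightarrow> norm (X i j - of_bool (i = j)) \<le> K * \<tau> ^ (i + j)"
    and K: "K \<ge> 0"
begin

lemma near_identity_row_sum_le:
  assumes "i < N"
  shows "(\<Sum>j<N. norm (X i j)) \<le> exp (K / (1 - \<tau>) * \<tau> ^ i)"
proof -
  have "(\<Sum>j<N. norm (X i j)) \<le> (\<Sum>j<N. of_bool (i = j) + K * \<tau> ^ i * \<tau> ^ j)"
  proof (intro sum_mono)
    fix j assume "j \<in> {..<N}"
    have "norm (X i j) \<le> norm (of_bool (i = j) :: complex) + norm (X i j - of_bool (i = j))"
      by (metis add.commute diff_add_cancel norm_triangle_ineq)
    also have "\<dots> \<le> of_bool (i = j) + K * \<tau> ^ (i + j)"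
      using X[of i j] assms \<open>j \<in> {..<N}\<close> by (auto simp: of_bool_def)
    finally show "norm (X i j) \<le> of_bool (i = j) + K * \<tau> ^ i * \<tau> ^ j"
      by (simp add: power_add mult.assoc)
  qed
  also have "\<dots> = 1 + K * \<tau> ^ i * (\<Sum>j<N. \<tau> ^ j)"
    using assms by (simp add: sum.distrib sum_distrib_left of_bool_def sum.delta')
  also have "\<dots> \<le> 1 + K * \<tau> ^ i * (1 / (1 - \<tau>))"
    using \<tau> K by (intro add_left_mono mult_left_mono sum_geometric_le) auto
  also have "\<dots> \<le> exp (K / (1 - \<tau>) * \<tau> ^ i)"
    using exp_ge_add_one_self[of "K / (1 - \<tau>) * \<tau> ^ i"] by (simp add: field_simps)
  finally show ?thesis .
qed

text \<open>The exponents of the row bounds form a geometric series, so the bound does not depend on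
  \<open>N\<close>. Only the first \<open>n\<close> of the \<open>N\<close> rows enter, so that it
  also covers minors with the last row deleted.\<close>

lemma near_identity_prod_row_sums_le:
  assumes "n \<le> N"
  shows "(\<Prod>i<n. \<Sum>j<N. norm (X i j)) \<le> exp (K / (1 - \<tau>)\<^sup>2)"
proof -
  have "(\<Prod>i<n. \<Sum>j<N. norm (X i j)) \<le> (\<Prod>i<n. exp (K / (1 - \<tau>) * \<tau> ^ i))"
    using assms by (intro prod_mono conjI sum_nonneg near_identity_row_sum_le) auto
  also have "\<dots> = exp (K / (1 - \<tau>) * (\<Sum>i<n. \<tau> ^ i))"
    by (simp add: exp_sum sum_distrib_left)
  also have "\<dots> \<le> exp (K / (1 - \<tau>) * (1 / (1 - \<tau>)))"
    using \<tau> K by (subst exp_le_cancel_iff, intro mult_left_mono sum_geometric_le) auto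
  finally show ?thesis by (simp add: power2_eq_square)
qed

lemma norm_det_near_identity_le:
  "norm (Determinant.det (Matrix.mat N N (\<lambda>(i, j). X i j))) \<le> exp (K / (1 - \<tau>)\<^sup>2)"
  using norm_det_le_prod_row_sums[of "Matrix.mat N N (\<lambda>(i, j). X i j)" N]
    near_identity_prod_row_sums_le[of N] by simp

end

text \<open>In the expansion along the last row, the cofactor of the corner is the section of size
  \<open>N\<close>. Subtracting it replaces the last row of X by that of X minus the identity, with
  entries of size \<tau>^(N + j), while all cofactors obey the uniform bound on products of row
  sums.\<close>

lemma det_near_identity_step:
  fixes X :: "nat \<Rightarrow> nat \<Rightarrow> complex"
  assumes \<tau>: "0 \<le> \<tau>" "\<tau> < 1"
    and X: "\<And>i j. norm (X i j - of_bool (i = j)) \<le> K * \<tau> ^ (i + j)"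
    and K: "K \<ge> 0"
  shows "norm (Determinant.det (Matrix.mat (Suc N) (Suc N) (\<lambda>(i, j). X i j)) -
               Determinant.det (Matrix.mat N N (\<lambda>(i, j). X i j)))
         \<le> exp (K / (1 - \<tau>)\<^sup>2) * (K / (1 - \<tau>)) * \<tau> ^ N"
proof -
  define A where "A = Matrix.mat (Suc N) (Suc N) (\<lambda>(i, j). X i j)"
  define B where "B = exp (K / (1 - \<tau>)\<^sup>2)"
  have A: "A \<in> carrier_mat (Suc N) (Suc N)" by (simp add: A_def)
  have cof: "norm (cofactor A N j) \<le> B" if j: "j < Suc N" for j
  proof -
    have "norm (cofactor A N j) = norm (Determinant.det (mat_delete A N j))"
      by (simp add: cofactor_def norm_mult norm_power)
    also have "\<dots> \<le> (\<Prod>i<N. \<Sum>l<N. norm (mat_delete A N j $$ (i, l)))"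
      by (rule norm_det_le_prod_row_sums) (use mat_delete_carrier[OF A] in simp)
    also have "\<dots> \<le> (\<Prod>i<N. \<Sum>l<Suc N. norm (A $$ (insert_index N i, l)))"
      by (intro prod_mono conjI sum_nonneg sum_norm_mat_delete_row_le A) (use j in auto)
    also have "\<dots> = (\<Prod>i<N. \<Sum>l<Suc N. norm (X i l))"
      by (intro prod.cong sum.cong refl) (auto simp: A_def insert_index_def)
    also have "\<dots> \<le> B"
      unfolding B_def by (intro near_identity_prod_row_sums_le \<tau> X K) auto
    finally show ?thesis .
  qed
  have last: "cofactor A N N = Determinant.det (Matrix.mat N N (\<lambda>(i, j). X i j))"
  proof -
    have "mat_delete A N N = Matrix.mat N N (\<lambda>(i, j). X i j)"
      by (rule eq_matI) (auto simp: mat_delete_def A_def)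
    thus ?thesis by (simp add: cofactor_def)
  qed
  have "Determinant.det A = (\<Sum>j<Suc N. A $$ (N, j) * cofactor A N j)"
    by (rule laplace_expansion_row[OF A]) auto
  hence "Determinant.det A - cofactor A N N =
         (\<Sum>j<Suc N. (X N j - of_bool (N = j)) * cofactor A N j)"
    by (simp add: A_def algebra_simps)
  also have "norm \<dots> \<le> (\<Sum>j<Suc N. K * \<tau> ^ (N + j) * B)"
    by (rule sum_norm_le, subst norm_mult, intro mult_mono X cof) (use K \<tau> in auto)
  also have "\<dots> = B * K * \<tau> ^ N * (\<Sum>j<Suc N. \<tau> ^ j)"
    by (simp add: power_add sum_distrib_left mult_ac del: sum.lessThan_Suc)
  also have "\<dots> \<le> B * K * \<tau> ^ N * (1 / (1 - \<tau>))"
    using \<tau> K by (intro mult_left_mono sum_geometric_le) (auto simp: B_def)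
  finally show ?thesis unfolding last by (simp add: A_def B_def)
qed

section \<open>Reduction of bordered Toeplitz determinants\<close>

text \<open>The constant and the rate are explicit arguments because later estimates have to be
  uniform over all sequences with the same pair.\<close>

definition geom_bounded :: "real \<Rightarrow> real \<Rightarrow> (nat \<Rightarrow> complex) \<Rightarrow> bool" where
  "geom_bounded C \<rho> a \<longleftrightarrow> (\<forall>n. norm (a n) \<le> C * \<rho> ^ n)"

lemma geom_boundedD: "geom_bounded C \<rho> a \<Longrightarrow> norm (a n) \<le> C * \<rho> ^ n"
  by (simp add: geom_bounded_def)

lemma geom_bounded_summable:
  assumes "geom_bounded C \<rho> a" "0 \<le> \<rho>" "\<rho> < 1"
  shows "summable (\<lambda>n. norm (a n))"
  by (rule summable_comparison_test[of _ "\<lambda>n. C * \<rho> ^ n"])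
     (use assms in \<open>auto simp: geom_bounded_def intro!: summable_mult summable_geometric\<close>)

lemma geom_bounded_mono:
  assumes "geom_bounded C \<rho> a" "0 \<le> \<rho>" "\<rho> \<le> \<rho>'" "C \<le> C'" "0 \<le> C"
  shows "geom_bounded C' \<rho>' a"
  unfolding geom_bounded_def
proof
  fix n
  have "norm (a n) \<le> C * \<rho> ^ n"
    using assms by (auto simp: geom_bounded_def)
  also have "\<dots> \<le> C' * \<rho>' ^ n"
    using assms by (intro mult_mono power_mono) auto
  finally show "norm (a n) \<le> C' * \<rho>' ^ n" .
qed

lemma norm_suminf_geometric_le:
  fixes f :: "nat \<Rightarrow> complex"
  assumes "\<And>n. norm (f n) \<le> K * \<rho> ^ n" "0 \<le> \<rho>" "\<rho> < 1"
  shows "norm (suminf f) \<le> K / (1 - \<rho>)"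
proof -
  have s: "summable (\<lambda>n. norm (f n))"
    by (rule geom_bounded_summable[of K \<rho>]) (use assms in \<open>auto simp: geom_bounded_def\<close>)
  have "norm (suminf f) \<le> (\<Sum>n. norm (f n))"
    by (rule summable_norm[OF s])
  also have "\<dots> \<le> (\<Sum>n. K * \<rho> ^ n)"
    by (rule suminf_le[OF _ s]) (use assms in \<open>auto intro!: summable_mult summable_geometric\<close>)
  also have "\<dots> = K / (1 - \<rho>)"
    using assms by (subst suminf_mult) (auto simp: suminf_geometric intro!: summable_geometric)
  finally show ?thesis .
qed

text \<open>The double series converges absolutely because \<open>h\<close> is bounded, and it is
  regrouped along the diagonals k + b = n. If \<open>f\<close> and \<open>g\<close> are the
  coefficients of a power series and of its inverse, only \<open>h 0\<close> remains on the right.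
  In this way the triangular Toeplitz operators of M and 1/M are seen to be inverse to each other on
  bounded sequences.\<close>

lemma suminf_convolution:
  fixes f g h :: "nat \<Rightarrow> complex"
  assumes f: "summable (\<lambda>n. norm (f n))" and g: "summable (\<lambda>n. norm (g n))"
    and h: "\<And>n. norm (h n) \<le> B"
  shows "(\<Sum>k. f k * (\<Sum>b. g b * h (k + b))) = (\<Sum>n. (\<Sum>i\<le>n. f i * g (n - i)) * h n)"
proof -
  define F where "F = (\<lambda>(k, b). f k * g b * h (k + b))"
  have B: "0 \<le> B" using h[of 0] norm_ge_zero order_trans by blast
  \<comment> \<open>Unordered sums permit reindexing and exchange of summation; absolute convergence
    identifies them with \<open>suminf\<close>.\<close>
  have to_infsum: "suminf u = infsum u UNIV" if "summable (\<lambda>n. norm (u n))" for u :: "nat \<Rightarrow> complex"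
    using norm_summable_imp_has_sum[OF that summable_sums[OF summable_norm_cancel[OF that]]]
    by (simp add: infsumI)
  have gh: "summable (\<lambda>b. norm (g b * h (k + b)))" for k
    by (rule summable_comparison_test[OF _ summable_mult2[OF g, of B]])
       (auto simp: norm_mult intro!: mult_left_mono h)
  have fgh: "summable (\<lambda>k. norm (f k * (\<Sum>b. g b * h (k + b))))"
  proof (rule summable_comparison_test[OF _ summable_mult2[OF f, of "(\<Sum>b. norm (g b) * B)"]])
    show "\<exists>N. \<forall>n\<ge>N. norm (norm (f n * (\<Sum>b. g b * h (n + b)))) \<le> norm (f n) * (\<Sum>b. norm (g b) * B)"
    proof (intro exI[of _ 0] allI impI)
      fix n
      have "norm (\<Sum>b. g b * h (n + b)) \<le> (\<Sum>b. norm (g b * h (n + b)))"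
        by (rule summable_norm[OF gh])
      also have "\<dots> \<le> (\<Sum>b. norm (g b) * B)"
        by (rule suminf_le[OF _ gh summable_mult2[OF g]]) (auto simp: norm_mult intro!: mult_left_mono h)
      finally show "norm (norm (f n * (\<Sum>b. g b * h (n + b)))) \<le> norm (f n) * (\<Sum>b. norm (g b) * B)"
        by (simp add: norm_mult mult_left_mono)
    qed
  qed
  have fg1: "(\<lambda>k. norm (f k)) summable_on UNIV" "(\<lambda>k. norm (g k)) summable_on UNIV"
    using f g by (auto intro!: norm_summable_imp_summable_on)
  have "(\<lambda>x. norm (case x of (k, b) \<Rightarrow> f k * g b)) summable_on UNIV \<times> UNIV"
    unfolding Infinite_Sum.abs_summable_on_Sigma_iff
    using fg1 by (auto simp: norm_mult infsum_cmult_right infsum_nonneg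
        intro!: summable_on_cmult_right summable_on_cmult_left)
  hence "(\<lambda>x. norm (case x of (k, b) \<Rightarrow> f k * g b) * B) summable_on UNIV \<times> UNIV"
    by (rule summable_on_cmult_left)
  hence absF: "(\<lambda>x. norm (F x)) summable_on UNIV \<times> UNIV"
    by (rule summable_on_comparison_test)
       (auto simp: F_def norm_mult intro!: mult_left_mono h)
  \<comment> \<open>The pair (k, b) is encoded by its diagonal n = k + b and the position i = k on
    it.\<close>
  have bij: "bij_betw (\<lambda>(n, i). (i, n - i)) (SIGMA n:UNIV. {..n::nat}) (UNIV \<times> UNIV)"
    by (rule bij_betwI[where g = "\<lambda>(k, b). (k + b, k)"]) auto
  have absF': "(\<lambda>x. norm (F (case x of (n, i) \<Rightarrow> (i, n - i)))) summable_on (SIGMA n:UNIV. {..n})"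
    using absF summable_on_reindex_bij_betw[OF bij, of "\<lambda>x. norm (F x)"] by simp
  have F': "F (i, n - i) = f i * g (n - i) * h n" if "i \<le> n" for n i
    using that by (simp add: F_def)
  have conv: "infsum (\<lambda>i. F (case (n, i) of (n, i) \<Rightarrow> (i, n - i))) {..n} =
      (\<Sum>i\<le>n. f i * g (n - i)) * h n" for n
    by (simp add: F' sum_distrib_right)
  have summable_conv: "(\<lambda>n. infsum (\<lambda>i. norm (F (case (n, i) of (n, i) \<Rightarrow> (i, n - i)))) {..n}) summable_on UNIV"
    using absF' unfolding Infinite_Sum.abs_summable_on_Sigma_iff by (auto simp: sum_nonneg)
  have sconv: "summable (\<lambda>n. norm ((\<Sum>i\<le>n. f i * g (n - i)) * h n))"
  proof (rule summable_comparison_test)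
    show "summable (\<lambda>n. infsum (\<lambda>i. norm (F (case (n, i) of (n, i) \<Rightarrow> (i, n - i)))) {..n})"
      using summable_conv by (rule summable_on_imp_summable)
    show "\<exists>N. \<forall>n\<ge>N. norm (norm ((\<Sum>i\<le>n. f i * g (n - i)) * h n)) \<le>
            infsum (\<lambda>i. norm (F (case (n, i) of (n, i) \<Rightarrow> (i, n - i)))) {..n}"
    proof (intro exI[of _ 0] allI impI)
      fix n
      have "norm ((\<Sum>i\<le>n. f i * g (n - i)) * h n) = norm (\<Sum>i\<le>n. f i * g (n - i) * h n)"
        by (simp add: sum_distrib_right)
      also have "\<dots> \<le> (\<Sum>i\<le>n. norm (f i * g (n - i) * h n))" by (rule norm_sum)
      also have "\<dots> = infsum (\<lambda>i. norm (F (case (n, i) of (n, i) \<Rightarrow> (i, n - i)))) {..n}"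
        by (simp add: F')
      finally show "norm (norm ((\<Sum>i\<le>n. f i * g (n - i)) * h n)) \<le>
            infsum (\<lambda>i. norm (F (case (n, i) of (n, i) \<Rightarrow> (i, n - i)))) {..n}" by simp
    qed
  qed
  have "(\<Sum>k. f k * (\<Sum>b. g b * h (k + b))) = infsum (\<lambda>k. infsum (\<lambda>b. F (k, b)) UNIV) UNIV"
    by (subst to_infsum[OF fgh])
       (auto simp: to_infsum[OF gh] F_def mult.assoc intro!: infsum_cong infsum_cmult_right'[symmetric])
  also have "\<dots> = infsum F (UNIV \<times> UNIV)"
    by (rule infsum_Sigma_banach) (rule Infinite_Sum.abs_summable_summable[OF absF])
  also have "\<dots> = infsum (\<lambda>x. F (case x of (n, i) \<Rightarrow> (i, n - i))) (SIGMA n:UNIV. {..n})"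
    by (rule infsum_reindex_bij_betw[OF bij, symmetric])
  also have "\<dots> = infsum (\<lambda>n. infsum (\<lambda>i. F (case (n, i) of (n, i) \<Rightarrow> (i, n - i))) {..n}) UNIV"
    by (rule infsum_Sigma_banach[symmetric]) (rule Infinite_Sum.abs_summable_summable[OF absF'])
  also have "\<dots> = (\<Sum>n. (\<Sum>i\<le>n. f i * g (n - i)) * h n)"
    unfolding conv by (rule to_infsum[OF sconv, symmetric])
  finally show ?thesis .
qed

section \<open>Laurent coefficients of a symbol given as a product of two power series\<close>

definition int_coeff :: "complex fps \<Rightarrow> int \<Rightarrow> complex" where
  "int_coeff P n = (if n \<ge> 0 then fps_nth P (nat n) else 0)"

text \<open>
  The Laurent coefficients of \<open>M (1/z) * P z\<close>: here \<open>P\<close> stands for \<open>\<phi>p\<close> and \<open>M\<close> for \<open>\<phi>m\<close> as a series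
  in \<open>1/z\<close>.
\<close>

definition symbol_coeff :: "complex fps \<Rightarrow> complex fps \<Rightarrow> int \<Rightarrow> complex" where
  "symbol_coeff M P n = (\<Sum>k. fps_nth M k * int_coeff P (n + int k))"

lemma norm_int_coeff_le:
  assumes "geom_bounded C \<rho> (fps_nth P)" "0 \<le> \<rho>" "\<rho> < 1" "0 \<le> C"
  shows "norm (int_coeff P n) \<le> C * \<rho> ^ nat n" "norm (int_coeff P n) \<le> C"
proof -
  show *: "norm (int_coeff P n) \<le> C * \<rho> ^ nat n"
    using assms by (auto simp: int_coeff_def geom_bounded_def)
  have "C * \<rho> ^ nat n \<le> C * 1"
    using assms by (intro mult_left_mono power_le_one) auto
  thus "norm (int_coeff P n) \<le> C" using * by simp
qed

text \<open>\<open>nat n\<close> is 0 for negative \<open>n\<close>, so the first bound gives decay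
  towards positive indices and mere boundedness elsewhere. Decay in the other direction is supplied
  in the reduction by the coefficients of 1/M.\<close>

lemma norm_symbol_coeff_le:
  assumes M: "geom_bounded C \<rho> (fps_nth M)" and P: "geom_bounded C \<rho> (fps_nth P)"
    and \<rho>: "0 \<le> \<rho>" "\<rho> < 1" and C: "0 \<le> C"
  shows "norm (symbol_coeff M P n) \<le> C\<^sup>2 / (1 - \<rho>) * \<rho> ^ nat n" (is "_ \<le> ?B * _")
    and "norm (symbol_coeff M P n) \<le> C\<^sup>2 / (1 - \<rho>)"
proof -
  have "norm (symbol_coeff M P n) \<le> (C\<^sup>2 * \<rho> ^ nat n) / (1 - \<rho>)"
    unfolding symbol_coeff_def
  proof (rule norm_suminf_geometric_le[OF _ \<rho>])
    fix k
    have "norm (int_coeff P (n + int k)) \<le> C * \<rho> ^ nat n"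
    proof (cases "n + int k \<ge> 0")
      case True
      have "norm (int_coeff P (n + int k)) \<le> C * \<rho> ^ nat (n + int k)"
        by (rule norm_int_coeff_le(1)[OF P \<rho> C])
      also have "\<dots> \<le> C * \<rho> ^ nat n"
        using True \<rho> C by (intro mult_left_mono power_decreasing) auto
      finally show ?thesis .
    qed (use C \<rho> in \<open>auto simp: int_coeff_def\<close>)
    hence "norm (fps_nth M k * int_coeff P (n + int k)) \<le> (C * \<rho> ^ k) * (C * \<rho> ^ nat n)"
      unfolding norm_mult using C \<rho> by (intro mult_mono geom_boundedD[OF M]) auto
    thus "norm (fps_nth M k * int_coeff P (n + int k)) \<le> C\<^sup>2 * \<rho> ^ nat n * \<rho> ^ k"
      by (simp add: power2_eq_square mult_ac)
  qed
  thus *: "norm (symbol_coeff M P n) \<le> ?B * \<rho> ^ nat n" by simp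
  have "?B * \<rho> ^ nat n \<le> ?B * 1"
    using \<rho> C by (intro mult_left_mono power_le_one) auto
  thus "norm (symbol_coeff M P n) \<le> ?B" using * by simp
qed

text \<open>This is the identity \<phi>(z) / M(1/z) = P(z) in coefficients.\<close>

lemma symbol_coeff_times_inverse:
  assumes M: "geom_bounded C \<rho> (fps_nth M)" and P: "geom_bounded C \<rho> (fps_nth P)"
    and m: "geom_bounded C \<rho> (fps_nth (inverse M))"
    and \<rho>: "0 \<le> \<rho>" "\<rho> < 1" and C: "0 \<le> C" and M0: "fps_nth M 0 \<noteq> 0"
  shows "(\<Sum>c. fps_nth (inverse M) c * symbol_coeff M P (n + int c)) = int_coeff P n"
proof -
  have "(\<Sum>c. fps_nth (inverse M) c * symbol_coeff M P (n + int c)) =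
        (\<Sum>c. fps_nth (inverse M) c * (\<Sum>k. fps_nth M k * int_coeff P (n + int (c + k))))"
    by (simp add: symbol_coeff_def add.assoc)
  also have "\<dots> = (\<Sum>k. (\<Sum>i\<le>k. fps_nth (inverse M) i * fps_nth M (k - i)) * int_coeff P (n + int k))"
    by (rule suminf_convolution[where B = C])
       (use geom_bounded_summable[OF M \<rho>] geom_bounded_summable[OF m \<rho>] norm_int_coeff_le(2)[OF P \<rho> C] in auto)
  also have "\<dots> = (\<Sum>k. if k = 0 then int_coeff P n else 0)"
  proof (intro suminf_cong)
    fix k
    have "(\<Sum>i\<le>k. fps_nth (inverse M) i * fps_nth M (k - i)) = fps_nth (inverse M * M) k"
      by (simp add: fps_mult_nth atLeast0AtMost)
    thus "(\<Sum>i\<le>k. fps_nth (inverse M) i * fps_nth M (k - i)) * int_coeff P (n + int k) =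
          (if k = 0 then int_coeff P n else 0)"
      using M0 by (simp add: inverse_mult_eq_1)
  qed
  also have "\<dots> = int_coeff P n"
    using sums_single[of 0 "\<lambda>_. int_coeff P n"] by (simp add: sums_iff)
  finally show ?thesis .
qed

text \<open>One pair of constants controls all four series, so that a bound in terms of
  \<open>C\<close> and \<open>\<rho>\<close> holds for a whole family of symbols. With the
  normalization of M at 0, the mean G of the symbol is the constant term of P.\<close>

definition admissible :: "real \<Rightarrow> real \<Rightarrow> complex fps \<Rightarrow> complex fps \<Rightarrow> bool" where
  "admissible C \<rho> M P \<longleftrightarrow>
     geom_bounded C \<rho> (fps_nth M) \<and> geom_bounded C \<rho> (fps_nth P) \<and>
     geom_bounded C \<rho> (fps_nth (inverse M)) \<and> geom_bounded C \<rho> (fps_nth (inverse P)) \<and>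
     fps_nth M 0 = 1 \<and> fps_nth P 0 \<noteq> 0"

lemma admissible_mono:
  assumes "admissible C \<rho> M P" "0 \<le> \<rho>" "\<rho> \<le> \<rho>'" "C \<le> C'" "0 \<le> C"
  shows "admissible C' \<rho>' M P"
  using assms unfolding admissible_def by (blast intro: geom_bounded_mono)

section \<open>Reduction by triangular Toeplitz matrices\<close>

definition bordered_det :: "(int \<Rightarrow> complex) \<Rightarrow> (nat \<Rightarrow> complex) \<Rightarrow> nat \<Rightarrow> complex" where
  "bordered_det f v N =
     Determinant.det (Matrix.mat N N (\<lambda>(i, j). if j = 0 then v i else f (int i - int j)))"

text \<open>These are the entries of L B U, where B is the bordered matrix and \<open>L\<close>,
  \<open>U\<close> are the triangular Toeplitz matrices of 1/P and 1/M. Summing over all columns of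
  \<phi> would give P and, after multiplication by \<open>L\<close>, the identity. What is
  subtracted comes from the columns of index at most 0: one is displaced by the border, the others
  lie outside of the matrix. No entry depends on the size \<open>N\<close>.\<close>

definition reduced_entry :: "complex fps \<Rightarrow> complex fps \<Rightarrow> (nat \<Rightarrow> complex) \<Rightarrow> nat \<Rightarrow> nat \<Rightarrow> complex" where
  "reduced_entry M P v i j =
     (if j = 0 then \<Sum>a\<le>i. fps_nth (inverse P) (i - a) * v a
      else of_bool (i = j) - (\<Sum>a\<le>i. fps_nth (inverse P) (i - a) *
             (\<Sum>c. fps_nth (inverse M) (j + c) * symbol_coeff M P (int a + int c))))"

lemma prod_list_diag_const:
  assumes "\<And>i. i < n \<Longrightarrow> A $$ (i, i) = c" "A \<in> carrier_mat n n"
  shows "prod_list (diag_mat A) = c ^ n"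
proof -
  have "diag_mat A = replicate n c"
    using assms by (intro nth_equalityI) (auto simp: diag_mat_def)
  thus ?thesis by simp
qed

lemma mult_mat_entry:
  assumes "A \<in> carrier_mat n n" "B \<in> carrier_mat n n" "i < n" "j < n"
  shows "(A * B) $$ (i, j) = (\<Sum>k\<in>{0..<n}. A $$ (i, k) * B $$ (k, j))"
  using assms by (simp add: scalar_prod_def)

lemma bordered_det_reduction:
  assumes adm: "admissible C \<rho> M P" and \<rho>: "0 \<le> \<rho>" "\<rho> < 1" and C: "0 \<le> C"
  shows "bordered_det (symbol_coeff M P) v N =
         fps_nth P 0 ^ N * Determinant.det (Matrix.mat N N (\<lambda>(i, j). reduced_entry M P v i j))"
proof -
  have M: "geom_bounded C \<rho> (fps_nth M)" and P: "geom_bounded C \<rho> (fps_nth P)"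
    and m: "geom_bounded C \<rho> (fps_nth (inverse M))" and M0: "fps_nth M 0 = 1" and P0: "fps_nth P 0 \<noteq> 0"
    using adm by (auto simp: admissible_def)
  define \<phi> where "\<phi> = symbol_coeff M P"
  \<comment> \<open>\<open>U\<close> is the Toeplitz matrix of \<open>1/M\<close> with its first row replaced by a unit vector, so that
      the border is left alone.\<close>
  define L where "L = Matrix.mat N N (\<lambda>(i, a). if a \<le> i then fps_nth (inverse P) (i - a) else 0)"
  define U where "U = Matrix.mat N N (\<lambda>(b, j). if b = 0 then of_bool (j = 0)
                    else if b \<le> j then fps_nth (inverse M) (j - b) else 0)"
  define B where "B = Matrix.mat N N (\<lambda>(i, j). if j = 0 then v i else \<phi> (int i - int j))"
  have carr: "L \<in> carrier_mat N N" "U \<in> carrier_mat N N" "B \<in> carrier_mat N N"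
    by (auto simp: L_def U_def B_def)
  have BU: "(B * U) $$ (a, j) = (if j = 0 then v a else int_coeff P (int a - int j) -
               (\<Sum>c. fps_nth (inverse M) (j + c) * \<phi> (int a + int c)))"
    if aj: "a < N" "j < N" for a j
  proof (cases "j = 0")
    case True
    have "(B * U) $$ (a, j) = (\<Sum>b\<in>{0..<N}. if b = 0 then v a else 0)"
      unfolding mult_mat_entry[OF carr(3,2) aj]
      by (rule sum.cong) (use aj True in \<open>auto simp: B_def U_def\<close>)
    also have "\<dots> = v a" using aj by simp
    finally show ?thesis using True by simp
  next
    case False
    have "(B * U) $$ (a, j) = (\<Sum>b\<in>{0..<N}. if 1 \<le> b \<and> b \<le> j then
             \<phi> (int a - int b) * fps_nth (inverse M) (j - b) else 0)"
      unfolding mult_mat_entry[OF carr(3,2) aj]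
      by (rule sum.cong) (use aj False in \<open>auto simp: B_def U_def\<close>)
    also have "\<dots> = (\<Sum>b\<in>{1..j}. \<phi> (int a - int b) * fps_nth (inverse M) (j - b))"
      using aj by (intro sum.mono_neutral_cong_right) auto
    also have "\<dots> = (\<Sum>c<j. fps_nth (inverse M) c * \<phi> (int a - int j + int c))"
      by (rule sum.reindex_bij_witness[of _ "\<lambda>c. j - c" "\<lambda>b. j - b"])
         (auto simp: of_nat_diff algebra_simps)
    \<comment> \<open>The complete sum over \<open>c\<close> is a coefficient of P by the
      factorization; the missing terms c \<ge> j belong to the columns b = j - c \<le> 0.\<close>
    also have "\<dots> = int_coeff P (int a - int j) -
               (\<Sum>c. fps_nth (inverse M) (c + j) * \<phi> (int a - int j + int (c + j)))"
    proof -
      have "summable (\<lambda>c. fps_nth (inverse M) c * \<phi> (int a - int j + int c))"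
      proof (rule summable_norm_cancel, rule geom_bounded_summable[OF _ \<rho>])
        show "geom_bounded (C * (C\<^sup>2 / (1 - \<rho>))) \<rho> (\<lambda>c. fps_nth (inverse M) c * \<phi> (int a - int j + int c))"
          unfolding geom_bounded_def
        proof
          fix c
          have "norm (\<phi> (int a - int j + int c)) \<le> C\<^sup>2 / (1 - \<rho>) * 1"
            unfolding \<phi>_def using norm_symbol_coeff_le(2)[OF M P \<rho> C] by simp
          hence "norm (fps_nth (inverse M) c * \<phi> (int a - int j + int c)) \<le> (C * \<rho> ^ c) * (C\<^sup>2 / (1 - \<rho>) * 1)"
            unfolding norm_mult using \<rho> C by (intro mult_mono geom_boundedD[OF m]) auto
          thus "norm (fps_nth (inverse M) c * \<phi> (int a - int j + int c)) \<le> C * (C\<^sup>2 / (1 - \<rho>)) * \<rho> ^ c"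
            by (simp add: mult_ac)
        qed
      qed
      from suminf_split_initial_segment[OF this, of j]
        symbol_coeff_times_inverse[OF M P m \<rho> C, of "int a - int j"] M0
      show ?thesis by (simp add: \<phi>_def)
    qed
    finally show ?thesis using False by (simp add: add.commute)
  qed
  have LBU: "L * (B * U) = Matrix.mat N N (\<lambda>(i, j). reduced_entry M P v i j)"
  proof (rule eq_matI)
    fix i j
    assume "i < dim_row (Matrix.mat N N (\<lambda>(i, j). reduced_entry M P v i j))"
           "j < dim_col (Matrix.mat N N (\<lambda>(i, j). reduced_entry M P v i j))"
    hence ij: "i < N" "j < N" by auto
    have "(L * (B * U)) $$ (i, j) = (\<Sum>a\<in>{0..<N}. (if a \<le> i then fps_nth (inverse P) (i - a) else 0) * (B * U) $$ (a, j))"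
      unfolding mult_mat_entry[OF carr(1) mult_carrier_mat[OF carr(3,2)] ij]
      by (rule sum.cong) (use ij in \<open>auto simp: L_def\<close>)
    also have "\<dots> = (\<Sum>a\<le>i. fps_nth (inverse P) (i - a) * (B * U) $$ (a, j))"
      using ij by (intro sum.mono_neutral_cong_right) auto
    also have "\<dots> = (\<Sum>a\<le>i. fps_nth (inverse P) (i - a) * (if j = 0 then v a else int_coeff P (int a - int j) -
               (\<Sum>c. fps_nth (inverse M) (j + c) * \<phi> (int a + int c))))"
      using ij by (intro sum.cong refl) (auto simp: BU)
    also have "\<dots> = reduced_entry M P v i j"
    proof (cases "j = 0")
      case False
      \<comment> \<open>The lower triangular Toeplitz matrices of 1/P and P are inverse to each
        other.\<close>
      have "(\<Sum>a\<le>i. fps_nth (inverse P) (i - a) * int_coeff P (int a - int j)) = of_bool (i = j)"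
      proof (cases "j \<le> i")
        case True
        have "(\<Sum>a\<le>i. fps_nth (inverse P) (i - a) * int_coeff P (int a - int j)) =
              (\<Sum>a\<in>{j..i}. fps_nth (inverse P) (i - a) * int_coeff P (int a - int j))"
          by (intro sum.mono_neutral_right) (auto simp: int_coeff_def)
        also have "\<dots> = (\<Sum>b\<in>{0..i-j}. fps_nth (inverse P) b * fps_nth P (i - j - b))"
          by (rule sum.reindex_bij_witness[of _ "\<lambda>b. i - b" "\<lambda>a. i - a"])
             (use True in \<open>auto simp: int_coeff_def nat_diff_distrib\<close>)
        also have "\<dots> = fps_nth (inverse P * P) (i - j)"
          by (simp add: fps_mult_nth)
        also have "\<dots> = of_bool (i = j)"
          using P0 True by (simp add: inverse_mult_eq_1)
        finally show ?thesis .
      qed (auto simp: int_coeff_def intro!: sum.neutral)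
      thus ?thesis using False
        by (simp add: reduced_entry_def right_diff_distrib sum_subtractf \<phi>_def)
    qed (simp add: reduced_entry_def)
    finally show "(L * (B * U)) $$ (i, j) = Matrix.mat N N (\<lambda>(i, j). reduced_entry M P v i j) $$ (i, j)"
      using ij by simp
  qed (use carr in auto)
  have "Determinant.det L = prod_list (diag_mat L)"
    by (rule det_lower_triangular[OF _ carr(1)]) (auto simp: L_def)
  also have "\<dots> = inverse (fps_nth P 0) ^ N"
    by (rule prod_list_diag_const[OF _ carr(1)]) (auto simp: L_def)
  finally have detL: "Determinant.det L = inverse (fps_nth P 0) ^ N" .
  have "Determinant.det U = prod_list (diag_mat U)"
    by (rule det_upper_triangular[OF _ carr(2)]) (auto simp: U_def upper_triangular_def)
  also have "\<dots> = 1 ^ N"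
    by (rule prod_list_diag_const[OF _ carr(2)]) (auto simp: U_def M0)
  finally have detU: "Determinant.det U = 1" by simp
  have "Determinant.det (L * (B * U)) = inverse (fps_nth P 0) ^ N * Determinant.det B"
    using carr by (simp add: det_mult[of _ N] detL detU)
  hence "Determinant.det B = fps_nth P 0 ^ N * Determinant.det (L * (B * U))"
    using P0 by (simp add: power_inverse)
  from this[unfolded LBU, unfolded B_def \<phi>_def] show ?thesis
    unfolding bordered_det_def .
qed

text \<open>Each of the n + 1 products has size \<rho>^n; the linear factor is absorbed afterwards
  by a slightly larger rate. The bound on \<open>b\<close> is restricted to k \<le> n because a
  border may be controlled only below the size of its matrix.\<close>

lemma norm_cauchy_product_le:
  fixes a b :: "nat \<Rightarrow> complex"
  assumes a: "geom_bounded C \<rho> a" and b: "\<And>k. k \<le> n \<Longrightarrow> norm (b k) \<le> D * \<rho> ^ k"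
    and "0 \<le> \<rho>" "0 \<le> C" "0 \<le> D"
  shows "norm (\<Sum>k\<le>n. a (n - k) * b k) \<le> C * D * (real (Suc n) * \<rho> ^ n)"
proof -
  have "norm (\<Sum>k\<le>n. a (n - k) * b k) \<le> (\<Sum>k\<le>n. C * D * \<rho> ^ n)"
  proof (rule sum_norm_le)
    fix k assume k: "k \<in> {..n}"
    have "norm (a (n - k) * b k) \<le> (C * \<rho> ^ (n - k)) * (D * \<rho> ^ k)"
      unfolding norm_mult using assms k by (intro mult_mono geom_boundedD[OF a] b) auto
    also have "\<dots> = C * D * \<rho> ^ (n - k + k)"
      by (simp add: power_add)
    finally show "norm (a (n - k) * b k) \<le> C * D * \<rho> ^ n" using k by simp
  qed
  also have "\<dots> = C * D * (real (Suc n) * \<rho> ^ n)" by simp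
  finally show ?thesis .
qed

text \<open>A subtracted term pairs the decay of 1/M in \<open>j\<close> with the decay of \<phi> at
  the nonnegative index a + c, and convolution with 1/P turns the decay in \<open>a\<close> into
  decay in \<open>i\<close>. The constant \<open>K\<close> is chosen before the symbol, the border
  and the size.\<close>

lemma reduced_entry_near_identity:
  assumes \<rho>: "0 \<le> \<rho>" "\<rho> < \<tau>" "\<tau> < 1" and C: "0 \<le> C"
  obtains K where "K \<ge> 0"
    "\<And>M P (v :: nat \<Rightarrow> complex) N i j. admissible C \<rho> M P \<Longrightarrow> (\<And>i. i < N \<Longrightarrow> norm (v i) \<le> C * \<rho> ^ i) \<Longrightarrow>
       i < N \<Longrightarrow> j < N \<Longrightarrow> norm (reduced_entry M P v i j - of_bool (i = j)) \<le> K * \<tau> ^ (i + j)"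
proof -
  obtain K0 where K0: "K0 > 0" "\<And>n. real (Suc n) * \<rho> ^ n \<le> K0 * \<tau> ^ n"
    using linear_times_geometric_le[OF \<rho>(1,2)] by metis
  \<comment> \<open>The factors are the bound of 1/M, the bound of the symbol coefficients and the
    geometric sum over \<open>c\<close>.\<close>
  define D where "D = C * (C\<^sup>2 / (1 - \<rho>)) / (1 - \<rho>)"
  have D: "0 \<le> D" using \<rho> C by (auto simp: D_def)
  show thesis
  proof (rule that[of "K0 * (C * D + C * C + 1)"])
    show "0 \<le> K0 * (C * D + C * C + 1)" using K0 C D by auto
    fix M P and v :: "nat \<Rightarrow> complex" and N i j
    assume adm: "admissible C \<rho> M P" and v: "\<And>i. i < N \<Longrightarrow> norm (v i) \<le> C * \<rho> ^ i"
      and ij: "i < N" "j < N"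
    have M: "geom_bounded C \<rho> (fps_nth M)" and P: "geom_bounded C \<rho> (fps_nth P)"
      and m: "geom_bounded C \<rho> (fps_nth (inverse M))" and p: "geom_bounded C \<rho> (fps_nth (inverse P))"
      using adm by (auto simp: admissible_def)
    have \<rho>1: "\<rho> < 1" using \<rho> by simp
    show "norm (reduced_entry M P v i j - of_bool (i = j)) \<le> K0 * (C * D + C * C + 1) * \<tau> ^ (i + j)"
    proof (cases "j = 0")
      case True
      \<comment> \<open>Column 0 need not resemble a unit vector: both the border and the entry 1
        are O(\<tau>^i) on their own, which suffices since j = 0.\<close>
      have "norm (reduced_entry M P v i j - of_bool (i = j)) \<le>
            norm (\<Sum>a\<le>i. fps_nth (inverse P) (i - a) * v a) + norm (of_bool (i = j) :: complex)"
        using True by (simp add: reduced_entry_def norm_triangle_ineq4)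
      also have "\<dots> \<le> C * C * (real (Suc i) * \<rho> ^ i) + real (Suc i) * \<rho> ^ i"
      proof (intro add_mono norm_cauchy_product_le p \<rho> C)
        show "norm (v k) \<le> C * \<rho> ^ k" if "k \<le> i" for k
          using that ij by (intro v) auto
      qed (use \<rho> True in auto)
      also have "\<dots> = (C * C + 1) * (real (Suc i) * \<rho> ^ i)" by (simp add: algebra_simps)
      also have "\<dots> \<le> (C * C + 1) * (K0 * \<tau> ^ i)"
        using C by (intro mult_left_mono K0) auto
      also have "\<dots> \<le> (C * D + C * C + 1) * (K0 * \<tau> ^ i)"
        using C D K0 \<rho> by (intro mult_right_mono) auto
      finally show ?thesis using True by (simp add: mult_ac)
    next
      case False
      define S where "S = (\<lambda>a. (\<Sum>c. fps_nth (inverse M) (j + c) * symbol_coeff M P (int a + int c)))"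
      have S: "norm (S a) \<le> D * \<rho> ^ j * \<rho> ^ a" for a
      proof -
        have "norm (S a) \<le> (C * (C\<^sup>2 / (1 - \<rho>)) * \<rho> ^ j * \<rho> ^ a) / (1 - \<rho>)"
          unfolding S_def
        proof (rule norm_suminf_geometric_le[OF _ \<rho>(1) \<rho>1])
          fix c
          have "norm (symbol_coeff M P (int a + int c)) \<le> C\<^sup>2 / (1 - \<rho>) * \<rho> ^ nat (int a + int c)"
            by (rule norm_symbol_coeff_le[OF M P \<rho>(1) \<rho>1 C])
          also have "\<dots> \<le> C\<^sup>2 / (1 - \<rho>) * \<rho> ^ a"
            using \<rho> C by (intro mult_left_mono power_decreasing) auto
          finally have "norm (symbol_coeff M P (int a + int c)) \<le> C\<^sup>2 / (1 - \<rho>) * \<rho> ^ a" .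
          hence "norm (fps_nth (inverse M) (j + c) * symbol_coeff M P (int a + int c)) \<le>
                 (C * \<rho> ^ (j + c)) * (C\<^sup>2 / (1 - \<rho>) * \<rho> ^ a)"
            unfolding norm_mult using \<rho> C by (intro mult_mono geom_boundedD[OF m]) auto
          thus "norm (fps_nth (inverse M) (j + c) * symbol_coeff M P (int a + int c)) \<le>
                C * (C\<^sup>2 / (1 - \<rho>)) * \<rho> ^ j * \<rho> ^ a * \<rho> ^ c"
            by (simp add: power_add mult_ac)
        qed
        thus ?thesis by (simp add: D_def mult_ac)
      qed
      have "norm (reduced_entry M P v i j - of_bool (i = j)) =
            norm (\<Sum>a\<le>i. fps_nth (inverse P) (i - a) * S a)"
        using False by (simp add: reduced_entry_def S_def)
      also have "\<dots> \<le> C * (D * \<rho> ^ j) * (real (Suc i) * \<rho> ^ i)"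
        by (intro norm_cauchy_product_le p S) (use \<rho> C D in auto)
      also have "\<dots> \<le> C * (D * \<tau> ^ j) * (K0 * \<tau> ^ i)"
        using \<rho> C D by (intro mult_mono K0 mult_left_mono power_mono) auto
      also have "\<dots> = (C * D) * (K0 * \<tau> ^ (i + j))" by (simp add: power_add)
      also have "\<dots> \<le> (C * D + C * C + 1) * (K0 * \<tau> ^ (i + j))"
        using C D K0 \<rho> by (intro mult_right_mono) auto
      finally show ?thesis by (simp add: mult_ac)
    qed
  qed
qed

text \<open>The decay of \<open>v\<close> is required only below \<open>N\<close>, which admits
  borders that depend on \<open>N\<close> themselves.\<close>

lemma norm_bordered_det_le:
  assumes \<rho>: "0 \<le> \<rho>" "\<rho> < 1" and C: "0 \<le> C"
  obtains K where "K \<ge> 0"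
    "\<And>M P (v :: nat \<Rightarrow> complex) N. admissible C \<rho> M P \<Longrightarrow> (\<And>i. i < N \<Longrightarrow> norm (v i) \<le> C * \<rho> ^ i) \<Longrightarrow>
       norm (bordered_det (symbol_coeff M P) v N) \<le> K * norm (fps_nth P 0) ^ N"
proof -
  define \<tau> where "\<tau> = (1 + \<rho>) / 2"
  have \<tau>: "\<rho> < \<tau>" "\<tau> < 1" "0 \<le> \<tau>" using \<rho> by (auto simp: \<tau>_def)
  obtain K where K: "K \<ge> 0"
    "\<And>M P (v :: nat \<Rightarrow> complex) N i j. admissible C \<rho> M P \<Longrightarrow> (\<And>i. i < N \<Longrightarrow> norm (v i) \<le> C * \<rho> ^ i) \<Longrightarrow>
       i < N \<Longrightarrow> j < N \<Longrightarrow> norm (reduced_entry M P v i j - of_bool (i = j)) \<le> K * \<tau> ^ (i + j)"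
    using reduced_entry_near_identity[OF \<rho>(1) \<tau>(1,2) C] by blast
  show thesis
  proof (rule that[of "exp (K / (1 - \<tau>)\<^sup>2)"])
    fix M P and v :: "nat \<Rightarrow> complex" and N
    assume adm: "admissible C \<rho> M P" and v: "\<And>i. i < N \<Longrightarrow> norm (v i) \<le> C * \<rho> ^ i"
    have "norm (Determinant.det (Matrix.mat N N (\<lambda>(i, j). reduced_entry M P v i j))) \<le>
          exp (K / (1 - \<tau>)\<^sup>2)"
      by (rule norm_det_near_identity_le[OF \<tau>(3,2) K(2)[OF adm v] K(1)])
    hence "norm (fps_nth P 0) ^ N * norm (Determinant.det (Matrix.mat N N (\<lambda>(i, j). reduced_entry M P v i j))) \<le>
          norm (fps_nth P 0) ^ N * exp (K / (1 - \<tau>)\<^sup>2)"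
      by (intro mult_left_mono) auto
    thus "norm (bordered_det (symbol_coeff M P) v N) \<le> exp (K / (1 - \<tau>)\<^sup>2) * norm (fps_nth P 0) ^ N"
      by (simp add: bordered_det_reduction[OF adm \<rho> C] norm_mult norm_power mult_ac)
  qed auto
qed

section \<open>Convergence of Toeplitz determinants and comparison with bordered ones\<close>

definition toeplitz_det :: "(int \<Rightarrow> complex) \<Rightarrow> nat \<Rightarrow> complex" where
  "toeplitz_det f N = Determinant.det (Matrix.mat N N (\<lambda>(i, j). f (int i - int j)))"

lemma bordered_det_self: "bordered_det f (\<lambda>i. f (int i)) N = toeplitz_det f N"
  unfolding bordered_det_def toeplitz_det_def
  by (rule arg_cong[of _ _ Determinant.det], rule eq_matI) auto

lemma geometric_steps_limit:
  fixes a :: "nat \<Rightarrow> complex"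
  assumes "\<And>n. norm (a (Suc n) - a n) \<le> K * \<tau> ^ n" "0 \<le> \<tau>" "\<tau> < 1"
  shows "\<exists>L. \<forall>n. norm (a n - L) \<le> K / (1 - \<tau>) * \<tau> ^ n"
proof -
  define d where "d n = a (Suc n) - a n" for n
  have d: "geom_bounded K \<tau> d" using assms by (simp add: geom_bounded_def d_def)
  have s: "summable d"
    by (rule summable_norm_cancel[OF geom_bounded_summable[OF d assms(2,3)]])
  have "norm (a n - (a 0 + suminf d)) \<le> K / (1 - \<tau>) * \<tau> ^ n" for n
  proof -
    have "(\<Sum>k<n. d k) = a n - a 0"
      unfolding d_def by (rule sum_lessThan_telescope)
    hence "(a 0 + suminf d) - a n = (\<Sum>k. d (k + n))"
      using suminf_split_initial_segment[OF s, of n] by simp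
    also have "norm \<dots> \<le> (K * \<tau> ^ n) / (1 - \<tau>)"
      by (rule norm_suminf_geometric_le[OF _ assms(2,3)])
         (use geom_boundedD[OF d, of "_ + n"] in \<open>simp add: power_add mult_ac\<close>)
    finally show ?thesis by (simp add: norm_minus_commute)
  qed
  thus ?thesis by blast
qed

text \<open>A Toeplitz matrix is bordered by its own column 0, so after the reduction the normalized
  determinants are those of the sections of one infinite matrix. The limit is not yet identified,
  but its rate of approach is uniform over all admissible symbols, as the passage from truncations
  to P requires.\<close>

lemma toeplitz_det_limit:
  assumes \<rho>: "0 \<le> \<rho>" "\<rho> < 1" and C: "0 \<le> C"
  obtains K \<tau> where "K \<ge> 0" "0 < \<tau>" "\<tau> < 1"
    "\<And>M P. admissible C \<rho> M P \<Longrightarrow>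
       \<exists>L. \<forall>N. norm (toeplitz_det (symbol_coeff M P) N / fps_nth P 0 ^ N - L) \<le> K * \<tau> ^ N"
proof -
  \<comment> \<open>The border consists of symbol coefficients here, whose constant is the second
    argument of \<open>max\<close>.\<close>
  define C' where "C' = max C (C\<^sup>2 / (1 - \<rho>))"
  have C': "C \<le> C'" "0 \<le> C'" using C by (auto simp: C'_def)
  define \<tau> where "\<tau> = (1 + \<rho>) / 2"
  have \<tau>: "\<rho> < \<tau>" "\<tau> < 1" "0 \<le> \<tau>" using \<rho> by (auto simp: \<tau>_def)
  obtain K where K: "K \<ge> 0"
    "\<And>M P (v :: nat \<Rightarrow> complex) N i j. admissible C' \<rho> M P \<Longrightarrow> (\<And>i. i < N \<Longrightarrow> norm (v i) \<le> C' * \<rho> ^ i) \<Longrightarrow>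
       i < N \<Longrightarrow> j < N \<Longrightarrow> norm (reduced_entry M P v i j - of_bool (i = j)) \<le> K * \<tau> ^ (i + j)"
    using reduced_entry_near_identity[OF \<rho>(1) \<tau>(1,2) C'(2)] by blast
  define K' where "K' = exp (K / (1 - \<tau>)\<^sup>2) * (K / (1 - \<tau>)) / (1 - \<tau>)"
  show thesis
  proof (rule that[of K' \<tau>])
    fix M P assume adm: "admissible C \<rho> M P"
    define v where "v = (\<lambda>i. symbol_coeff M P (int i))"
    have adm': "admissible C' \<rho> M P"
      by (rule admissible_mono[OF adm]) (use \<rho> C C' in auto)
    have v: "norm (v i) \<le> C' * \<rho> ^ i" for i
    proof -
      have "norm (v i) \<le> C\<^sup>2 / (1 - \<rho>) * \<rho> ^ nat (int i)"
        unfolding v_def by (rule norm_symbol_coeff_le) (use adm \<rho> C in \<open>auto simp: admissible_def\<close>)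
      also have "\<dots> \<le> C' * \<rho> ^ nat (int i)"
        using \<rho> by (intro mult_right_mono) (auto simp: C'_def)
      also have "\<dots> = C' * \<rho> ^ i" by simp
      finally show ?thesis .
    qed
    have P0: "fps_nth P 0 \<noteq> 0" using adm by (simp add: admissible_def)
    have eq: "toeplitz_det (symbol_coeff M P) N / fps_nth P 0 ^ N =
          Determinant.det (Matrix.mat N N (\<lambda>(i, j). reduced_entry M P v i j))" for N
      using P0 bordered_det_reduction[OF adm \<rho> C, of v N]
      by (simp add: v_def bordered_det_self)
    \<comment> \<open>The entry bound presupposes a size, but the entries do not depend on it; any
      size above both indices serves.\<close>
    have near: "norm (reduced_entry M P v i j - of_bool (i = j)) \<le> K * \<tau> ^ (i + j)" for i j
      by (rule K(2)[OF adm', of "Suc (max i j)"]) (auto intro: v)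
    show "\<exists>L. \<forall>N. norm (toeplitz_det (symbol_coeff M P) N / fps_nth P 0 ^ N - L) \<le> K' * \<tau> ^ N"
      unfolding eq K'_def
      by (rule geometric_steps_limit[OF _ \<tau>(3,2)]) (rule det_near_identity_step[OF \<tau>(3,2) near K(1)])
  qed (use \<tau> K \<rho> in \<open>auto simp: K'_def\<close>)
qed

text \<open>Expansion along the border column: its cofactors do not see the border, so they may be
  computed with border 0.\<close>

lemma bordered_det_linear:
  assumes "N \<ge> 1"
  obtains c where "\<And>v. bordered_det f v N = (\<Sum>i<N. v i * c i)"
proof -
  define A where "A = (\<lambda>v. Matrix.mat N N (\<lambda>(i, j). if j = 0 then v i else f (int i - int j)))"
  show thesis
  proof (rule that[of "\<lambda>i. cofactor (A (\<lambda>_. 0)) i 0"])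
    fix v
    have "bordered_det f v N = (\<Sum>i<N. A v $$ (i, 0) * cofactor (A v) i 0)"
      unfolding bordered_det_def A_def
      by (rule laplace_expansion_column) (use assms in auto)
    also have "\<dots> = (\<Sum>i<N. v i * cofactor (A (\<lambda>_. 0)) i 0)"
    proof (intro sum.cong refl arg_cong2[of _ _ _ _ "(*)"])
      fix i assume i: "i \<in> {..<N}"
      show "A v $$ (i, 0) = v i" using i assms by (simp add: A_def)
      have "mat_delete (A v) i 0 = mat_delete (A (\<lambda>_. 0)) i 0"
        by (rule eq_matI) (auto simp: mat_delete_def A_def)
      thus "cofactor (A v) i 0 = cofactor (A (\<lambda>_. 0)) i 0"
        by (simp add: cofactor_def)
    qed
    finally show "bordered_det f v N = (\<Sum>i<N. v i * cofactor (A (\<lambda>_. 0)) i 0)" .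
  qed
qed

lemma bordered_det_shifted:
  assumes "1 \<le> k" "k < N"
  shows "bordered_det f (\<lambda>i. f (int i - int k)) N = 0"
  unfolding bordered_det_def
  by (rule det_identical_columns[of _ N 0 k]) (use assms in \<open>auto intro!: eq_vecI\<close>)

text \<open>The semi-infinite Toeplitz matrix of \<phi> is the upper triangular one of M times the
  lower triangular one of P. Inverting both factors solves the system with right-hand side \<psi>.
  Written as a combination of columns, \<psi> then contributes to the determinant through column 0
  with weight \<open>v 0\<close> and through the columns beyond the matrix.\<close>

lemma bordered_det_asymp:
  assumes adm: "admissible C \<rho> M P" and \<rho>: "0 \<le> \<rho>" "\<rho> < 1" and C: "0 \<le> C"
    and \<psi>: "geom_bounded C \<rho> \<psi>"
  obtains K \<tau> where "K \<ge> 0" "0 < \<tau>" "\<tau> < 1"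
    "\<And>N. N \<ge> 1 \<Longrightarrow> norm (bordered_det (symbol_coeff M P) \<psi> N -
        inverse (fps_nth P 0) * (\<Sum>b. fps_nth (inverse M) b * \<psi> b) * toeplitz_det (symbol_coeff M P) N)
       \<le> K * \<tau> ^ N * norm (fps_nth P 0) ^ N"
proof -
  have M: "geom_bounded C \<rho> (fps_nth M)" and P: "geom_bounded C \<rho> (fps_nth P)"
    and m: "geom_bounded C \<rho> (fps_nth (inverse M))" and p: "geom_bounded C \<rho> (fps_nth (inverse P))"
    and M0: "fps_nth M 0 = 1" and P0: "fps_nth P 0 \<noteq> 0"
    using adm by (auto simp: admissible_def)
  define \<phi> where "\<phi> = symbol_coeff M P"
  define \<tau> where "\<tau> = (1 + \<rho>) / 2"
  have \<tau>: "\<rho> < \<tau>" "\<tau> < 1" "0 < \<tau>" using \<rho> by (auto simp: \<tau>_def)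
  obtain K0 where K0: "K0 > 0" "\<And>n. real (Suc n) * \<rho> ^ n \<le> K0 * \<tau> ^ n"
    using linear_times_geometric_le[OF \<rho>(1) \<tau>(1)] by metis
  \<comment> \<open>\<open>u\<close> is the result of the upper triangular inverse and
    \<open>v\<close> that of the lower triangular one; \<open>v 0\<close> is the factor of the
    Toeplitz determinant in the claim.\<close>
  define u where "u k = (\<Sum>b. fps_nth (inverse M) b * \<psi> (k + b))" for k
  define v where "v n = (\<Sum>k\<le>n. fps_nth (inverse P) (n - k) * u k)" for n
  define D where "D = C * C / (1 - \<rho>)"
  have D: "D \<ge> 0" using \<rho> C by (simp add: D_def)
  have u: "norm (u k) \<le> D * \<rho> ^ k" for k
  proof -
    have "norm (u k) \<le> (C * C * \<rho> ^ k) / (1 - \<rho>)"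
      unfolding u_def
    proof (rule norm_suminf_geometric_le[OF _ \<rho>])
      fix b
      have "norm (fps_nth (inverse M) b * \<psi> (k + b)) \<le> (C * 1) * (C * \<rho> ^ (k + b))"
        unfolding norm_mult using \<rho> C
        by (intro mult_mono geom_boundedD[OF \<psi>] order_trans[OF geom_boundedD[OF m]] mult_left_mono power_le_one) auto
      thus "norm (fps_nth (inverse M) b * \<psi> (k + b)) \<le> C * C * \<rho> ^ k * \<rho> ^ b"
        by (simp add: power_add mult_ac)
    qed
    thus ?thesis by (simp add: D_def mult_ac)
  qed
  define K1 where "K1 = C * D * K0"
  have K1: "K1 \<ge> 0" using C D K0 by (simp add: K1_def)
  have v: "norm (v n) \<le> K1 * \<tau> ^ n" for n
  proof -
    have "norm (v n) \<le> C * D * (real (Suc n) * \<rho> ^ n)"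
      unfolding v_def by (intro norm_cauchy_product_le p u \<rho> C D)
    also have "\<dots> \<le> C * D * (K0 * \<tau> ^ n)"
      using C D by (intro mult_left_mono K0) auto
    finally show ?thesis by (simp add: K1_def mult_ac)
  qed
  have vP: "(\<Sum>k\<le>n. v k * fps_nth P (n - k)) = u n" for n
  proof -
    have "Abs_fps v = Abs_fps u * inverse P"
      unfolding fps_eq_iff fps_mult_nth by (auto simp: v_def atLeast0AtMost mult.commute intro!: sum.cong)
    hence "Abs_fps v * P = Abs_fps u"
      using P0 by (simp add: mult.assoc inverse_mult_eq_1)
    from arg_cong[OF this, of "\<lambda>f. fps_nth f n"] show ?thesis
      by (simp add: fps_mult_nth atLeast0AtMost)
  qed
  have \<psi>u: "\<psi> i = (\<Sum>k. fps_nth M k * u (i + k))" for i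
  proof -
    have "(\<Sum>k. fps_nth M k * u (i + k)) = (\<Sum>k. fps_nth M k * (\<Sum>b. fps_nth (inverse M) b * \<psi> (i + (k + b))))"
      by (simp add: u_def add.assoc)
    also have "\<dots> = (\<Sum>n. (\<Sum>k\<le>n. fps_nth M k * fps_nth (inverse M) (n - k)) * \<psi> (i + n))"
    proof (rule suminf_convolution[where B = C])
      show "norm (\<psi> (i + n)) \<le> C" for n
        by (rule order_trans[OF geom_boundedD[OF \<psi>]]) (use \<rho> C in \<open>auto intro!: mult_left_le power_le_one\<close>)
    qed (use geom_bounded_summable[OF M \<rho>] geom_bounded_summable[OF m \<rho>] in auto)
    also have "\<dots> = (\<Sum>n. if n = 0 then \<psi> i else 0)"
    proof (intro suminf_cong)
      fix n
      have "(\<Sum>k\<le>n. fps_nth M k * fps_nth (inverse M) (n - k)) = fps_nth (M * inverse M) n"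
        by (simp add: fps_mult_nth atLeast0AtMost)
      also have "M * inverse M = 1" using M0 by (simp add: inverse_mult_eq_1')
      finally show "(\<Sum>k\<le>n. fps_nth M k * fps_nth (inverse M) (n - k)) * \<psi> (i + n) = (if n = 0 then \<psi> i else 0)"
        by simp
    qed
    also have "\<dots> = \<psi> i"
      using sums_single[of 0 "\<lambda>_. \<psi> i"] by (simp add: sums_iff)
    finally show ?thesis by simp
  qed
  \<comment> \<open>This is the contribution of all columns n \<ge> N. With the sum over M taken
    outside, the inner sum over \<open>n\<close> is finite, so no double series has to be
    rearranged.\<close>
  define tail where "tail N i = (\<Sum>k. fps_nth M k * (\<Sum>n\<in>{N..i + k}. v n * fps_nth P (i + k - n)))" for N i
  define K2 where "K2 = C * (K1 * C / (1 - \<tau>)) / (1 - \<rho>)"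
  have K2: "K2 \<ge> 0" using K1 C \<rho> \<tau> by (simp add: K2_def)
  have e: "norm (\<Sum>n\<in>{N..l}. v n * fps_nth P (l - n)) \<le> K1 * C / (1 - \<tau>) * \<tau> ^ N" for N l
  proof -
    have "norm (\<Sum>n\<in>{N..l}. v n * fps_nth P (l - n)) \<le> (\<Sum>n\<in>{N..l}. (K1 * \<tau> ^ n) * C)"
      unfolding norm_mult
    proof (rule sum_norm_le)
      fix n
      have "norm (fps_nth P (l - n)) \<le> C"
        by (rule order_trans[OF geom_boundedD[OF P]]) (use \<rho> C in \<open>auto intro!: mult_left_le power_le_one\<close>)
      thus "norm (v n * fps_nth P (l - n)) \<le> (K1 * \<tau> ^ n) * C"
        unfolding norm_mult using K1 \<tau> by (intro mult_mono v) auto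
    qed
    also have "\<dots> = K1 * C * \<tau> ^ N * (\<Sum>i<Suc l - N. \<tau> ^ i)"
      unfolding sum_distrib_left
      by (rule sum.reindex_bij_witness[of _ "\<lambda>i. N + i" "\<lambda>n. n - N"]) (auto simp: power_add[symmetric])
    also have "\<dots> \<le> K1 * C * \<tau> ^ N * (1 / (1 - \<tau>))"
      using \<tau> K1 C by (intro mult_left_mono sum_geometric_le) auto
    finally show ?thesis by simp
  qed
  have tail: "norm (tail N i) \<le> K2 * \<tau> ^ N" for N i
  proof -
    have "norm (tail N i) \<le> (C * (K1 * C / (1 - \<tau>) * \<tau> ^ N)) / (1 - \<rho>)"
      unfolding tail_def
    proof (rule norm_suminf_geometric_le[OF _ \<rho>])
      fix k
      have "norm (fps_nth M k * (\<Sum>n\<in>{N..i + k}. v n * fps_nth P (i + k - n))) \<le>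
            (C * \<rho> ^ k) * (K1 * C / (1 - \<tau>) * \<tau> ^ N)"
        unfolding norm_mult using C \<rho> by (intro mult_mono geom_boundedD[OF M] e) auto
      thus "norm (fps_nth M k * (\<Sum>n\<in>{N..i + k}. v n * fps_nth P (i + k - n))) \<le>
            C * (K1 * C / (1 - \<tau>) * \<tau> ^ N) * \<rho> ^ k"
        by (simp add: mult_ac)
    qed
    thus ?thesis by (simp add: K2_def mult_ac)
  qed
  have split: "\<psi> i = (\<Sum>n<N. v n * \<phi> (int i - int n)) + tail N i" for i N
  proof -
    have bnd: "summable (\<lambda>k. fps_nth M k * g k)" if "\<And>k. norm (g k) \<le> B" for g B
    proof (rule summable_norm_cancel, rule summable_comparison_test)
      show "summable (\<lambda>k. norm (fps_nth M k) * B)"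
        by (intro summable_mult2 geom_bounded_summable[OF M \<rho>])
      show "\<exists>N. \<forall>n\<ge>N. norm (norm (fps_nth M n * g n)) \<le> norm (fps_nth M n) * B"
        using that by (auto simp: norm_mult intro!: mult_left_mono)
    qed
    have sP: "summable (\<lambda>k. fps_nth M k * int_coeff P (int i - int n + int k))" for n
      by (rule bnd[of _ C]) (rule norm_int_coeff_le(2)[OF P \<rho> C])
    have "(\<Sum>n<N. v n * \<phi> (int i - int n)) =
          (\<Sum>n<N. \<Sum>k. v n * (fps_nth M k * int_coeff P (int i - int n + int k)))"
      by (simp add: \<phi>_def symbol_coeff_def suminf_mult[OF sP])
    also have "\<dots> = (\<Sum>k. \<Sum>n<N. v n * (fps_nth M k * int_coeff P (int i - int n + int k)))"
      by (rule suminf_sum[symmetric]) (intro summable_mult sP)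
    also have "\<dots> + tail N i = (\<Sum>k. (\<Sum>n<N. v n * (fps_nth M k * int_coeff P (int i - int n + int k))) +
                    fps_nth M k * (\<Sum>n\<in>{N..i + k}. v n * fps_nth P (i + k - n)))"
      unfolding tail_def
      by (intro suminf_add summable_sum summable_mult sP bnd[OF e])
    also have "\<dots> = (\<Sum>k. fps_nth M k * u (i + k))"
    proof (intro suminf_cong)
      fix k
      have "(\<Sum>n<N. v n * int_coeff P (int i - int n + int k)) + (\<Sum>n\<in>{N..i + k}. v n * fps_nth P (i + k - n))
            = (\<Sum>n\<in>{..<N} \<inter> {..i+k}. v n * fps_nth P (i + k - n)) + (\<Sum>n\<in>{N..i + k}. v n * fps_nth P (i + k - n))"
      proof -
        have *: "int_coeff P (int i - int n + int k) = fps_nth P (i + k - n)" if "n \<le> i + k" for n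
        proof -
          have "int i - int n + int k = int (i + k - n)" using that by simp
          thus ?thesis unfolding int_coeff_def by (metis nat_int of_nat_0_le_iff)
        qed
        have "(\<Sum>n<N. v n * int_coeff P (int i - int n + int k)) =
              (\<Sum>n\<in>{..<N} \<inter> {..i+k}. v n * fps_nth P (i + k - n))"
        proof (rule sum.mono_neutral_cong_right)
          show "\<forall>n\<in>{..<N} - {..<N} \<inter> {..i+k}. v n * int_coeff P (int i - int n + int k) = 0"
            by (auto simp: int_coeff_def)
        qed (auto simp: *)
        thus ?thesis by simp
      qed
      also have "\<dots> = (\<Sum>n\<in>({..<N} \<inter> {..i+k}) \<union> {N..i + k}. v n * fps_nth P (i + k - n))"
        by (rule sum.union_disjoint[symmetric]) auto
      also have "({..<N} \<inter> {..i+k}) \<union> {N..i + k} = {..i + k}" by auto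
      also have "(\<Sum>n\<le>i + k. v n * fps_nth P (i + k - n)) = u (i + k)" by (rule vP)
      finally have "fps_nth M k * ((\<Sum>n<N. v n * int_coeff P (int i - int n + int k)) +
          (\<Sum>n\<in>{N..i + k}. v n * fps_nth P (i + k - n))) = fps_nth M k * u (i + k)"
        by simp
      thus "(\<Sum>n<N. v n * (fps_nth M k * int_coeff P (int i - int n + int k))) +
             fps_nth M k * (\<Sum>n\<in>{N..i + k}. v n * fps_nth P (i + k - n)) = fps_nth M k * u (i + k)"
        by (simp add: distrib_left sum_distrib_left mult_ac)
    qed
    also have "\<dots> = \<psi> i" by (rule \<psi>u[symmetric])
    finally show ?thesis by simp
  qed
  \<comment> \<open>For \<open>i < N\<close> we have \<open>\<tau> ^ N \<le> s ^ N * s ^ i\<close>: half of the smallness of the tail is spent on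
      making it an admissible border.\<close>
  define s where "s = sqrt \<tau>"
  have s: "0 < s" "s < 1" "\<tau> = s * s" using \<tau> by (auto simp: s_def)
  have \<rho>s: "\<rho> \<le> s"
  proof -
    have "s * s \<le> s * 1" using s by (intro mult_left_mono) auto
    thus ?thesis using \<tau>(1) s(3) by simp
  qed
  define C' where "C' = max C K2"
  have C': "C \<le> C'" "K2 \<le> C'" "0 \<le> C'" using C by (auto simp: C'_def)
  obtain K where K: "K \<ge> 0"
    "\<And>M P (v :: nat \<Rightarrow> complex) N. admissible C' s M P \<Longrightarrow> (\<And>i. i < N \<Longrightarrow> norm (v i) \<le> C' * s ^ i) \<Longrightarrow>
       norm (bordered_det (symbol_coeff M P) v N) \<le> K * norm (fps_nth P 0) ^ N"
    using norm_bordered_det_le[of s C'] s C' by (metis less_imp_le)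
  show thesis
  proof (rule that[of K s])
    fix N :: nat assume N: "N \<ge> 1"
    obtain c where c: "\<And>v. bordered_det \<phi> v N = (\<Sum>i<N. v i * c i)"
      using bordered_det_linear[OF N, of \<phi>] by metis
    have "bordered_det \<phi> \<psi> N = (\<Sum>i<N. (\<Sum>n<N. v n * \<phi> (int i - int n)) * c i) + (\<Sum>i<N. tail N i * c i)"
      unfolding c by (subst split[of _ N]) (simp add: distrib_right sum.distrib)
    also have "(\<Sum>i<N. (\<Sum>n<N. v n * \<phi> (int i - int n)) * c i) =
               (\<Sum>n<N. v n * bordered_det \<phi> (\<lambda>i. \<phi> (int i - int n)) N)"
      unfolding c sum_distrib_left sum_distrib_right by (subst sum.swap) (simp add: mult_ac)
    also have "\<dots> = (\<Sum>n<N. if n = 0 then v 0 * toeplitz_det \<phi> N else 0)"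
      by (rule sum.cong) (auto simp: bordered_det_shifted bordered_det_self)
    also have "\<dots> = v 0 * toeplitz_det \<phi> N" using N by simp
    also have "v 0 = inverse (fps_nth P 0) * (\<Sum>b. fps_nth (inverse M) b * \<psi> b)"
      by (simp add: v_def u_def)
    also have "(\<Sum>i<N. tail N i * c i) = s ^ N * bordered_det \<phi> (\<lambda>i. tail N i / s ^ N) N"
      unfolding c sum_distrib_left using s by simp
    finally have "bordered_det \<phi> \<psi> N - inverse (fps_nth P 0) * (\<Sum>b. fps_nth (inverse M) b * \<psi> b) * toeplitz_det \<phi> N
        = s ^ N * bordered_det \<phi> (\<lambda>i. tail N i / s ^ N) N" by simp
    also have "norm \<dots> \<le> s ^ N * (K * norm (fps_nth P 0) ^ N)"
      unfolding norm_mult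
    proof (intro mult_mono)
      show "norm (bordered_det \<phi> (\<lambda>i. tail N i / s ^ N) N) \<le> K * norm (fps_nth P 0) ^ N"
        unfolding \<phi>_def
      proof (rule K(2))
        show "admissible C' s M P"
          by (rule admissible_mono[OF adm]) (use \<rho> C C' \<rho>s in auto)
        fix i assume i: "i < N"
        have "norm (tail N i) \<le> K2 * (s ^ N * s ^ N)"
          using tail[of N i] by (simp add: s(3) power_mult_distrib)
        also have "\<dots> \<le> C' * (s ^ i * s ^ N)"
          using s C' i K2 by (intro mult_mono power_decreasing) auto
        finally show "norm (tail N i / s ^ N) \<le> C' * s ^ i"
          using s by (simp add: norm_divide norm_power divide_simps mult_ac)
      qed
    qed (use s in \<open>auto simp: norm_power\<close>)
    finally show "norm (bordered_det (symbol_coeff M P) \<psi> N -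
        inverse (fps_nth P 0) * (\<Sum>b. fps_nth (inverse M) b * \<psi> b) * toeplitz_det (symbol_coeff M P) N)
       \<le> K * s ^ N * norm (fps_nth P 0) ^ N" by (simp add: \<phi>_def mult_ac)
  qed (use K s in auto)
qed

section \<open>The constant for polynomial symbols\<close>

text \<open>Subtracting \<open>x\<close> times the preceding row from each row is multiplication by
  a unitriangular matrix. It turns the border x^i into the first unit vector, and the minor that
  remains carries f n - x f (n - 1).\<close>

lemma toeplitz_det_times_linear:
  "toeplitz_det (\<lambda>n. f n - x * f (n - 1)) N = bordered_det f (\<lambda>i. x ^ i) (Suc N)"
proof -
  define A where "A = Matrix.mat (Suc N) (Suc N) (\<lambda>(i, j). if j = 0 then x ^ i else f (int i - int j))"
  define E where "E = Matrix.mat (Suc N) (Suc N) (\<lambda>(i, j). if i = j then 1 else if i = Suc j then - x else 0)"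
  have carr: "A \<in> carrier_mat (Suc N) (Suc N)" "E \<in> carrier_mat (Suc N) (Suc N)"
    by (auto simp: A_def E_def)
  have EA: "(E * A) $$ (i, j) = A $$ (i, j) - (if i = 0 then 0 else x * A $$ (i - 1, j))"
    if ij: "i < Suc N" "j < Suc N" for i j
  proof -
    have "(E * A) $$ (i, j) = (\<Sum>k\<in>{0..<Suc N}. E $$ (i, k) * A $$ (k, j))"
      by (rule mult_mat_entry[OF carr(2,1) ij])
    also have "\<dots> = (\<Sum>k\<in>{0..<Suc N}. (if k = i then A $$ (i, j) else 0) -
                     (if i \<noteq> 0 \<and> k = i - 1 then x * A $$ (i - 1, j) else 0))"
      by (rule sum.cong) (use ij in \<open>auto simp: E_def\<close>)
    also have "\<dots> = A $$ (i, j) - (if i = 0 then 0 else x * A $$ (i - 1, j))"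
      using ij by (simp add: sum_subtractf del: sum.op_ivl_Suc)
    finally show ?thesis .
  qed
  have "Determinant.det E = prod_list (diag_mat E)"
    by (rule det_lower_triangular[OF _ carr(2)]) (auto simp: E_def)
  also have "\<dots> = 1 ^ Suc N"
    by (rule prod_list_diag_const[OF _ carr(2)]) (auto simp: E_def)
  finally have "Determinant.det A = Determinant.det (E * A)"
    using carr by (simp add: det_mult[of _ "Suc N"])
  also have "\<dots> = (\<Sum>i<Suc N. (E * A) $$ (i, 0) * cofactor (E * A) i 0)"
    by (rule laplace_expansion_column) (use carr in auto)
  also have "\<dots> = (\<Sum>i<Suc N. if i = 0 then cofactor (E * A) 0 0 else 0)"
  proof (rule sum.cong)
    fix i assume "i \<in> {..<Suc N}"
    hence i: "i < Suc N" by simp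
    have "(E * A) $$ (i, 0) = of_bool (i = 0)"
      unfolding EA[OF i zero_less_Suc] using i by (cases i) (auto simp: A_def)
    thus "(E * A) $$ (i, 0) * cofactor (E * A) i 0 = (if i = 0 then cofactor (E * A) 0 0 else 0)"
      by simp
  qed auto
  also have "\<dots> = Determinant.det (mat_delete (E * A) 0 0)"
    by (simp add: cofactor_def)
  also have "mat_delete (E * A) 0 0 = Matrix.mat N N (\<lambda>(i, j). f (int i - int j) - x * f (int i - int j - 1))"
  proof (rule eq_matI)
    fix i j
    assume "i < dim_row (Matrix.mat N N (\<lambda>(i, j). f (int i - int j) - x * f (int i - int j - 1)))"
      "j < dim_col (Matrix.mat N N (\<lambda>(i, j). f (int i - int j) - x * f (int i - int j - 1)))"
    hence ij: "i < N" "j < N" by auto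
    have "mat_delete (E * A) 0 0 $$ (i, j) = (E * A) $$ (Suc i, Suc j)"
      using ij carr by (subst mat_delete_index[of _ N, symmetric]) auto
    also have "\<dots> = A $$ (Suc i, Suc j) - x * A $$ (i, Suc j)"
      using EA[of "Suc i" "Suc j"] ij by simp
    also have "\<dots> = f (int i - int j) - x * f (int i - int j - 1)"
      using ij by (simp add: A_def algebra_simps)
    finally show "mat_delete (E * A) 0 0 $$ (i, j) =
        Matrix.mat N N (\<lambda>(i, j). f (int i - int j) - x * f (int i - int j - 1)) $$ (i, j)"
      using ij by simp
  qed (use carr in auto)
  finally show ?thesis
    unfolding toeplitz_det_def bordered_det_def A_def by simp
qed

lemma symbol_coeff_times_linear:
  assumes M: "geom_bounded C \<rho> (fps_nth M)" and P: "geom_bounded C \<rho> (fps_nth P)"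
    and \<rho>: "0 \<le> \<rho>" "\<rho> < 1" and C: "0 \<le> C"
  shows "symbol_coeff M ((1 - fps_const x * fps_X) * P) n = symbol_coeff M P n - x * symbol_coeff M P (n - 1)"
proof -
  have s: "summable (\<lambda>k. fps_nth M k * int_coeff P (n + int k))" for n
  proof (rule summable_norm_cancel, rule summable_comparison_test)
    show "summable (\<lambda>k. norm (fps_nth M k) * C)"
      by (intro summable_mult2 geom_bounded_summable[OF M \<rho>])
    show "\<exists>N. \<forall>k\<ge>N. norm (norm (fps_nth M k * int_coeff P (n + int k))) \<le> norm (fps_nth M k) * C"
      using norm_int_coeff_le(2)[OF P \<rho> C] by (auto simp: norm_mult intro!: mult_left_mono)
  qed
  have ic: "int_coeff ((1 - fps_const x * fps_X) * P) n = int_coeff P n - x * int_coeff P (n - 1)" for n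
    by (cases "n = 0") (auto simp: int_coeff_def left_diff_distrib mult.assoc nat_diff_distrib)
  have "symbol_coeff M ((1 - fps_const x * fps_X) * P) n =
        (\<Sum>k. fps_nth M k * int_coeff P (n + int k) - x * (fps_nth M k * int_coeff P (n - 1 + int k)))"
    unfolding symbol_coeff_def ic by (intro suminf_cong) (simp add: algebra_simps)
  also have "\<dots> = symbol_coeff M P n - x * symbol_coeff M P (n - 1)"
    unfolding symbol_coeff_def
    by (subst suminf_diff[symmetric]) (auto intro!: summable_mult s simp: suminf_mult[OF s])
  finally show ?thesis .
qed

definition szego_limit :: "complex fps \<Rightarrow> complex fps \<Rightarrow> complex \<Rightarrow> bool" where
  "szego_limit M P L \<longleftrightarrow> (\<lambda>N. toeplitz_det (symbol_coeff M P) N / fps_nth P 0 ^ N) \<longlonglongrightarrow> L"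

text \<open>The border x^i decays because of norm x < 1, and its weight in the bordered asymptotics
  is (1/G) times the value of 1/M at x.\<close>

lemma szego_limit_times_linear:
  assumes adm: "admissible C \<rho> M P" and \<rho>: "0 \<le> \<rho>" "\<rho> < 1" and C: "0 \<le> C"
    and x: "norm x < 1" and L: "szego_limit M P L"
  shows "szego_limit M ((1 - fps_const x * fps_X) * P) ((\<Sum>b. fps_nth (inverse M) b * x ^ b) * L)"
proof -
  define \<rho>' C' where "\<rho>' = max \<rho> (norm x)" and "C' = max C 1"
  have \<rho>': "\<rho> \<le> \<rho>'" "norm x \<le> \<rho>'" "0 \<le> \<rho>'" "\<rho>' < 1" and C': "C \<le> C'" "1 \<le> C'" "0 \<le> C'"
    using \<rho> x by (auto simp: \<rho>'_def C'_def)
  define S where "S = (\<Sum>b. fps_nth (inverse M) b * x ^ b)"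
  define G where "G = fps_nth P 0"
  define \<phi> where "\<phi> = symbol_coeff M P"
  have G: "G \<noteq> 0" using adm by (simp add: admissible_def G_def)
  have "geom_bounded C' \<rho>' (\<lambda>i. x ^ i)"
    unfolding geom_bounded_def
  proof
    fix n
    have "norm (x ^ n) \<le> 1 * \<rho>' ^ n"
      using \<rho>' by (simp add: norm_power power_mono)
    also have "\<dots> \<le> C' * \<rho>' ^ n" using C' \<rho>' by (intro mult_right_mono) auto
    finally show "norm (x ^ n) \<le> C' * \<rho>' ^ n" .
  qed
  with admissible_mono[OF adm \<rho>(1) \<rho>'(1) C'(1) C]
  obtain K \<tau> where K: "K \<ge> 0" "0 < \<tau>" "\<tau> < 1"
    "\<And>N. N \<ge> 1 \<Longrightarrow> norm (bordered_det \<phi> (\<lambda>i. x ^ i) N - inverse G * S * toeplitz_det \<phi> N) \<le> K * \<tau> ^ N * norm G ^ N"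
    unfolding S_def G_def \<phi>_def by (rule bordered_det_asymp[OF _ \<rho>'(3,4) C'(3)]) blast
  have "(\<lambda>N. bordered_det \<phi> (\<lambda>i. x ^ i) (Suc N) / G ^ Suc N - inverse G * S * (toeplitz_det \<phi> (Suc N) / G ^ Suc N)) \<longlonglongrightarrow> 0"
  proof (rule Lim_null_comparison)
    show "\<forall>\<^sub>F N in sequentially. norm (bordered_det \<phi> (\<lambda>i. x ^ i) (Suc N) / G ^ Suc N - inverse G * S * (toeplitz_det \<phi> (Suc N) / G ^ Suc N)) \<le> K * \<tau> ^ Suc N"
    proof (intro always_eventually allI)
      fix N
      have "bordered_det \<phi> (\<lambda>i. x ^ i) (Suc N) / G ^ Suc N - inverse G * S * (toeplitz_det \<phi> (Suc N) / G ^ Suc N) =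
            (bordered_det \<phi> (\<lambda>i. x ^ i) (Suc N) - inverse G * S * toeplitz_det \<phi> (Suc N)) / G ^ Suc N"
        by (simp only: diff_divide_distrib times_divide_eq_right)
      also have "norm \<dots> \<le> K * \<tau> ^ Suc N"
        using K(4)[of "Suc N"] G unfolding norm_divide norm_power
        by (subst pos_divide_le_eq) auto
      finally show "norm (bordered_det \<phi> (\<lambda>i. x ^ i) (Suc N) / G ^ Suc N - inverse G * S * (toeplitz_det \<phi> (Suc N) / G ^ Suc N)) \<le> K * \<tau> ^ Suc N" .
    qed
    have "(\<lambda>N. K * \<tau> ^ Suc N) \<longlonglongrightarrow> K * 0"
      by (intro tendsto_mult tendsto_const LIMSEQ_Suc LIMSEQ_power_zero) (use K in auto)
    thus "(\<lambda>N. K * \<tau> ^ Suc N) \<longlonglongrightarrow> 0" by simp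
  qed
  moreover have "(\<lambda>N. inverse G * S * (toeplitz_det \<phi> (Suc N) / G ^ Suc N)) \<longlonglongrightarrow> inverse G * S * L"
    by (rule tendsto_mult[OF tendsto_const LIMSEQ_Suc]) (use L in \<open>simp add: szego_limit_def G_def \<phi>_def\<close>)
  ultimately have "(\<lambda>N. (bordered_det \<phi> (\<lambda>i. x ^ i) (Suc N) / G ^ Suc N - inverse G * S * (toeplitz_det \<phi> (Suc N) / G ^ Suc N)) +
                     inverse G * S * (toeplitz_det \<phi> (Suc N) / G ^ Suc N)) \<longlonglongrightarrow> 0 + inverse G * S * L"
    by (rule tendsto_add)
  \<comment> \<open>The bordered determinant has size N + 1 and is normalized by G^(N + 1), whereas
    the new symbol, whose mean is again G, needs G^N; the extra factor cancels 1/G.\<close>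
  hence "(\<lambda>N. G * (bordered_det \<phi> (\<lambda>i. x ^ i) (Suc N) / G ^ Suc N)) \<longlonglongrightarrow> G * (inverse G * S * L)"
    by (intro tendsto_mult tendsto_const) simp
  moreover have "G * (bordered_det \<phi> (\<lambda>i. x ^ i) (Suc N) / G ^ Suc N) =
      toeplitz_det (symbol_coeff M ((1 - fps_const x * fps_X) * P)) N /
      fps_nth ((1 - fps_const x * fps_X) * P) 0 ^ N" for N
  proof -
    have "symbol_coeff M ((1 - fps_const x * fps_X) * P) = (\<lambda>n. \<phi> n - x * \<phi> (n - 1))"
      unfolding \<phi>_def by (rule ext, rule symbol_coeff_times_linear[of C \<rho>])
         (use adm \<rho> C in \<open>auto simp: admissible_def\<close>)
    thus ?thesis using G by (simp add: toeplitz_det_times_linear G_def)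
  qed
  moreover have "G * (inverse G * S * L) = S * L" using G by simp
  ultimately show ?thesis
    unfolding szego_limit_def S_def[symmetric] by (simp only:)
qed

text \<open>The n-th coefficient is n times that of log P, which is the form in which the positive
  coefficients of log \<phi> enter E. It needs no logarithm of P and turns products into
  sums.\<close>

definition fps_log_deriv :: "complex fps \<Rightarrow> complex fps" where
  "fps_log_deriv P = fps_X * fps_deriv P * inverse P"

lemma fps_log_deriv_mult:
  assumes "fps_nth P 0 \<noteq> 0" "fps_nth Q 0 \<noteq> 0"
  shows "fps_log_deriv (P * Q) = fps_log_deriv P + fps_log_deriv Q"
proof -
  have "P * inverse P = 1" "Q * inverse Q = 1"
    using assms by (auto simp: inverse_mult_eq_1')
  moreover have "fps_X * (fps_deriv P * Q + P * fps_deriv Q) * (inverse P * inverse Q) =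
         fps_X * fps_deriv P * inverse P * (Q * inverse Q) + fps_X * fps_deriv Q * inverse Q * (P * inverse P)"
    by (simp add: algebra_simps)
  ultimately have "fps_X * (fps_deriv P * Q + P * fps_deriv Q) * (inverse P * inverse Q) =
         fps_X * fps_deriv P * inverse P + fps_X * fps_deriv Q * inverse Q" by simp
  thus ?thesis
    by (simp add: fps_log_deriv_def fps_inverse_mult add.commute mult.commute)
qed

lemma fps_inverse_linear: "inverse (1 - fps_const x * fps_X) = Abs_fps (\<lambda>n. (x :: complex) ^ n)"
  using one_minus_const_fps_X_neg_power'[of 1 x] by simp

text \<open>In terms of logarithms: log(1 - x z) is minus the sum of x^n z^n / n.\<close>

lemma fps_log_deriv_linear_nth:
  "fps_nth (fps_log_deriv (1 - fps_const x * fps_X)) n = (if n = 0 then 0 else - (x ^ n))"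
proof -
  have "fps_log_deriv (1 - fps_const x * fps_X) = fps_X * (fps_const (- x) * Abs_fps (\<lambda>n. x ^ n))"
    unfolding fps_log_deriv_def fps_inverse_linear by (simp add: mult.assoc)
  thus ?thesis by (cases n) auto
qed

lemma geom_bounded_mult:
  assumes f: "geom_bounded C \<rho> (fps_nth f)" and g: "geom_bounded D \<rho> (fps_nth g)"
    and \<rho>: "0 \<le> \<rho>" "\<rho> < \<tau>" and "0 \<le> C" "0 \<le> D"
  obtains K where "K > 0" "geom_bounded K \<tau> (fps_nth (f * g))"
proof -
  obtain K0 where K0: "K0 > 0" "\<And>n. real (Suc n) * \<rho> ^ n \<le> K0 * \<tau> ^ n"
    using linear_times_geometric_le[OF \<rho>] by metis
  have "geom_bounded (C * D * K0) \<tau> (fps_nth (f * g))"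
    unfolding geom_bounded_def
  proof
    fix n
    have "norm (fps_nth (f * g) n) = norm (\<Sum>k\<le>n. fps_nth f (n - k) * fps_nth g k)"
      unfolding mult.commute[of f g] fps_mult_nth by (simp add: atLeast0AtMost mult.commute)
    also have "\<dots> \<le> C * D * (real (Suc n) * \<rho> ^ n)"
      using assms by (intro norm_cauchy_product_le geom_boundedD[OF g]) auto
    also have "\<dots> \<le> C * D * (K0 * \<tau> ^ n)"
      using assms by (intro mult_left_mono K0) auto
    finally show "norm (fps_nth (f * g) n) \<le> C * D * K0 * \<tau> ^ n" by (simp add: mult_ac)
  qed
  hence "geom_bounded (C * D * K0 + 1) \<tau> (fps_nth (f * g))"
    by (rule geom_bounded_mono) (use assms K0 in auto)
  thus thesis using assms K0 by (intro that[of "C * D * K0 + 1"]) (auto intro!: add_nonneg_pos)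
qed

text \<open>Each factor costs a larger constant and a worse rate, since a product of two
  geometrically bounded series decays only at a rate above both. Uniform constants for the
  truncations are therefore obtained separately, not by iterating this.\<close>

lemma admissible_times_linear:
  assumes adm: "admissible C \<rho> M P" and \<rho>: "0 \<le> \<rho>" "\<rho> < 1" and C: "0 \<le> C" and x: "norm x < 1"
  obtains C' \<rho>' where "0 \<le> C'" "0 \<le> \<rho>'" "\<rho>' < 1" "admissible C' \<rho>' M ((1 - fps_const x * fps_X) * P)"
proof -
  define \<rho>1 where "\<rho>1 = max (1/2) (max \<rho> (norm x))"
  define \<tau> where "\<tau> = (1 + \<rho>1) / 2"
  have \<rho>1: "0 \<le> \<rho>1" "\<rho>1 < 1" "\<rho> \<le> \<rho>1" "norm x \<le> \<rho>1" "1/2 \<le> \<rho>1" using \<rho> x by (auto simp: \<rho>1_def)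
  have \<tau>: "\<rho>1 < \<tau>" "\<tau> < 1" "0 \<le> \<tau>" using \<rho>1 by (auto simp: \<tau>_def)
  have P: "geom_bounded C \<rho>1 (fps_nth P)" "geom_bounded C \<rho>1 (fps_nth (inverse P))"
    using adm \<rho> \<rho>1 C unfolding admissible_def by (auto intro: geom_bounded_mono)
  have 1: "geom_bounded 1 \<rho>1 (fps_nth (1 - fps_const x * fps_X))"
    unfolding geom_bounded_def
  proof
    fix n show "norm (fps_nth (1 - fps_const x * fps_X) n) \<le> 1 * \<rho>1 ^ n"
      using \<rho>1 by (cases n) auto
  qed
  have 2: "geom_bounded 1 \<rho>1 (fps_nth (inverse (1 - fps_const x * fps_X)))"
    using \<rho>1 by (auto simp: fps_inverse_linear geom_bounded_def norm_power intro!: power_mono)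
  obtain K1 where K1: "K1 > 0" "geom_bounded K1 \<tau> (fps_nth ((1 - fps_const x * fps_X) * P))"
    using geom_bounded_mult[OF 1 P(1) \<rho>1(1) \<tau>(1)] C by (metis zero_le_one)
  obtain K2 where K2: "K2 > 0" "geom_bounded K2 \<tau> (fps_nth (inverse (1 - fps_const x * fps_X) * inverse P))"
    using geom_bounded_mult[OF 2 P(2) \<rho>1(1) \<tau>(1)] C by (metis zero_le_one)
  define C' where "C' = max C (max K1 K2)"
  have "admissible C' \<tau> M ((1 - fps_const x * fps_X) * P)"
    unfolding admissible_def
  proof (intro conjI)
    show "geom_bounded C' \<tau> (fps_nth M)" "geom_bounded C' \<tau> (fps_nth (inverse M))"
      using adm \<rho>1 \<tau> \<rho> C unfolding admissible_def C'_def
      by (auto elim!: geom_bounded_mono)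
    show "geom_bounded C' \<tau> (fps_nth ((1 - fps_const x * fps_X) * P))"
      by (rule geom_bounded_mono[OF K1(2)]) (use K1 \<tau> in \<open>auto simp: C'_def\<close>)
    show "geom_bounded C' \<tau> (fps_nth (inverse ((1 - fps_const x * fps_X) * P)))"
      unfolding fps_inverse_mult
      by (rule geom_bounded_mono[OF K2(2)]) (use K2 \<tau> in \<open>auto simp: C'_def\<close>)
    show "fps_nth M 0 = 1" "fps_nth ((1 - fps_const x * fps_X) * P) 0 \<noteq> 0"
      using adm by (auto simp: admissible_def)
  qed
  moreover have "0 \<le> C'" using C by (simp add: C'_def)
  ultimately show thesis using \<tau> that by blast
qed

text \<open>The symbol c M(1/z) has no coefficients of positive index, so its Toeplitz matrix is
  upper triangular with diagonal \<open>c\<close>.\<close>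

lemma toeplitz_det_const:
  assumes M0: "fps_nth M 0 = 1"
  shows "toeplitz_det (symbol_coeff M (fps_const c)) N = c ^ N"
proof -
  have sc: "symbol_coeff M (fps_const c) n = (if n \<le> 0 then fps_nth M (nat (-n)) * c else 0)" for n
  proof -
    have "fps_nth M k * int_coeff (fps_const c) (n + int k) =
          (if n \<le> 0 \<and> k = nat (-n) then fps_nth M (nat (-n)) * c else 0)" for k
      by (auto simp: int_coeff_def)
    thus ?thesis
      unfolding symbol_coeff_def
      using sums_single[of "nat (-n)" "\<lambda>_. fps_nth M (nat (-n)) * c"] by (auto simp: sums_iff)
  qed
  define A where "A = Matrix.mat N N (\<lambda>(i, j). symbol_coeff M (fps_const c) (int i - int j))"
  have A: "A \<in> carrier_mat N N" by (simp add: A_def)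
  have "Determinant.det A = prod_list (diag_mat A)"
    by (rule det_upper_triangular[OF _ A]) (auto simp: A_def upper_triangular_def sc)
  also have "\<dots> = c ^ N"
    by (rule prod_list_diag_const[OF _ A]) (auto simp: A_def sc M0)
  finally show ?thesis by (simp add: toeplitz_det_def A_def)
qed

text \<open>Here \<open>l\<close> stands for the coefficients of log \<phi>_- in 1/z. Each root 1/x
  changes the logarithmic derivative by -x^n in degree n, which adds minus the sum of l_n x^n to the
  exponent; this matches the factor 1/M(x) of the limit. Admissibility is carried through the
  induction for the bordered asymptotics, and the bound on the logarithmic derivative for
  convergence of the exponent.\<close>

lemma szego_limit_poly:
  fixes q :: "complex poly"
  assumes M: "geom_bounded C \<rho> (fps_nth M)" "geom_bounded C \<rho> (fps_nth (inverse M))" "fps_nth M 0 = 1"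
    and \<rho>: "0 \<le> \<rho>" "\<rho> < 1" and C: "0 \<le> C"
    and l: "summable (\<lambda>n. norm (l n))" "l 0 = 0"
    and Ml: "\<And>x. norm x < 1 \<Longrightarrow> (\<Sum>b. fps_nth (inverse M) b * x ^ b) = exp (- (\<Sum>n. l n * x ^ n))"
    and q: "q \<noteq> 0" "\<And>z. poly q z = 0 \<Longrightarrow> norm z > 1"
  shows "(\<exists>C \<rho>. 0 \<le> C \<and> 0 \<le> \<rho> \<and> \<rho> < 1 \<and> admissible C \<rho> M (fps_of_poly q)) \<and>
         (\<exists>B. \<forall>n. norm (fps_nth (fps_log_deriv (fps_of_poly q)) n) \<le> B) \<and>
         szego_limit M (fps_of_poly q) (exp (\<Sum>n. l n * fps_nth (fps_log_deriv (fps_of_poly q)) n))"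
  using q
proof (induction "degree q" arbitrary: q)
  case 0
  then obtain c where c: "q = [:c:]" by (metis degree_eq_zeroE)
  have c0: "c \<noteq> 0" using 0 c by auto
  have P: "fps_of_poly q = fps_const c" by (simp add: c fps_of_poly_const)
  have ld: "fps_log_deriv (fps_const c) = 0" by (simp add: fps_log_deriv_def)
  define C' where "C' = max C (max (norm c) (norm (inverse c)))"
  have gc: "geom_bounded C' \<rho> (fps_nth (fps_const d))" if "norm d \<le> C'" for d
    unfolding geom_bounded_def
  proof
    fix n show "norm (fps_nth (fps_const d) n) \<le> C' * \<rho> ^ n"
      using that \<rho> C by (cases n) (auto simp: C'_def intro: order_trans)
  qed
  have "admissible C' \<rho> M (fps_const c)"
    unfolding admissible_def
  proof (intro conjI)
    show "geom_bounded C' \<rho> (fps_nth M)" "geom_bounded C' \<rho> (fps_nth (inverse M))"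
      by (rule geom_bounded_mono[OF M(1)] geom_bounded_mono[OF M(2)]; use \<rho> C in \<open>simp add: C'_def\<close>)+
    have "inverse (fps_const c) = fps_const (inverse c)" by (simp add: fps_const_inverse)
    thus "geom_bounded C' \<rho> (fps_nth (inverse (fps_const c)))"
      by (simp only:) (rule gc, simp add: C'_def)
    show "geom_bounded C' \<rho> (fps_nth (fps_const c))"
      by (rule gc) (simp add: C'_def)
  qed (use M c0 in auto)
  moreover have "szego_limit M (fps_const c) 1"
    unfolding szego_limit_def using c0 by (simp add: toeplitz_det_const[OF M(3)])
  moreover have "0 \<le> C'" using C by (auto simp: C'_def)
  ultimately show ?case using \<rho> unfolding P ld by auto
next
  case (Suc d)
  from Suc.hyps(2) have "\<not> constant (poly q)" by (simp add: constant_degree)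
  then obtain r where r: "poly q r = 0" using fundamental_theorem_of_algebra by blast
  have r1: "norm r > 1" by (rule Suc.prems(2)[OF r])
  hence r0: "r \<noteq> 0" by auto
  from r obtain q1 where q1: "q = [:-r, 1:] * q1" by (auto simp: poly_eq_0_iff_dvd elim: dvdE)
  \<comment> \<open>Moving the factor -r to the cofactor gives the linear factor 1 - x z the
    constant term 1.\<close>
  define q2 where "q2 = Polynomial.smult (-r) q1"
  define x where "x = inverse r"
  have x: "norm x < 1" using r1 by (simp add: x_def norm_inverse inverse_less_1_iff)
  have q2: "q = [:1, -x:] * q2"
  proof -
    have "[:-r, 1:] = Polynomial.smult (-r) [:1, -x:]" using r0 by (simp add: x_def)
    thus ?thesis unfolding q1 q2_def by (simp only: mult_smult_left mult_smult_right)
  qed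
  have q20: "q2 \<noteq> 0" using Suc.prems(1) q2 by auto
  have "degree q = degree [:1, -x:] + degree q2"
    unfolding q2 using q20 by (intro degree_mult_eq) auto
  hence deg: "d = degree q2" using Suc.hyps(2) r0 by (simp add: x_def)
  have root: "norm z > 1" if "poly q2 z = 0" for z
    by (rule Suc.prems(2)) (simp add: q2 that)
  define P where "P = fps_of_poly q2"
  have P: "fps_of_poly q = (1 - fps_const x * fps_X) * P"
    by (simp add: q2 P_def fps_of_poly_mult fps_of_poly_pCons mult.commute)
  from Suc.hyps(1)[OF deg q20 root] obtain C1 \<rho>1 B where
    adm: "0 \<le> C1" "0 \<le> \<rho>1" "\<rho>1 < 1" "admissible C1 \<rho>1 M P"
    and B: "\<And>n. norm (fps_nth (fps_log_deriv P) n) \<le> B"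
    and lim: "szego_limit M P (exp (\<Sum>n. l n * fps_nth (fps_log_deriv P) n))"
    unfolding P_def by blast
  have P0: "fps_nth P 0 \<noteq> 0" using adm by (simp add: admissible_def)
  have ld: "fps_nth (fps_log_deriv (fps_of_poly q)) n =
            (if n = 0 then 0 else - (x ^ n)) + fps_nth (fps_log_deriv P) n" for n
    unfolding P by (subst fps_log_deriv_mult) (auto simp: P0 fps_log_deriv_linear_nth)
  have sl: "summable (\<lambda>n. l n * g n)" if "\<And>n. norm (g n) \<le> D" for g :: "nat \<Rightarrow> complex" and D
    by (rule summable_norm_cancel, rule summable_comparison_test[OF _ summable_mult2[OF l(1), of D]])
       (use that in \<open>auto simp: norm_mult intro!: mult_left_mono\<close>)
  have xn: "norm (x ^ n) \<le> 1" for n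
    using x by (simp add: norm_power power_le_one)
  have "(\<Sum>n. l n * fps_nth (fps_log_deriv (fps_of_poly q)) n) =
        (\<Sum>n. l n * fps_nth (fps_log_deriv P) n - l n * x ^ n)"
    unfolding ld by (intro suminf_cong) (auto simp: l(2) algebra_simps)
  also have "\<dots> = (\<Sum>n. l n * fps_nth (fps_log_deriv P) n) - (\<Sum>n. l n * x ^ n)"
    by (intro suminf_diff[symmetric] sl[OF B] sl[OF xn])
  finally have "exp (\<Sum>n. l n * fps_nth (fps_log_deriv (fps_of_poly q)) n) =
     (\<Sum>b. fps_nth (inverse M) b * x ^ b) * exp (\<Sum>n. l n * fps_nth (fps_log_deriv P) n)"
    using Ml[OF x] by (simp add: exp_diff exp_minus divide_inverse mult.commute)
  hence "szego_limit M (fps_of_poly q) (exp (\<Sum>n. l n * fps_nth (fps_log_deriv (fps_of_poly q)) n))"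
    using szego_limit_times_linear[OF adm(4,2,3,1) x lim] by (simp add: P)
  moreover have "norm (fps_nth (fps_log_deriv (fps_of_poly q)) n) \<le> 1 + B" for n
    unfolding ld by (rule order_trans[OF norm_triangle_ineq add_mono[OF _ B]]) (use xn[of n] in auto)
  moreover obtain C' \<rho>' where "0 \<le> C'" "0 \<le> \<rho>'" "\<rho>' < 1" "admissible C' \<rho>' M (fps_of_poly q)"
    using admissible_times_linear[OF adm(4,2,3,1) x] unfolding P by blast
  ultimately show ?case by blast
qed

section \<open>The constant in general\<close>

text \<open>The bound \<open>B\<close> depends on the decay constants alone, so it dominates the
  exponents of all truncations at once.\<close>

lemma fps_log_deriv_bounded:
  assumes \<rho>: "0 \<le> \<rho>" "\<rho> < 1" and C: "0 \<le> C"
  obtains B where "\<And>P n. geom_bounded C \<rho> (fps_nth P) \<Longrightarrow> geom_bounded C \<rho> (fps_nth (inverse P)) \<Longrightarrow>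
                      norm (fps_nth (fps_log_deriv P) n) \<le> B"
proof -
  define \<tau> where "\<tau> = (1 + \<rho>) / 2"
  have \<tau>: "\<rho> < \<tau>" "\<tau> < 1" "0 \<le> \<tau>" "\<rho> \<le> \<tau>" using \<rho> by (auto simp: \<tau>_def)
  obtain K0 where K0: "K0 > 0" "\<And>n. real (Suc n) * \<rho> ^ n \<le> K0 * \<tau> ^ n"
    using linear_times_geometric_le[OF \<rho>(1) \<tau>(1)] by metis
  obtain K1 where K1: "K1 > 0" "\<And>n. real (Suc n) * \<tau> ^ n \<le> K1 * 1 ^ n"
    using linear_times_geometric_le[OF \<tau>(3,2)] by metis
  show thesis
  proof (rule that[of "C * (C * K0) * K1"])
    fix P n
    assume P: "geom_bounded C \<rho> (fps_nth P)" and p: "geom_bounded C \<rho> (fps_nth (inverse P))"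
    have XP: "norm (fps_nth (fps_X * fps_deriv P) k) \<le> (C * K0) * \<tau> ^ k" for k
    proof -
      have "norm (fps_nth (fps_X * fps_deriv P) k) = real k * norm (fps_nth P k)"
        by (cases k) (auto simp: norm_mult simp del: of_nat_Suc)
      also have "\<dots> \<le> real (Suc k) * (C * \<rho> ^ k)"
        by (intro mult_mono geom_boundedD[OF P]) auto
      also have "\<dots> = C * (real (Suc k) * \<rho> ^ k)" by simp
      also have "\<dots> \<le> C * (K0 * \<tau> ^ k)" using C by (intro mult_left_mono K0) auto
      finally show ?thesis by (simp add: mult_ac)
    qed
    have "norm (fps_nth (fps_log_deriv P) n) =
          norm (\<Sum>k\<le>n. fps_nth (inverse P) (n - k) * fps_nth (fps_X * fps_deriv P) k)"
      unfolding fps_log_deriv_def fps_mult_nth[of _ "inverse P"] by (simp add: atLeast0AtMost mult.commute)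
    also have "\<dots> \<le> C * (C * K0) * (real (Suc n) * \<tau> ^ n)"
      by (intro norm_cauchy_product_le XP geom_bounded_mono[OF p]) (use \<rho> \<tau> C K0 in auto)
    also have "\<dots> \<le> C * (C * K0) * (K1 * 1 ^ n)"
      using C K0 by (intro mult_left_mono K1) auto
    finally show "norm (fps_nth (fps_log_deriv P) n) \<le> C * (C * K0) * K1" by simp
  qed
qed

section \<open>From polynomials to general factors by truncation\<close>

lemma fps_mult_nth_eq_0:
  fixes f g :: "complex fps"
  assumes "\<And>i. i \<le> k \<Longrightarrow> fps_nth g i = 0" "n \<le> k"
  shows "fps_nth (f * g) n = 0"
  using assms by (auto simp: fps_mult_nth intro!: sum.neutral)

text \<open>1/P - 1/Q is a multiple of Q - P, which vanishes up to order \<open>k\<close>.\<close>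

lemma fps_inverse_nth_cong:
  fixes P Q :: "complex fps"
  assumes "\<And>i. i \<le> k \<Longrightarrow> fps_nth P i = fps_nth Q i" "fps_nth P 0 \<noteq> 0" "n \<le> k"
  shows "fps_nth (inverse P) n = fps_nth (inverse Q) n"
proof -
  have Q0: "fps_nth Q 0 \<noteq> 0" using assms(1)[of 0] assms(2) by simp
  have "P * inverse P = 1" "Q * inverse Q = 1"
    using assms(2) Q0 by (auto simp: inverse_mult_eq_1')
  moreover have "inverse P * inverse Q * (Q - P) = inverse P * (Q * inverse Q) - inverse Q * (P * inverse P)"
    by (simp add: algebra_simps)
  ultimately have "inverse P - inverse Q = inverse P * inverse Q * (Q - P)" by simp
  moreover have "fps_nth (inverse P * inverse Q * (Q - P)) n = 0"
    by (rule fps_mult_nth_eq_0[of k]) (use assms in auto)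
  ultimately show ?thesis by (metis eq_iff_diff_eq_0 fps_sub_nth)
qed

lemma fps_log_deriv_nth_cong:
  fixes P Q :: "complex fps"
  assumes "\<And>i. i \<le> k \<Longrightarrow> fps_nth P i = fps_nth Q i" "fps_nth P 0 \<noteq> 0" "n \<le> k"
  shows "fps_nth (fps_log_deriv P) n = fps_nth (fps_log_deriv Q) n"
proof -
  have X: "fps_nth (fps_X * fps_deriv P) i = fps_nth (fps_X * fps_deriv Q) i" if "i \<le> k" for i
    using assms(1)[of i] that by (cases i) auto
  show ?thesis
    unfolding fps_log_deriv_def fps_mult_nth[of _ "inverse _"]
    by (intro sum.cong refl arg_cong2[of _ _ _ _ "(*)"] X fps_inverse_nth_cong[OF assms(1,2)])
       (use assms(3) in auto)
qed

text \<open>For fixed \<open>N\<close> the Leibniz formula is a polynomial in finitely many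
  coefficients.\<close>

lemma tendsto_toeplitz_det:
  assumes "\<And>n. (\<lambda>k. f k n) \<longlonglongrightarrow> g n"
  shows "(\<lambda>k. toeplitz_det (f k) N) \<longlonglongrightarrow> toeplitz_det g N"
proof -
  have eq: "toeplitz_det h N = (\<Sum>p | p permutes {0..<N}. signof p * (\<Prod>i = 0..<N. h (int i - int (p i))))" for h
    unfolding toeplitz_det_def
  proof (subst det_def'[of _ N])
    have "(\<Prod>i = 0..<N. Matrix.mat N N (\<lambda>(i, j). h (int i - int j)) $$ (i, p i)) =
          (\<Prod>i = 0..<N. h (int i - int (p i)))" if "p permutes {0..<N}" for p
      using permutes_in_image[OF that] by (intro prod.cong refl) (auto simp: index_mat)
    thus "(\<Sum>p | p permutes {0..<N}. signof p * (\<Prod>i = 0..<N. Matrix.mat N N (\<lambda>(i, j). h (int i - int j)) $$ (i, p i))) =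
          (\<Sum>p | p permutes {0..<N}. signof p * (\<Prod>i = 0..<N. h (int i - int (p i))))"
      by (intro sum.cong refl) auto
  qed auto
  show ?thesis
    unfolding eq by (intro tendsto_intros assms)
qed

text \<open>Cauchy's estimate for 1/q on the circle of radius \<open>s\<close>, where 1/q is at most
  1/\<delta>.\<close>

lemma inverse_poly_coeff_bound:
  fixes q :: "complex poly"
  assumes s: "s > 0" and q: "\<And>z. norm z \<le> s \<Longrightarrow> norm (poly q z) \<ge> \<delta>" and \<delta>: "\<delta> > 0"
  shows "norm (fps_nth (inverse (fps_of_poly q)) n) \<le> 1 / \<delta> * (1 / s) ^ n"
proof -
  define g where "g = (\<lambda>z. inverse (poly q z))"
  have nz: "poly q z \<noteq> 0" if "norm z \<le> s" for z using q[OF that] \<delta> by auto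
  have "poly q has_fps_expansion fps_of_poly q"
    by (intro has_fps_expansionI always_eventually allI)
       (use sums_finite[of "{..degree q}" "\<lambda>n. poly.coeff q n * _ ^ n"] in
         \<open>auto simp: poly_altdef fps_of_poly_nth coeff_eq_0\<close>)
  hence "g has_fps_expansion inverse (fps_of_poly q)"
    unfolding g_def using nz[of 0] s
    by (intro has_fps_expansion_inverse) (auto simp: fps_of_poly_nth poly_0_coeff_0)
  hence "fps_nth (inverse (fps_of_poly q)) n = (deriv ^^ n) g 0 / fact n"
    by (rule fps_nth_fps_expansion)
  moreover have "norm ((deriv ^^ n) g 0) \<le> fact n * (1 / \<delta>) / s ^ n"
  proof (rule Cauchy_inequality)
    show "g holomorphic_on ball 0 s"
      unfolding g_def using nz by (intro holomorphic_intros) auto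
    show "continuous_on (cball 0 s) g"
      unfolding g_def using nz by (intro continuous_intros) auto
    show "norm (g x) \<le> 1 / \<delta>" if "norm (0 - x) = s" for x
      using q[of x] that \<delta> by (simp add: g_def norm_inverse inverse_eq_divide norm_divide frac_le)
  qed (use s in auto)
  hence "norm ((deriv ^^ n) g 0) / fact n \<le> fact n * (1 / \<delta>) / s ^ n / fact n"
    by (intro divide_right_mono) auto
  ultimately show ?thesis
    by (simp add: norm_divide power_divide)
qed

text \<open>On a closed disc of radius s > 1 both P and 1/P converge, so P is bounded away from 0
  there. The Taylor polynomials converge uniformly on that disc, so from some index on they have
  half this lower bound. That index is built into the numbering of \<open>q\<close>. The common
  lower bound keeps their zeros away and controls the coefficients of their inverses.\<close>

lemma truncations_uniformly_admissible:
  assumes adm: "admissible C \<rho> M P" and \<rho>: "0 \<le> \<rho>" "\<rho> < 1" and C: "0 \<le> C"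
  obtains q :: "nat \<Rightarrow> complex poly" and C' \<rho>' where "0 \<le> C'" "0 \<le> \<rho>'" "\<rho>' < 1"
    "\<And>k. admissible C' \<rho>' M (fps_of_poly (q k))"
    "\<And>k z. poly (q k) z = 0 \<Longrightarrow> norm z > 1" "\<And>k. q k \<noteq> 0"
    "\<And>k n. n \<le> k \<Longrightarrow> poly.coeff (q k) n = fps_nth P n"
proof -
  \<comment> \<open>With \<rho>1 = \<sigma>^2 and s = 1/\<sigma>, terms bounded by C \<rho>1^n s^n
    still decay like \<sigma>^n on the disc of radius \<open>s\<close>; the maximum with 1/2 makes
    \<sigma> positive.\<close>
  define \<rho>1 where "\<rho>1 = max \<rho> (1/2)"
  define \<sigma> where "\<sigma> = sqrt \<rho>1"
  define s where "s = 1 / \<sigma>"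
  have \<rho>1: "\<rho> \<le> \<rho>1" "0 < \<rho>1" "\<rho>1 < 1" using \<rho> by (auto simp: \<rho>1_def)
  have \<sigma>: "0 < \<sigma>" "\<sigma> < 1" "\<rho>1 = \<sigma> * \<sigma>" using \<rho>1 by (auto simp: \<sigma>_def)
  have "\<sigma> * \<sigma> \<le> \<sigma> * 1" using \<sigma> by (intro mult_left_mono) auto
  hence \<rho>\<sigma>: "\<rho> \<le> \<sigma>" using \<sigma>(3) \<rho>1(1) by linarith
  have s: "s > 1" "\<rho>1 * s = \<sigma>" using \<sigma> by (auto simp: s_def)
  have C1: "C \<ge> 1"
    using adm geom_boundedD[of C \<rho> "fps_nth M" 0] by (auto simp: admissible_def)
  define D where "D = C / (1 - \<sigma>)"
  have D: "D > 0" using C1 \<sigma> by (simp add: D_def)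
  have term_le: "norm (fps_nth f n * z ^ n) \<le> C * \<sigma> ^ n"
    if "geom_bounded C \<rho> (fps_nth f)" "norm z \<le> s" for f :: "complex fps" and z n
  proof -
    have "norm (fps_nth f n * z ^ n) \<le> (C * \<rho>1 ^ n) * s ^ n"
      unfolding norm_mult norm_power
      using geom_boundedD[OF geom_bounded_mono[OF that(1) \<rho>(1) \<rho>1(1) order_refl C], of n] that(2) C \<rho>1
      by (intro mult_mono power_mono) auto
    also have "\<dots> = C * \<sigma> ^ n" using s by (simp add: power_mult_distrib[symmetric])
    finally show ?thesis .
  qed
  have P: "geom_bounded C \<rho> (fps_nth P)" and p: "geom_bounded C \<rho> (fps_nth (inverse P))"
    and P0: "fps_nth P 0 \<noteq> 0"
    using adm by (auto simp: admissible_def)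
  define F where "F = (\<lambda>z. \<Sum>n. fps_nth P n * z ^ n)"
  \<comment> \<open>The Cauchy product of the series of P and 1/P is 1, and the second is at most
    \<open>D\<close>.\<close>
  have F_ge: "norm (F z) \<ge> 1 / D" if z: "norm z \<le> s" for z
  proof -
    have sums: "summable (\<lambda>n. norm (fps_nth P n * z ^ n))" "summable (\<lambda>n. norm (fps_nth (inverse P) n * z ^ n))"
      using term_le[OF P z] term_le[OF p z] \<sigma>
      by (auto intro!: geom_bounded_summable[of C \<sigma>] simp: geom_bounded_def)
    have "F z * (\<Sum>n. fps_nth (inverse P) n * z ^ n) =
          (\<Sum>k. \<Sum>i\<le>k. (fps_nth P i * z ^ i) * (fps_nth (inverse P) (k - i) * z ^ (k - i)))"
      unfolding F_def by (rule Cauchy_product[OF sums])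
    also have "\<dots> = (\<Sum>k. if k = 0 then 1 else 0)"
    proof (intro suminf_cong)
      fix k
      have "(\<Sum>i\<le>k. (fps_nth P i * z ^ i) * (fps_nth (inverse P) (k - i) * z ^ (k - i))) =
            (\<Sum>i\<le>k. fps_nth P i * fps_nth (inverse P) (k - i) * z ^ k)"
        by (intro sum.cong refl) (auto simp: power_add[symmetric] mult_ac)
      also have "\<dots> = fps_nth (P * inverse P) k * z ^ k"
        by (simp add: fps_mult_nth atLeast0AtMost sum_distrib_right)
      also have "P * inverse P = 1" using P0 by (simp add: inverse_mult_eq_1')
      finally show "(\<Sum>i\<le>k. (fps_nth P i * z ^ i) * (fps_nth (inverse P) (k - i) * z ^ (k - i))) = (if k = 0 then 1 else 0)"
        by simp
    qed
    also have "\<dots> = 1" using sums_single[of 0 "\<lambda>_. 1 :: complex"] by (simp add: sums_iff)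
    finally have eq: "F z * (\<Sum>n. fps_nth (inverse P) n * z ^ n) = 1" .
    have "norm (\<Sum>n. fps_nth (inverse P) n * z ^ n) \<le> D"
      unfolding D_def by (rule norm_suminf_geometric_le[OF term_le[OF p z]]) (use \<sigma> in auto)
    hence "norm (F z) * norm (\<Sum>n. fps_nth (inverse P) n * z ^ n) \<le> norm (F z) * D"
      by (intro mult_left_mono) auto
    hence "1 \<le> norm (F z) * D" using eq by (metis norm_mult norm_one)
    thus ?thesis using D by (simp add: divide_simps)
  qed
  define q where "q k = (\<Sum>i\<le>k. Polynomial.monom (fps_nth P i) i)" for k
  have coeff: "poly.coeff (q k) n = (if n \<le> k then fps_nth P n else 0)" for k n
    by (simp add: q_def coeff_sum coeff_monom)
  have eval: "poly (q k) z = (\<Sum>n<Suc k. fps_nth P n * z ^ n)" for k z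
    by (simp add: q_def poly_sum poly_monom lessThan_Suc_atMost)
  have close: "norm (F z - poly (q k) z) \<le> D * \<sigma> ^ Suc k" if z: "norm z \<le> s" for z k
  proof -
    have "summable (\<lambda>n. fps_nth P n * z ^ n)"
      using term_le[OF P z] \<sigma>
      by (intro summable_norm_cancel[OF geom_bounded_summable[of C \<sigma>]]) (auto simp: geom_bounded_def)
    hence "F z - poly (q k) z = (\<Sum>n. fps_nth P (n + Suc k) * z ^ (n + Suc k))"
      unfolding F_def eval using suminf_split_initial_segment[of "\<lambda>n. fps_nth P n * z ^ n" "Suc k"] by simp
    also have "norm \<dots> \<le> (C * \<sigma> ^ Suc k) / (1 - \<sigma>)"
      by (rule norm_suminf_geometric_le)
         (use term_le[OF P z, of "_ + Suc k"] \<sigma> in \<open>simp_all add: power_add mult_ac\<close>)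
    finally show ?thesis by (simp add: D_def mult_ac)
  qed
  have "(\<lambda>k. D * \<sigma> ^ Suc k) \<longlonglongrightarrow> D * 0"
    by (intro tendsto_mult tendsto_const LIMSEQ_Suc LIMSEQ_power_zero) (use \<sigma> in auto)
  hence "(\<lambda>k. D * \<sigma> ^ Suc k) \<longlonglongrightarrow> 0" by (simp only: mult_zero_right)
  hence "eventually (\<lambda>k. D * \<sigma> ^ Suc k < 1 / (2 * D)) sequentially"
    by (rule order_tendstoD(2)) (use D in simp)
  then obtain k0 where k0: "\<And>k. k \<ge> k0 \<Longrightarrow> D * \<sigma> ^ Suc k < 1 / (2 * D)"
    by (auto simp: eventually_sequentially)
  have q_ge: "norm (poly (q k) z) \<ge> 1 / (2 * D)" if "norm z \<le> s" "k \<ge> k0" for k z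
  proof -
    have "norm (F z) \<le> norm (F z - poly (q k) z) + norm (poly (q k) z)"
      by (metis diff_add_cancel norm_triangle_ineq)
    thus ?thesis using F_ge[OF that(1)] close[OF that(1), of k] k0[OF that(2)] by (simp add: field_simps)
  qed
  define C' where "C' = max C (2 * D)"
  have C': "C \<le> C'" "2 * D \<le> C'" "0 \<le> C'" using C by (auto simp: C'_def)
  have pos: "1 / (2 * D) > 0" using D by simp
  show thesis
  proof (rule that[of C' \<sigma> "\<lambda>k. q (k + k0)"])
    fix k
    show "admissible C' \<sigma> M (fps_of_poly (q (k + k0)))"
      unfolding admissible_def
    proof (intro conjI)
      show "geom_bounded C' \<sigma> (fps_nth M)" "geom_bounded C' \<sigma> (fps_nth (inverse M))"
        using adm \<rho> C C' \<rho>\<sigma> unfolding admissible_def by (auto elim!: geom_bounded_mono)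
      have P': "geom_bounded C' \<sigma> (fps_nth P)"
        by (rule geom_bounded_mono[OF P]) (use \<rho> C C' \<rho>\<sigma> in auto)
      show "geom_bounded C' \<sigma> (fps_nth (fps_of_poly (q (k + k0))))"
        using geom_boundedD[OF P'] C' \<sigma> by (auto simp: geom_bounded_def fps_of_poly_nth coeff)
      show "geom_bounded C' \<sigma> (fps_nth (inverse (fps_of_poly (q (k + k0)))))"
        unfolding geom_bounded_def
      proof
        fix n
        have "norm (fps_nth (inverse (fps_of_poly (q (k + k0)))) n) \<le> 1 / (1 / (2 * D)) * (1 / s) ^ n"
          by (rule inverse_poly_coeff_bound[OF _ q_ge pos]) (use s in auto)
        also have "\<dots> = 2 * D * \<sigma> ^ n" by (simp add: s_def)
        also have "\<dots> \<le> C' * \<sigma> ^ n" using C' \<sigma> by (intro mult_right_mono) auto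
        finally show "norm (fps_nth (inverse (fps_of_poly (q (k + k0)))) n) \<le> C' * \<sigma> ^ n" .
      qed
      show "fps_nth M 0 = 1" using adm by (simp add: admissible_def)
      show "fps_nth (fps_of_poly (q (k + k0))) 0 \<noteq> 0" using P0 by (simp add: fps_of_poly_nth coeff)
    qed
    show "q (k + k0) \<noteq> 0" using coeff[of "k + k0" 0] P0 by auto
    show "norm z > 1" if "poly (q (k + k0)) z = 0" for z
      using q_ge[of z "k + k0"] that pos s by (cases "norm z \<le> s") auto
    show "poly.coeff (q (k + k0)) n = fps_nth P n" if "n \<le> k" for n
      using that by (simp add: coeff)
  qed (use \<sigma> C' in auto)
qed

text \<open>For every truncation the uniform estimate has some limit, which uniqueness of limits
  identifies with the polynomial case. The resulting bound has the same \<open>K\<close> and \<tau>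
  for all truncations, so for fixed \<open>N\<close> it persists when the truncation order tends to
  infinity.\<close>

lemma toeplitz_det_asymp:
  assumes adm: "admissible C \<rho> M P" and \<rho>: "0 \<le> \<rho>" "\<rho> < 1" and C: "0 \<le> C"
    and l: "summable (\<lambda>n. norm (l n))" "l 0 = 0"
    and Ml: "\<And>x. norm x < 1 \<Longrightarrow> (\<Sum>b. fps_nth (inverse M) b * x ^ b) = exp (- (\<Sum>n. l n * x ^ n))"
  obtains K \<tau> where "K \<ge> 0" "0 < \<tau>" "\<tau> < 1"
    "\<And>N. norm (toeplitz_det (symbol_coeff M P) N / fps_nth P 0 ^ N -
                exp (\<Sum>n. l n * fps_nth (fps_log_deriv P) n)) \<le> K * \<tau> ^ N"
proof -
  obtain q :: "nat \<Rightarrow> complex poly" and C' \<rho>' where C': "0 \<le> C'" "0 \<le> \<rho>'" "\<rho>' < 1"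
    and admq: "\<And>k. admissible C' \<rho>' M (fps_of_poly (q k))"
    and root: "\<And>k z. poly (q k) z = 0 \<Longrightarrow> norm z > 1" and q0: "\<And>k. q k \<noteq> 0"
    and coeff: "\<And>k n. n \<le> k \<Longrightarrow> poly.coeff (q k) n = fps_nth P n"
    by (rule truncations_uniformly_admissible[OF adm \<rho> C]) blast
  define Q where "Q k = fps_of_poly (q k)" for k
  have Qn: "fps_nth (Q k) n = fps_nth P n" if "n \<le> k" for k n
    using coeff[OF that] by (simp add: Q_def fps_of_poly_nth)
  define J where "J R = (\<Sum>n. l n * fps_nth (fps_log_deriv R) n)" for R
  have lim: "szego_limit M (Q k) (exp (J (Q k)))" for k
    unfolding Q_def J_def
    using szego_limit_poly[OF _ _ _ \<rho> C l Ml q0 root] adm by (auto simp: admissible_def)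
  obtain K \<tau> where K: "K \<ge> 0" "0 < \<tau>" "\<tau> < 1"
    and KL: "\<And>M P. admissible C' \<rho>' M P \<Longrightarrow>
       \<exists>L. \<forall>N. norm (toeplitz_det (symbol_coeff M P) N / fps_nth P 0 ^ N - L) \<le> K * \<tau> ^ N"
    by (rule toeplitz_det_limit[OF C'(2,3,1)]) blast
  have bound: "norm (toeplitz_det (symbol_coeff M (Q k)) N / fps_nth P 0 ^ N - exp (J (Q k))) \<le> K * \<tau> ^ N" for k N
  proof -
    obtain L where L: "\<And>N. norm (toeplitz_det (symbol_coeff M (Q k)) N / fps_nth (Q k) 0 ^ N - L) \<le> K * \<tau> ^ N"
      using KL[OF admq[of k]] unfolding Q_def by blast
    have "(\<lambda>N. K * \<tau> ^ N) \<longlonglongrightarrow> K * 0"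
      by (intro tendsto_mult tendsto_const LIMSEQ_power_zero) (use K in auto)
    hence K\<tau>: "(\<lambda>N. K * \<tau> ^ N) \<longlonglongrightarrow> 0" by simp
    have "(\<lambda>N. toeplitz_det (symbol_coeff M (Q k)) N / fps_nth (Q k) 0 ^ N - L) \<longlonglongrightarrow> 0"
      by (rule Lim_null_comparison[OF always_eventually K\<tau>]) (use L in blast)
    hence "szego_limit M (Q k) L"
      unfolding szego_limit_def by (simp add: LIM_zero_iff)
    hence "L = exp (J (Q k))"
      using lim[of k] LIMSEQ_unique unfolding szego_limit_def by blast
    thus ?thesis using L[of N] by (simp add: Qn)
  qed
  have P0: "fps_nth P 0 \<noteq> 0" using adm by (simp add: admissible_def)
  obtain B where B: "\<And>P n. geom_bounded C' \<rho>' (fps_nth P) \<Longrightarrow> geom_bounded C' \<rho>' (fps_nth (inverse P)) \<Longrightarrow>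
                      norm (fps_nth (fps_log_deriv P) n) \<le> B"
    using fps_log_deriv_bounded[OF C'(2,3,1)] by metis
  \<comment> \<open>Dominated convergence of series: each coefficient of the logarithmic derivative
    is eventually constant in \<open>k\<close>, and l_n times the uniform bound \<open>B\<close> is
    summable.\<close>
  have "(\<lambda>k. J (Q k)) \<longlonglongrightarrow> J P"
    unfolding J_def
  proof (rule tannerys_theorem[THEN conjunct2, THEN conjunct2])
    fix n
    have "eventually (\<lambda>k. l n * fps_nth (fps_log_deriv (Q k)) n = l n * fps_nth (fps_log_deriv P) n) sequentially"
      using eventually_ge_at_top[of n]
    proof eventually_elim
      case (elim k)
      have "fps_nth (fps_log_deriv (Q k)) n = fps_nth (fps_log_deriv P) n"
        by (rule fps_log_deriv_nth_cong[of k]) (use elim P0 in \<open>auto simp: Qn\<close>)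
      thus ?case by simp
    qed
    thus "(\<lambda>k. l n * fps_nth (fps_log_deriv (Q k)) n) \<longlonglongrightarrow> l n * fps_nth (fps_log_deriv P) n"
      by (rule tendsto_eventually)
    show "\<forall>\<^sub>F (n, k) in at_top \<times>\<^sub>F sequentially. norm (l n * fps_nth (fps_log_deriv (Q k)) n) \<le> norm (l n) * B"
      using admq by (intro always_eventually) (auto simp: norm_mult Q_def admissible_def intro!: mult_left_mono B)
    show "summable (\<lambda>n. norm (l n) * B)" by (intro summable_mult2 l)
  qed auto
  moreover have "(\<lambda>k. toeplitz_det (symbol_coeff M (Q k)) N) \<longlonglongrightarrow> toeplitz_det (symbol_coeff M P) N" for N
  proof (rule tendsto_toeplitz_det)
    fix n
    show "(\<lambda>k. symbol_coeff M (Q k) n) \<longlonglongrightarrow> symbol_coeff M P n"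
      unfolding symbol_coeff_def
    proof (rule tannerys_theorem[THEN conjunct2, THEN conjunct2])
      fix j
      have "eventually (\<lambda>k. fps_nth M j * int_coeff (Q k) (n + int j) = fps_nth M j * int_coeff P (n + int j)) sequentially"
        using eventually_ge_at_top[of "nat (n + int j)"]
        by eventually_elim (auto simp: int_coeff_def Qn)
      thus "(\<lambda>k. fps_nth M j * int_coeff (Q k) (n + int j)) \<longlonglongrightarrow> fps_nth M j * int_coeff P (n + int j)"
        by (rule tendsto_eventually)
      show "\<forall>\<^sub>F (j, k) in at_top \<times>\<^sub>F sequentially. norm (fps_nth M j * int_coeff (Q k) (n + int j)) \<le> norm (fps_nth M j) * C'"
        using admq C' by (intro always_eventually)
          (auto simp: norm_mult Q_def admissible_def intro!: mult_left_mono norm_int_coeff_le(2)[of _ \<rho>'])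
      show "summable (\<lambda>j. norm (fps_nth M j) * C')"
        using adm by (intro summable_mult2 geom_bounded_summable[OF _ \<rho>]) (auto simp: admissible_def)
    qed auto
  qed
  ultimately have conv: "(\<lambda>k. toeplitz_det (symbol_coeff M (Q k)) N / fps_nth P 0 ^ N - exp (J (Q k))) \<longlonglongrightarrow>
                   toeplitz_det (symbol_coeff M P) N / fps_nth P 0 ^ N - exp (J P)" for N
    using P0 by (intro tendsto_intros) auto
  have "norm (toeplitz_det (symbol_coeff M P) N / fps_nth P 0 ^ N - exp (J P)) \<le> K * \<tau> ^ N" for N
    by (rule Lim_norm_ubound[OF _ conv]) (use bound in auto)
  thus thesis using that[OF K] unfolding J_def by blast
qed

section \<open>Fourier coefficients on the circle\<close>

lemma circlepath_unit: "circlepath 0 1 t = exp (2 * of_real pi * \<i> * of_real t)"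
  by (simp add: circlepath)

lemma norm_circlepath_unit [simp]: "norm (circlepath 0 1 t) = 1"
  by (simp add: circlepath_unit norm_exp_eq_Re)

lemma circlepath_unit_neq_0 [simp]: "circlepath 0 1 t \<noteq> 0"
  by (simp add: circlepath_unit)

lemma continuous_on_compose_circlepath:
  assumes "continuous_on unit_circle f"
  shows "continuous_on A (\<lambda>t. f (circlepath 0 1 t))"
proof (rule continuous_on_compose2[OF assms])
  show "continuous_on A (circlepath 0 1)"
    unfolding circlepath by (intro continuous_intros)
qed auto

text \<open>Along this parametrization of the circle dz / (2 pi i z) is dt.\<close>

lemma fourier_coeff_eq_integral:
  "fourier_coeff f n = integral {0..1} (\<lambda>t. circlepath 0 1 t powi (- n) * f (circlepath 0 1 t))"
  unfolding fourier_coeff_def contour_integral_integral vector_derivative_circlepath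
  by (intro integral_cong) (simp add: circlepath_unit)

lemma fourier_integrand_integrable:
  assumes "continuous_on unit_circle f"
  shows "(\<lambda>t. circlepath 0 1 t powi n * f (circlepath 0 1 t)) integrable_on {0..1}"
  by (intro integrable_continuous_real continuous_on_compose_circlepath[of "\<lambda>z. z powi n * f z"]
        continuous_intros assms) auto

lemma fourier_coeff_cong:
  assumes "\<And>z. norm z = 1 \<Longrightarrow> f z = g z"
  shows "fourier_coeff f n = fourier_coeff g n"
  unfolding fourier_coeff_eq_integral using assms by (intro integral_cong) auto

lemma fourier_coeff_add:
  assumes "continuous_on unit_circle f" "continuous_on unit_circle g"
  shows "fourier_coeff (\<lambda>z. f z + g z) n = fourier_coeff f n + fourier_coeff g n"
  unfolding fourier_coeff_eq_integral distrib_left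
  by (intro integral_add fourier_integrand_integrable assms)

lemma fourier_coeff_cmult: "fourier_coeff (\<lambda>z. c * f z) n = c * fourier_coeff f n"
proof -
  have "fourier_coeff (\<lambda>z. c * f z) n =
        integral {0..1} (\<lambda>t. c * (circlepath 0 1 t powi (- n) * f (circlepath 0 1 t)))"
    unfolding fourier_coeff_eq_integral by (simp add: mult_ac)
  thus ?thesis by (simp add: fourier_coeff_eq_integral)
qed

lemma fourier_coeff_diff:
  assumes "continuous_on unit_circle f" "continuous_on unit_circle g"
  shows "fourier_coeff (\<lambda>z. f z - g z) n = fourier_coeff f n - fourier_coeff g n"
  using fourier_coeff_add[OF assms(1), of "\<lambda>z. - 1 * g z" n] fourier_coeff_cmult[of "-1" g n] assms(2)
  by (simp add: continuous_on_minus)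

lemma fourier_coeff_sum:
  assumes "\<And>k. k \<in> A \<Longrightarrow> continuous_on unit_circle (f k)"
  shows "fourier_coeff (\<lambda>z. \<Sum>k\<in>A. f k z) n = (\<Sum>k\<in>A. fourier_coeff (f k) n)"
  using assms
proof (induction A rule: infinite_finite_induct)
  case (insert a A)
  thus ?case by (simp add: fourier_coeff_add continuous_on_sum)
qed (simp_all add: fourier_coeff_eq_integral)

lemma fourier_coeff_powi_mult: "fourier_coeff (\<lambda>z. z powi k * f z) n = fourier_coeff f (n - k)"
proof -
  have "circlepath 0 1 t powi (- n) * (circlepath 0 1 t powi k * f (circlepath 0 1 t)) =
        circlepath 0 1 t powi (- (n - k)) * f (circlepath 0 1 t)" for t
    by (simp add: power_int_diff power_int_minus divide_inverse mult_ac)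
  thus ?thesis unfolding fourier_coeff_eq_integral by (simp only:)
qed

lemma fourier_coeff_one: "fourier_coeff (\<lambda>_. 1) n = of_bool (n = 0)"
proof (cases "n = 0")
  case False
  have "((\<lambda>t. circlepath 0 1 t powi (- n) * 1) has_integral
          circlepath 0 1 1 powi (- n) / (- (2 * of_real pi * \<i> * of_int n))
          - circlepath 0 1 0 powi (- n) / (- (2 * of_real pi * \<i> * of_int n))) {0..1}"
  proof (rule fundamental_theorem_of_calculus)
    fix t :: real
    have eq: "circlepath 0 1 x powi (- n) / (- (2 * of_real pi * \<i> * of_int n)) =
          exp (- (2 * of_real pi * \<i> * of_int n) * of_real x) / (- (2 * of_real pi * \<i> * of_int n))" for x
      unfolding circlepath_unit exp_power_int by (simp add: mult_ac)
    show "((\<lambda>t. circlepath 0 1 t powi (- n) / (- (2 * of_real pi * \<i> * of_int n)))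
           has_vector_derivative circlepath 0 1 t powi (- n) * 1) (at t within {0..1})"
      unfolding eq unfolding circlepath_unit exp_power_int
      by (rule has_vector_derivative_real_field)
         (use False in \<open>auto intro!: derivative_eq_intros simp: mult_ac\<close>)
  qed auto
  thus ?thesis using False
    unfolding fourier_coeff_eq_integral by (simp add: integral_unique circlepath_unit)
qed (simp add: fourier_coeff_eq_integral)

lemma norm_fourier_coeff_le:
  assumes "continuous_on unit_circle f" "\<And>z. norm z = 1 \<Longrightarrow> norm (f z) \<le> B"
  shows "norm (fourier_coeff f n) \<le> B"
proof -
  have "norm (fourier_coeff f n) \<le> integral {0..1} (\<lambda>t::real. B)"
    unfolding fourier_coeff_eq_integral
    by (rule integral_norm_bound_integral[OF fourier_integrand_integrable[OF assms(1)]])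
       (use assms(2) in \<open>auto simp: norm_mult norm_power_int\<close>)
  thus ?thesis by simp
qed

text \<open>The integer \<open>s\<close> will be 1 or -1, so that series in z and in 1/z are treated
  together.\<close>

lemma uniform_limit_powi_series:
  fixes a :: "nat \<Rightarrow> complex" and s :: int
  assumes a: "summable (\<lambda>k. norm (a k))"
  shows "uniform_limit unit_circle (\<lambda>N z. \<Sum>k<N. a k * z powi (s * int k)) (\<lambda>z. \<Sum>k. a k * z powi (s * int k)) sequentially"
  by (rule Weierstrass_m_test[OF _ a]) (auto simp: norm_mult norm_power_int)

lemma continuous_on_powi_series:
  fixes a :: "nat \<Rightarrow> complex" and s :: int
  assumes a: "summable (\<lambda>k. norm (a k))"
  shows "continuous_on unit_circle (\<lambda>z. \<Sum>k. a k * z powi (s * int k))"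
  by (rule uniform_limit_theorem[OF _ uniform_limit_powi_series[OF a]])
     (auto intro!: continuous_intros always_eventually)

lemma fourier_coeff_powi_series_mult:
  fixes a :: "nat \<Rightarrow> complex" and s :: int
  assumes a: "summable (\<lambda>k. norm (a k))" and f: "continuous_on unit_circle f"
  shows "(\<lambda>k. a k * fourier_coeff f (n - s * int k)) sums
         fourier_coeff (\<lambda>z. (\<Sum>k. a k * z powi (s * int k)) * f z) n"
proof -
  have "compact (f ` unit_circle)"
    by (intro compact_continuous_image f compact_sphere)
  then obtain B where B: "B > 0" "\<And>z. norm z = 1 \<Longrightarrow> norm (f z) \<le> B"
    by (auto simp: bounded_pos dest!: compact_imp_bounded)
  define S where "S N z = (\<Sum>k<N. a k * z powi (s * int k))" for N z
  define T where "T z = (\<Sum>k. a k * z powi (s * int k))" for z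
  have contS: "continuous_on unit_circle (S N)" for N
    unfolding S_def by (intro continuous_intros) auto
  have contT: "continuous_on unit_circle T"
    unfolding T_def by (rule continuous_on_powi_series[OF a])
  have partial: "(\<Sum>k<N. a k * fourier_coeff f (n - s * int k)) = fourier_coeff (\<lambda>z. S N z * f z) n" for N
  proof -
    have "fourier_coeff (\<lambda>z. S N z * f z) n = fourier_coeff (\<lambda>z. \<Sum>k<N. a k * (z powi (s * int k) * f z)) n"
      by (simp add: S_def sum_distrib_right mult.assoc)
    also have "\<dots> = (\<Sum>k<N. fourier_coeff (\<lambda>z. a k * (z powi (s * int k) * f z)) n)"
      by (intro fourier_coeff_sum continuous_intros f) auto
    finally show ?thesis by (simp add: fourier_coeff_cmult fourier_coeff_powi_mult)
  qed
  have "(\<lambda>N. fourier_coeff (\<lambda>z. S N z * f z) n) \<longlonglongrightarrow> fourier_coeff (\<lambda>z. T z * f z) n"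
  proof (rule tendstoI)
    fix e :: real assume e: "e > 0"
    have "\<forall>\<^sub>F N in sequentially. \<forall>z\<in>unit_circle. dist (S N z) (T z) < e / (2 * B)"
      using uniform_limit_powi_series[OF a, of s] e B
      unfolding uniform_limit_iff S_def T_def by auto
    thus "\<forall>\<^sub>F N in sequentially. dist (fourier_coeff (\<lambda>z. S N z * f z) n) (fourier_coeff (\<lambda>z. T z * f z) n) < e"
    proof eventually_elim
      case (elim N)
      have "dist (fourier_coeff (\<lambda>z. S N z * f z) n) (fourier_coeff (\<lambda>z. T z * f z) n) =
            norm (fourier_coeff (\<lambda>z. S N z * f z - T z * f z) n)"
        by (subst fourier_coeff_diff) (auto intro!: continuous_intros contS contT f simp: dist_norm)
      also have "\<dots> \<le> e / (2 * B) * B"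
      proof (rule norm_fourier_coeff_le)
        show "continuous_on unit_circle (\<lambda>z. S N z * f z - T z * f z)"
          by (intro continuous_intros contS contT f)
        fix z :: complex assume z: "norm z = 1"
        have "norm (S N z * f z - T z * f z) = norm (S N z - T z) * norm (f z)"
          by (simp add: left_diff_distrib[symmetric] norm_mult)
        also have "\<dots> \<le> e / (2 * B) * B"
          using elim z B e by (intro mult_mono B) (auto simp: dist_norm intro: less_imp_le)
        finally show "norm (S N z * f z - T z * f z) \<le> e / (2 * B) * B" .
      qed
      also have "\<dots> < e" using B e by simp
      finally show ?case .
    qed
  qed
  thus ?thesis unfolding sums_def partial T_def .
qed

text \<open>Vanishing of all coefficients survives multiplication by z and by 1/z. On the circle 1/z
  is the conjugate, so every real linear form is a combination of the two. The function is
  generalized in the induction because a product of polynomials is applied one factor after the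
  other.\<close>

lemma fourier_coeff_eq_0_mult_real_polynomial:
  assumes p: "real_polynomial_function p" and f: "continuous_on unit_circle f" "\<And>n. fourier_coeff f n = 0"
  shows "continuous_on unit_circle (\<lambda>z. of_real (p z) * f z) \<and> (\<forall>n. fourier_coeff (\<lambda>z. of_real (p z) * f z) n = 0)"
  using p f
proof (induction arbitrary: f rule: real_polynomial_function.induct)
  case (linear p)
  interpret bounded_linear p by fact
  \<comment> \<open>Obtained by writing Re z and Im z in p z = Re z p 1 + Im z p \<i> through z and
    its conjugate.\<close>
  define c where "c = (of_real (p 1) - \<i> * of_real (p \<i>)) / 2"
  have eq: "of_real (p z) * f z = c * (z powi 1 * f z) + cnj c * (z powi (-1) * f z)" if "norm z = 1" for z
  proof -
    have zc: "inverse z = cnj z" using divide_conv_cnj[OF that, of 1] by (simp add: inverse_eq_divide)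
    have "z = Re z *\<^sub>R 1 + Im z *\<^sub>R \<i>" by (simp add: complex_eq_iff)
    hence "p z = Re z * p 1 + Im z * p \<i>" by (metis add scaleR real_scaleR_def)
    hence "of_real (p z) = c * z + cnj c * cnj z"
      by (simp add: c_def complex_eq_iff field_simps)
    thus ?thesis by (simp add: zc power_int_minus distrib_right mult.assoc)
  qed
  have cont: "continuous_on unit_circle (\<lambda>z. c * (z powi 1 * f z))"
       "continuous_on unit_circle (\<lambda>z. cnj c * (z powi (-1) * f z))"
    by (auto intro!: continuous_intros linear.prems)
  have "continuous_on unit_circle (\<lambda>z. of_real (p z) * f z)"
    by (rule continuous_on_mult[OF continuous_on_of_real[OF linear_continuous_on[OF linear.hyps]] linear.prems(1)])
  moreover have "fourier_coeff (\<lambda>z. of_real (p z) * f z) n = 0" for n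
  proof -
    have "fourier_coeff (\<lambda>z. of_real (p z) * f z) n =
          fourier_coeff (\<lambda>z. c * (z powi 1 * f z) + cnj c * (z powi (-1) * f z)) n"
      by (rule fourier_coeff_cong) (rule eq)
    also have "\<dots> = c * fourier_coeff f (n - 1) + cnj c * fourier_coeff f (n - (- 1))"
      by (subst fourier_coeff_add[OF cont]) (simp only: fourier_coeff_cmult fourier_coeff_powi_mult)
    finally show ?thesis by (simp add: linear.prems)
  qed
  ultimately show ?case by blast
next
  case (const c)
  thus ?case by (auto simp: fourier_coeff_cmult intro!: continuous_intros)
next
  case (add p q)
  from add.IH(1)[OF add.prems] add.IH(2)[OF add.prems] show ?case
    by (auto simp: distrib_right fourier_coeff_add intro!: continuous_intros)
next
  case (mult p q)
  from mult.IH(2)[OF mult.prems] mult.IH(1)[of "\<lambda>z. of_real (q z) * f z"] show ?case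
    by (auto simp: mult.assoc)
qed

text \<open>By Stone-Weierstrass the conjugate of \<open>f\<close> is a uniform limit of polynomials
  in the real coordinates, against each of which \<open>f\<close> integrates to 0. Hence the
  integral of the squared modulus vanishes, and continuity gives f = 0. The real and imaginary parts
  are approximated separately, which accounts for the factor 2 in the error.\<close>

lemma fourier_coeff_unique_0:
  assumes f: "continuous_on unit_circle f" "\<And>n. fourier_coeff f n = 0" and z: "norm z = 1"
  shows "f z = 0"
proof -
  have "compact (f ` unit_circle)"
    by (intro compact_continuous_image f compact_sphere)
  then obtain B where B: "B > 0" "\<And>z. norm z = 1 \<Longrightarrow> norm (f z) \<le> B"
    by (auto simp: bounded_pos dest!: compact_imp_bounded)
  have small: "norm (fourier_coeff (\<lambda>z. cnj (f z) * f z) 0) \<le> 2 * e * B" if e: "e > 0" for e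
  proof -
    obtain p where p: "real_polynomial_function p" "\<And>z. z \<in> unit_circle \<Longrightarrow> \<bar>Re (f z) - p z\<bar> < e"
      using Stone_Weierstrass_real_polynomial_function[of unit_circle "\<lambda>z. Re (f z)" e] f e
      by (auto intro!: continuous_intros)
    obtain q where q: "real_polynomial_function q" "\<And>z. z \<in> unit_circle \<Longrightarrow> \<bar>Im (f z) - q z\<bar> < e"
      using Stone_Weierstrass_real_polynomial_function[of unit_circle "\<lambda>z. Im (f z)" e] f e
      by (auto intro!: continuous_intros)
    note p' = fourier_coeff_eq_0_mult_real_polynomial[OF p(1) f, THEN conjunct1]
      fourier_coeff_eq_0_mult_real_polynomial[OF p(1) f, THEN conjunct2, rule_format]
    note q' = fourier_coeff_eq_0_mult_real_polynomial[OF q(1) f, THEN conjunct1]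
      fourier_coeff_eq_0_mult_real_polynomial[OF q(1) f, THEN conjunct2, rule_format]
    define g where "g = (\<lambda>z. of_real (p z) * f z - \<i> * (of_real (q z) * f z))"
    have g: "continuous_on unit_circle g"
      unfolding g_def by (rule continuous_on_diff[OF p'(1) continuous_on_mult[OF continuous_on_const q'(1)]])
    have g0: "fourier_coeff g 0 = 0"
      unfolding g_def fourier_coeff_diff[OF p'(1) continuous_on_mult[OF continuous_on_const q'(1)]]
      by (simp add: fourier_coeff_cmult p' q')
    have ff: "continuous_on unit_circle (\<lambda>z. cnj (f z) * f z)"
      by (intro continuous_intros f)
    have "fourier_coeff (\<lambda>z. cnj (f z) * f z) 0 = fourier_coeff (\<lambda>z. cnj (f z) * f z - g z) 0"
      by (simp add: fourier_coeff_diff[OF ff g] g0)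
    also have "norm \<dots> \<le> 2 * e * B"
    proof (rule norm_fourier_coeff_le)
      show "continuous_on unit_circle (\<lambda>z. cnj (f z) * f z - g z)"
        by (intro continuous_intros ff g)
      fix z :: complex assume z: "norm z = 1"
      have "cnj (f z) - (of_real (p z) - \<i> * of_real (q z)) =
            of_real (Re (f z) - p z) - \<i> * of_real (Im (f z) - q z)"
        by (simp add: complex_eq_iff)
      also have "norm \<dots> \<le> norm (of_real (Re (f z) - p z) :: complex) + norm (\<i> * of_real (Im (f z) - q z))"
        by (rule norm_triangle_ineq4)
      also have "\<dots> \<le> e + e"
        using p(2)[of z] q(2)[of z] z by (intro add_mono) (simp_all add: norm_mult del: of_real_diff)
      finally have "norm (cnj (f z) - (of_real (p z) - \<i> * of_real (q z))) * norm (f z) \<le> (2 * e) * B"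
        using B(2)[OF z] e by (intro mult_mono) auto
      also have "norm (cnj (f z) - (of_real (p z) - \<i> * of_real (q z))) * norm (f z) =
                 norm (cnj (f z) * f z - g z)"
        by (simp add: norm_mult[symmetric] g_def algebra_simps)
      finally show "norm (cnj (f z) * f z - g z) \<le> 2 * e * B" .
    qed
    finally show ?thesis .
  qed
  have "norm (fourier_coeff (\<lambda>z. cnj (f z) * f z) 0) \<le> 0"
  proof (rule field_le_epsilon)
    fix e :: real assume "e > 0"
    thus "norm (fourier_coeff (\<lambda>z. cnj (f z) * f z) 0) \<le> 0 + e"
      using small[of "e / (2 * B)"] B(1) by simp
  qed
  hence "0 = integral {0..1} (\<lambda>t. of_real ((norm (f (circlepath 0 1 t)))\<^sup>2) :: complex)"
    unfolding fourier_coeff_eq_integral complex_norm_square by (simp add: mult.commute)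
  also have "\<dots> = of_real (integral {0..1} (\<lambda>t. (norm (f (circlepath 0 1 t)))\<^sup>2))"
    by (rule integral_linear[OF _ bounded_linear_of_real, unfolded o_def])
       (intro integrable_continuous_real continuous_intros continuous_on_compose_circlepath f)
  finally have int0: "integral {0..1} (\<lambda>t. (norm (f (circlepath 0 1 t)))\<^sup>2) = 0"
    by (metis of_real_eq_0_iff)
  have "\<forall>t\<in>{0..1}. (norm (f (circlepath 0 1 t)))\<^sup>2 = 0"
    using int0
    by (subst (asm) integral_eq_0_iff)
       (auto intro!: continuous_intros continuous_on_compose_circlepath f)
  moreover have "z \<in> path_image (circlepath 0 1)" using z by simp
  then obtain t where "t \<in> {0..1}" "z = circlepath 0 1 t"
    unfolding path_image_def by blast
  ultimately show ?thesis by auto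
qed

lemma fourier_coeff_unique:
  assumes "continuous_on unit_circle f" "continuous_on unit_circle g"
    and "\<And>n. fourier_coeff f n = fourier_coeff g n" "norm z = 1"
  shows "f z = g z"
proof -
  have "f z - g z = 0"
    by (rule fourier_coeff_unique_0[of "\<lambda>z. f z - g z"])
       (use assms in \<open>auto simp: fourier_coeff_diff intro!: continuous_intros\<close>)
  thus ?thesis by simp
qed

section \<open>Geometric decay for analytic functions and for the logarithm of the symbol\<close>

lemma has_analytic_continuation_continuous:
  assumes "has_analytic_continuation f"
  shows "continuous_on unit_circle f"
proof -
  from assms obtain U g where U: "unit_circle \<subseteq> U" "g holomorphic_on U" "\<forall>z\<in>unit_circle. g z = f z"
    unfolding has_analytic_continuation_def by blast
  have "continuous_on unit_circle g"
    using U holomorphic_on_imp_continuous_on continuous_on_subset by blast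
  thus ?thesis by (rule continuous_on_eq) (use U(3) in auto)
qed

text \<open>The contour is deformed radially to radius \<open>s\<close> inside U - {0}, and the
  integrand is then bounded on the new circle.\<close>

lemma fourier_coeff_circlepath:
  assumes U: "open U" "g holomorphic_on U" and s: "s > 0"
    and sub: "\<And>x. x \<in> closed_segment 1 s \<Longrightarrow> sphere 0 x \<subseteq> U"
    and B: "\<And>z. norm z = s \<Longrightarrow> norm (g z) \<le> B"
  shows "norm (fourier_coeff g n) \<le> B * s powi (- n)"
proof -
  define h where "h = (\<lambda>z. z powi (- n) * g z / (2 * of_real pi * \<i> * z))"
  have hol: "h holomorphic_on (U - {0})"
    unfolding h_def using U(2) by (auto intro!: holomorphic_intros intro: holomorphic_on_subset)
  have "homotopic_loops (U - {0}) (circlepath 0 1) (circlepath 0 s)"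
  proof (rule homotopic_loops_linear)
    fix t :: real
    assume "t \<in> {0..1}"
    show "closed_segment (circlepath 0 1 t) (circlepath 0 s t) \<subseteq> U - {0}"
    proof
      fix w assume "w \<in> closed_segment (circlepath 0 1 t) (circlepath 0 s t)"
      then obtain u where u: "0 \<le> u" "u \<le> 1" "w = (1 - u) *\<^sub>R circlepath 0 1 t + u *\<^sub>R circlepath 0 s t"
        by (auto simp: closed_segment_def)
      \<comment> \<open>\<open>x\<close> is the radius of the point \<open>w\<close>: both ends of
        the segment lie on the same ray.\<close>
      define x where "x = (1 - u) * 1 + u * s"
      have x: "x \<in> closed_segment 1 s" unfolding x_def closed_segment_def using u by auto
      have w: "w = of_real x * circlepath 0 1 t"
        unfolding u(3) x_def circlepath by (simp add: scaleR_conv_of_real algebra_simps)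
      have "x > 0"
      proof (cases "u = 1")
        case False
        thus ?thesis using u s by (auto simp: x_def intro!: add_pos_nonneg)
      qed (use s in \<open>simp add: x_def\<close>)
      thus "w \<in> U - {0}" using sub[OF x] by (auto simp: w norm_mult)
    qed
  qed auto
  hence eq: "contour_integral (circlepath 0 1) h = contour_integral (circlepath 0 s) h"
    by (rule Cauchy_theorem_homotopic_loops) (use U(1) hol in auto)
  have "sphere 0 s \<subseteq> U" by (rule sub) auto
  hence "h contour_integrable_on circlepath 0 s"
    using s by (intro contour_integrable_continuous_circlepath holomorphic_on_imp_continuous_on
                  holomorphic_on_subset[OF hol]) auto
  hence "(h has_contour_integral fourier_coeff g n) (circlepath 0 s)"
    unfolding fourier_coeff_def h_def[symmetric] eq by (rule has_contour_integral_integral)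
  hence "norm (fourier_coeff g n) \<le> (s powi (- n) * B / (2 * pi * s)) * (2 * pi * s)"
  proof (rule has_contour_integral_bound_circlepath)
    have "B \<ge> 0" using B[of "of_real s"] s by (simp add: order_trans[OF norm_ge_zero])
    thus "0 \<le> s powi (- n) * B / (2 * pi * s)" using s by simp
    fix z :: complex assume z: "norm (z - 0) = s"
    have "norm (h z) = s powi (- n) * norm (g z) / (2 * pi * s)"
      using z by (simp add: h_def norm_divide norm_mult norm_power_int)
    also have "\<dots> \<le> s powi (- n) * B / (2 * pi * s)"
      using B[of z] z s by (intro divide_right_mono mult_left_mono) auto
    finally show "norm (h z) \<le> s powi (- n) * B / (2 * pi * s)" .
  qed (use s in auto)
  thus ?thesis using s by (simp add: mult.commute)
qed

text \<open>Nonnegative indices use a circle of radius larger than 1, negative ones a circle of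
  radius smaller than 1.\<close>

lemma analytic_fourier_coeff_decay:
  assumes "has_analytic_continuation f"
  obtains C \<rho> where "0 \<le> C" "0 \<le> \<rho>" "\<rho> < 1" "\<And>n. norm (fourier_coeff f n) \<le> C * \<rho> ^ nat \<bar>n\<bar>"
proof -
  from assms obtain U g where U: "open U" "unit_circle \<subseteq> U" "g holomorphic_on U" "\<forall>z\<in>unit_circle. g z = f z"
    unfolding has_analytic_continuation_def by blast
  obtain e0 where e0: "e0 > 0" "(\<Union>x\<in>unit_circle. cball x e0) \<subseteq> U"
    using compact_subset_open_imp_cball_epsilon_subset[of unit_circle U] U by auto
  \<comment> \<open>The bound 1/2 keeps the inner radius 1 - e positive.\<close>
  define e where "e = min e0 (1/2)"
  have e: "e > 0" "e < 1" using e0 by (auto simp: e_def)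
  have sub: "sphere 0 x \<subseteq> U" if "\<bar>x - 1\<bar> \<le> e" for x
  proof
    fix z :: complex assume "z \<in> sphere 0 x"
    hence z: "norm z = x" by simp
    have x: "x > 0" using that e by (auto simp: abs_if split: if_splits)
    have "norm (z / of_real x - z) = \<bar>x - 1\<bar>"
    proof -
      have "z / of_real x - z = z * of_real ((1 - x) / x)"
        using x by (simp add: field_simps)
      thus ?thesis using x z by (simp add: norm_mult del: of_real_divide)
    qed
    hence "z \<in> cball (z / of_real x) e0" using that by (simp add: dist_norm e_def)
    moreover have "z / of_real x \<in> unit_circle" using x z by (simp add: norm_divide)
    ultimately show "z \<in> U" using e0(2) by blast
  qed
  have bnd: "\<exists>B\<ge>0. \<forall>z. norm z = s \<longrightarrow> norm (g z) \<le> B" if "\<bar>s - 1\<bar> \<le> e" for s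
  proof -
    have "compact (g ` sphere 0 s)"
      by (intro compact_continuous_image holomorphic_on_imp_continuous_on
            holomorphic_on_subset[OF U(3)] sub that compact_sphere)
    hence "bounded (g ` sphere 0 s)" by (rule compact_imp_bounded)
    then obtain B where "B > 0" "\<forall>x\<in>g ` sphere 0 s. norm x \<le> B" by (auto simp: bounded_pos)
    thus ?thesis by (intro exI[of _ B]) auto
  qed
  have fg: "fourier_coeff f n = fourier_coeff g n" for n
    by (rule fourier_coeff_cong) (use U(4) in auto)
  obtain B1 where B1: "B1 \<ge> 0" "\<And>z. norm z = 1 + e \<Longrightarrow> norm (g z) \<le> B1" using bnd[of "1 + e"] e by auto
  obtain B2 where B2: "B2 \<ge> 0" "\<And>z. norm z = 1 - e \<Longrightarrow> norm (g z) \<le> B2" using bnd[of "1 - e"] e by auto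
  define \<rho> where "\<rho> = max (1 / (1 + e)) (1 - e)"
  have \<rho>: "0 \<le> \<rho>" "\<rho> < 1" "1 / (1 + e) \<le> \<rho>" "1 - e \<le> \<rho>" using e by (auto simp: \<rho>_def)
  show thesis
  proof (rule that[of "max B1 B2" \<rho>])
    fix n :: int
    show "norm (fourier_coeff f n) \<le> max B1 B2 * \<rho> ^ nat \<bar>n\<bar>"
    proof (cases "n \<ge> 0")
      case True
      have "norm (fourier_coeff g n) \<le> B1 * (1 + e) powi (- n)"
        by (rule fourier_coeff_circlepath[OF U(1,3) _ _ B1(2)])
           (use e in \<open>auto simp: closed_segment_eq_real_ivl intro!: sub[THEN subsetD]\<close>)
      also have "(1 + e) powi (- n) = (1 / (1 + e)) ^ nat \<bar>n\<bar>"
        using True e by (simp add: power_int_def power_divide inverse_eq_divide)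
      also have "B1 * (1 / (1 + e)) ^ nat \<bar>n\<bar> \<le> max B1 B2 * \<rho> ^ nat \<bar>n\<bar>"
        using B1 e \<rho> by (intro mult_mono power_mono) auto
      finally show ?thesis by (simp add: fg)
    next
      case False
      have "norm (fourier_coeff g n) \<le> B2 * (1 - e) powi (- n)"
        by (rule fourier_coeff_circlepath[OF U(1,3) _ _ B2(2)])
           (use e in \<open>auto simp: closed_segment_eq_real_ivl intro!: sub[THEN subsetD]\<close>)
      also have "(1 - e) powi (- n) = (1 - e) ^ nat \<bar>n\<bar>"
        using False e by (simp add: power_int_def)
      also have "B2 * (1 - e) ^ nat \<bar>n\<bar> \<le> max B1 B2 * \<rho> ^ nat \<bar>n\<bar>"
        using B2 e \<rho> by (intro mult_mono power_mono) auto
      finally show ?thesis by (simp add: fg)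
    qed
  qed (use B1 \<rho> in auto)
qed

text \<open>A loop of winding number 0 around the origin is null-homotopic in the punctured plane,
  and a null-homotopic map of the circle into it has a continuous logarithm. The choice in
  \<open>log_symbol\<close> is therefore justified.\<close>

lemma log_symbol_works:
  assumes "szego_type \<phi>"
  shows "continuous_on unit_circle (log_symbol \<phi>)" "\<And>z. norm z = 1 \<Longrightarrow> exp (log_symbol \<phi> z) = \<phi> z"
proof -
  define p where "p = \<phi> \<circ> circlepath 0 1"
  have cont: "continuous_on unit_circle \<phi>" and nz: "\<And>z. norm z = 1 \<Longrightarrow> \<phi> z \<noteq> 0" and wn: "winding_number p 0 = 0"
    using assms has_analytic_continuation_continuous unfolding szego_type_def p_def by auto
  have "path p"
    unfolding path_def p_def o_def by (rule continuous_on_compose_circlepath[OF cont])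
  moreover have "0 \<notin> path_image p" using nz unfolding path_image_def p_def by force
  ultimately obtain a where "homotopic_loops (- {0}) p (\<lambda>t. a)"
    using winding_number_homotopic_loops_null_eq wn by blast
  \<comment> \<open>The normalized argument inverts the parametrization, which turns the homotopy of
    loops into one of maps on the circle.\<close>
  hence "homotopic_with_canon (\<lambda>h. True) (sphere 0 1) (- {0}) (p \<circ> (\<lambda>z. (Arg2pi z / (2 * pi)))) ((\<lambda>t. a) \<circ> (\<lambda>z. (Arg2pi z / (2 * pi))))"
    by (rule homotopic_loops_imp_homotopic_circlemaps)
  hence "homotopic_with_canon (\<lambda>h. True) (sphere 0 1) (- {0}) (p \<circ> (\<lambda>z. (Arg2pi z / (2 * pi)))) (\<lambda>t. a)"
    by (simp add: o_def)
  then obtain l where l: "continuous_on unit_circle l" "\<And>z. z \<in> unit_circle \<Longrightarrow> p (Arg2pi z / (2 * pi)) = exp (l z)"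
    using inessential_eq_continuous_logarithm[of unit_circle "p \<circ> (\<lambda>z. (Arg2pi z / (2 * pi)))"] by auto
  have "exp (l z) = \<phi> z" if "z \<in> unit_circle" for z
  proof -
    have "circlepath 0 1 (Arg2pi z / (2 * pi)) = exp (\<i> * of_real (Arg2pi z))"
      by (simp add: circlepath_unit mult_ac)
    also have "\<dots> = z" using that complex_norm_eq_1_exp[of z] by simp
    finally show ?thesis using l(2)[OF that] by (simp add: p_def)
  qed
  hence "\<exists>l. continuous_on unit_circle l \<and> (\<forall>z\<in>unit_circle. exp (l z) = \<phi> z)" using l(1) by blast
  hence *: "continuous_on unit_circle (log_symbol \<phi>) \<and> (\<forall>z\<in>unit_circle. exp (log_symbol \<phi> z) = \<phi> z)"
    unfolding log_symbol_def by (rule someI_ex)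
  show "continuous_on unit_circle (log_symbol \<phi>)" "\<And>z. norm z = 1 \<Longrightarrow> exp (log_symbol \<phi> z) = \<phi> z"
    using * by auto
qed

text \<open>\<open>l\<close> is only known to be continuous. Near z0 it equals l z0 + Ln (g z / g
  z0), since both are logarithms of \<open>g\<close> and the increment of \<open>l\<close> stays in
  the strip where \<open>Ln\<close> inverts exp.\<close>

lemma continuous_log_has_vector_derivative:
  assumes U: "open U" "unit_circle \<subseteq> U" "g holomorphic_on U"
    and l: "continuous_on unit_circle l" "\<And>z. norm z = 1 \<Longrightarrow> exp (l z) = g z"
  shows "((\<lambda>t. l (circlepath 0 1 t)) has_vector_derivative
           2 * of_real pi * \<i> * circlepath 0 1 t * (deriv g (circlepath 0 1 t) / g (circlepath 0 1 t))) (at t)"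
proof -
  define z0 where "z0 = circlepath 0 1 t"
  have z0: "norm z0 = 1" by (simp add: z0_def)
  have gz0: "g z0 \<noteq> 0" using l(2)[OF z0] by (metis exp_not_eq_zero)
  have "z0 \<in> U" using U(2) z0 by auto
  hence dg: "(g has_field_derivative deriv g z0) (at z0)"
    by (rule holomorphic_derivI[OF U(3,1)])
  define k where "k z = l z0 + Ln (g z / g z0)" for z
  have dk: "(k has_field_derivative deriv g z0 / g z0) (at z0)"
    unfolding k_def using gz0 dg by (auto intro!: derivative_eq_intros)
  have dc: "(circlepath 0 1 has_vector_derivative 2 * of_real pi * \<i> * z0) (at t)"
    using has_vector_derivative_circlepath[of 0 1 t UNIV] by (simp add: z0_def circlepath_unit)
  have dkc: "((k \<circ> circlepath 0 1) has_vector_derivative 2 * of_real pi * \<i> * z0 * (deriv g z0 / g z0)) (at t)"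
    by (rule field_vector_diff_chain_at[OF dc]) (use dk in \<open>simp add: z0_def\<close>)
  have "isCont (\<lambda>t. l (circlepath 0 1 t)) t"
    using continuous_on_compose_circlepath[OF l(1), of UNIV] by (simp add: continuous_on_eq_continuous_at)
  \<comment> \<open>The choice of pi as the tolerance keeps the imaginary part of the increment
    inside the principal strip.\<close>
  from this[unfolded continuous_at_eps_delta, rule_format, OF pi_gt_zero]
  obtain d where d: "d > 0" "\<And>t'. dist t' t < d \<Longrightarrow> dist (l (circlepath 0 1 t')) (l z0) < pi"
    unfolding z0_def by blast
  have "((\<lambda>t. l (circlepath 0 1 t)) has_vector_derivative 2 * of_real pi * \<i> * z0 * (deriv g z0 / g z0)) (at t within UNIV)"
  proof (rule has_vector_derivative_transform_within[OF _ d(1)])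
    show "((k \<circ> circlepath 0 1) has_vector_derivative 2 * of_real pi * \<i> * z0 * (deriv g z0 / g z0)) (at t within UNIV)"
      using dkc by simp
    fix t' assume "dist t' t < d"
    hence "norm (l (circlepath 0 1 t') - l z0) < pi" using d(2) by (simp add: dist_norm)
    hence "\<bar>Im (l (circlepath 0 1 t') - l z0)\<bar> < pi" using abs_Im_le_cmod order_le_less_trans by blast
    hence "Ln (exp (l (circlepath 0 1 t') - l z0)) = l (circlepath 0 1 t') - l z0"
      by (intro Ln_exp) (auto simp: abs_less_iff)
    moreover have "exp (l (circlepath 0 1 t') - l z0) = g (circlepath 0 1 t') / g z0"
      by (simp add: exp_diff l(2) z0)
    ultimately show "(k \<circ> circlepath 0 1) t' = l (circlepath 0 1 t')"
      by (simp add: k_def)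
  qed auto
  thus ?thesis by (simp add: z0_def)
qed

text \<open>Integration by parts along the circle; the boundary terms cancel because the path is
  closed. This transfers questions about the logarithm to z g'/g, whose analyticity is
  immediate.\<close>

lemma fourier_coeff_log:
  assumes U: "open U" "unit_circle \<subseteq> U" "g holomorphic_on U"
    and l: "continuous_on unit_circle l" "\<And>z. norm z = 1 \<Longrightarrow> exp (l z) = g z"
  shows "of_int n * fourier_coeff l n = fourier_coeff (\<lambda>z. z * deriv g z / g z) n"
proof -
  define c where "c = circlepath 0 1"
  define k where "k = (\<lambda>z. z * deriv g z / g z)"
  have gnz: "g z \<noteq> 0" if "norm z = 1" for z using l(2)[OF that] by (metis exp_not_eq_zero)
  have contk: "continuous_on unit_circle k"
    unfolding k_def using gnz U
    by (intro continuous_intros holomorphic_on_imp_continuous_on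
          holomorphic_on_subset[OF holomorphic_deriv[OF U(3,1)]] holomorphic_on_subset[OF U(3)]) auto
  have dc: "(c has_vector_derivative 2 * of_real pi * \<i> * c t) (at t within {0..1})" for t
    using has_vector_derivative_circlepath[of 0 1 t "{0..1}"] by (simp add: c_def circlepath_unit)
  have "((\<lambda>t. 2 * of_real pi * \<i> * (c t powi (- n) * k (c t)) - 2 * of_real pi * \<i> * of_int n * (c t powi (- n) * l (c t)))
          has_integral (c 1 powi (- n) * l (c 1) - c 0 powi (- n) * l (c 0))) {0..1}"
  proof (rule fundamental_theorem_of_calculus)
    fix t :: real
    have ct: "c t \<noteq> 0" by (simp add: c_def)
    have "((\<lambda>z. z powi (- n)) has_field_derivative of_int (- n) * c t powi (- n - 1)) (at (c t))"
      using ct by (auto intro!: derivative_eq_intros)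
    hence dp: "((\<lambda>t. c t powi (- n)) has_vector_derivative
             2 * of_real pi * \<i> * c t * (of_int (- n) * c t powi (- n - 1))) (at t within {0..1})"
      by (rule field_vector_diff_chain_within[OF dc has_field_derivative_at_within, unfolded o_def])
    have dl: "((\<lambda>t. l (c t)) has_vector_derivative
             2 * of_real pi * \<i> * c t * (deriv g (c t) / g (c t))) (at t within {0..1})"
      unfolding c_def by (rule has_vector_derivative_at_within, rule continuous_log_has_vector_derivative[OF U l])
    have pw: "c t * c t powi (- n - 1) = c t powi (- n)"
      using ct by (simp add: power_int_diff)
    have "c t powi (- n) * (2 * of_real pi * \<i> * c t * (deriv g (c t) / g (c t))) +
          2 * of_real pi * \<i> * c t * (of_int (- n) * c t powi (- n - 1)) * l (c t) =
          2 * of_real pi * \<i> * (c t powi (- n) * k (c t)) - 2 * of_real pi * \<i> * of_int n * (c t powi (- n) * l (c t))"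
      by (simp add: pw[symmetric] k_def algebra_simps)
    thus "((\<lambda>t. c t powi (- n) * l (c t)) has_vector_derivative
          2 * of_real pi * \<i> * (c t powi (- n) * k (c t)) - 2 * of_real pi * \<i> * of_int n * (c t powi (- n) * l (c t)))
          (at t within {0..1})"
      using has_vector_derivative_mult[OF dp dl] by (simp only:)
  qed auto
  moreover have "c 1 = c 0" by (simp add: c_def circlepath_unit)
  ultimately have "((\<lambda>t. 2 * of_real pi * \<i> * (c t powi (- n) * k (c t)) - 2 * of_real pi * \<i> * of_int n * (c t powi (- n) * l (c t)))
          has_integral 0) {0..1}" by simp
  hence "integral {0..1} (\<lambda>t. 2 * of_real pi * \<i> * (c t powi (- n) * k (c t)) - 2 * of_real pi * \<i> * of_int n * (c t powi (- n) * l (c t))) = 0"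
    by (rule integral_unique)
  also have "integral {0..1} (\<lambda>t. 2 * of_real pi * \<i> * (c t powi (- n) * k (c t)) - 2 * of_real pi * \<i> * of_int n * (c t powi (- n) * l (c t))) =
      2 * of_real pi * \<i> * fourier_coeff k n - 2 * of_real pi * \<i> * of_int n * fourier_coeff l n"
    unfolding fourier_coeff_eq_integral c_def
    using fourier_integrand_integrable[OF contk, of "-n"] fourier_integrand_integrable[OF l(1), of "-n"]
    by (subst integral_diff) (auto intro!: integrable_on_mult_right)
  finally have "2 * of_real pi * \<i> * (fourier_coeff k n - of_int n * fourier_coeff l n) = 0"
    by (simp add: algebra_simps)
  thus ?thesis unfolding k_def by simp
qed

text \<open>For nonzero \<open>n\<close> the coefficient is at most that of z g'/g, which is
  analytic where \<open>g\<close> has no zeros. The index 0 is covered by enlarging the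
  constant.\<close>

lemma log_symbol_decay:
  assumes \<phi>: "szego_type \<phi>"
  obtains C \<rho> where "0 \<le> C" "0 \<le> \<rho>" "\<rho> < 1" "\<And>n. norm (fourier_coeff (log_symbol \<phi>) n) \<le> C * \<rho> ^ nat \<bar>n\<bar>"
proof -
  note l = log_symbol_works[OF \<phi>]
  from \<phi> obtain U g where U: "open U" "unit_circle \<subseteq> U" "g holomorphic_on U" "\<forall>z\<in>unit_circle. g z = \<phi> z"
    unfolding szego_type_def has_analytic_continuation_def by blast
  have lg: "\<And>z. norm z = 1 \<Longrightarrow> exp (log_symbol \<phi> z) = g z" using U(4) l(2) by auto
  define V where "V = {z \<in> U. g z \<noteq> 0}"
  have "open (U \<inter> g -` (- {0}))"
    by (rule continuous_open_preimage[OF holomorphic_on_imp_continuous_on[OF U(3)] U(1)]) auto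
  also have "U \<inter> g -` (- {0}) = V" by (auto simp: V_def)
  finally have V: "open V" .
  have hac: "has_analytic_continuation (\<lambda>z. z * deriv g z / g z)"
    unfolding has_analytic_continuation_def
  proof (intro exI conjI ballI)
    show "open V" by fact
    show "unit_circle \<subseteq> V" using U(2) lg unfolding V_def by (auto simp flip: lg)
    show "(\<lambda>z. z * deriv g z / g z) holomorphic_on V"
      by (intro holomorphic_intros holomorphic_on_subset[OF holomorphic_deriv[OF U(3,1)]] holomorphic_on_subset[OF U(3)])
         (auto simp: V_def)
  qed auto
  obtain C \<rho> where C: "0 \<le> C" "0 \<le> \<rho>" "\<rho> < 1"
     "\<And>n. norm (fourier_coeff (\<lambda>z. z * deriv g z / g z) n) \<le> C * \<rho> ^ nat \<bar>n\<bar>"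
    by (rule analytic_fourier_coeff_decay[OF hac]) blast
  show thesis
  proof (rule that[of "max C (norm (fourier_coeff (log_symbol \<phi>) 0))" \<rho>])
    fix n :: int
    show "norm (fourier_coeff (log_symbol \<phi>) n) \<le> max C (norm (fourier_coeff (log_symbol \<phi>) 0)) * \<rho> ^ nat \<bar>n\<bar>"
    proof (cases "n = 0")
      case False
      have "norm (fourier_coeff (log_symbol \<phi>) n) \<le> \<bar>real_of_int n\<bar> * norm (fourier_coeff (log_symbol \<phi>) n)"
        using False by (intro mult_le_cancel_right1[THEN iffD2]) auto
      also have "\<dots> = norm (fourier_coeff (\<lambda>z. z * deriv g z / g z) n)"
        by (simp add: fourier_coeff_log[OF U(1-3) l(1) lg, symmetric] norm_mult)
      also have "\<dots> \<le> C * \<rho> ^ nat \<bar>n\<bar>" by (rule C(4))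
      also have "\<dots> \<le> max C (norm (fourier_coeff (log_symbol \<phi>) 0)) * \<rho> ^ nat \<bar>n\<bar>"
        using C by (intro mult_right_mono) auto
      finally show ?thesis .
    qed auto
  qed (use C in auto)
qed

section \<open>Wiener--Hopf factors as power series\<close>

lemma holomorphic_coeff_decay:
  assumes g: "g holomorphic_on ball 0 R" and R: "R > 1" and P: "g has_fps_expansion P"
  obtains C \<rho> where "0 \<le> C" "0 \<le> \<rho>" "\<rho> < 1" "geom_bounded C \<rho> (fps_nth P)"
proof -
  define r where "r = (1 + R) / 2"
  have r: "1 < r" "r < R" using R by (auto simp: r_def)
  have cont: "continuous_on (cball 0 r) g"
    by (rule holomorphic_on_imp_continuous_on, rule holomorphic_on_subset[OF g]) (use r in auto)
  hence "bounded (g ` cball 0 r)"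
    by (intro compact_imp_bounded compact_continuous_image) auto
  then obtain B where B: "B > 0" "\<And>z. z \<in> cball 0 r \<Longrightarrow> norm (g z) \<le> B" by (auto simp: bounded_pos)
  have "geom_bounded B (1 / r) (fps_nth P)"
    unfolding geom_bounded_def
  proof
    fix n
    have "norm ((deriv ^^ n) g 0) \<le> fact n * B / r ^ n"
    proof (rule Cauchy_inequality[OF _ cont])
      show "g holomorphic_on ball 0 r" by (rule holomorphic_on_subset[OF g]) (use r in auto)
      show "norm (g x) \<le> B" if "norm (0 - x) = r" for x using B(2)[of x] that by simp
    qed (use r in auto)
    hence "norm ((deriv ^^ n) g 0) / fact n \<le> fact n * B / r ^ n / fact n"
      by (intro divide_right_mono) auto
    thus "norm (fps_nth P n) \<le> B * (1 / r) ^ n"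
      by (simp add: fps_nth_fps_expansion[OF P] norm_divide power_divide)
  qed
  thus thesis using r B by (intro that[of B "1 / r"]) auto
qed

text \<open>The exponential of A is holomorphic and without zeros on a disc of radius greater than
  1, so Cauchy's estimates give decay for it and for its inverse. Its logarithmic derivative is z
  A'.\<close>

lemma fps_exp_decay:
  assumes A: "geom_bounded C \<rho> (fps_nth A)" and \<rho>: "0 \<le> \<rho>" "\<rho> < 1" and C: "0 \<le> C"
  obtains P C' \<rho>' where "0 \<le> C'" "0 \<le> \<rho>'" "\<rho>' < 1"
    "geom_bounded C' \<rho>' (fps_nth P)" "geom_bounded C' \<rho>' (fps_nth (inverse P))"
    "fps_nth P 0 = exp (fps_nth A 0)" "fps_log_deriv P = fps_X * fps_deriv A"
    "\<And>z. norm z \<le> 1 \<Longrightarrow> (\<Sum>n. fps_nth P n * z ^ n) = exp (\<Sum>n. fps_nth A n * z ^ n)"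
    "\<And>z. norm z \<le> 1 \<Longrightarrow> (\<Sum>n. fps_nth (inverse P) n * z ^ n) = exp (- (\<Sum>n. fps_nth A n * z ^ n))"
proof -
  \<comment> \<open>Since \<rho> \<le> \<sigma>^2, the terms of A still decay like \<sigma>^n at
    radius R = 1/\<sigma>; the maximum with 1/2 keeps \<sigma> positive.\<close>
  define \<sigma> where "\<sigma> = sqrt (max \<rho> (1/2))"
  have \<sigma>: "0 < \<sigma>" "\<sigma> < 1" "\<rho> \<le> \<sigma> * \<sigma>" using \<rho> by (auto simp: \<sigma>_def)
  define R where "R = 1 / \<sigma>"
  have R: "R > 1" using \<sigma> by (simp add: R_def)
  have "summable (\<lambda>n. fps_nth A n * of_real R ^ n)"
  proof (rule summable_norm_cancel, rule geom_bounded_summable)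
    show "geom_bounded C \<sigma> (\<lambda>n. fps_nth A n * of_real R ^ n)"
      unfolding geom_bounded_def
    proof
      fix n
      have "norm (fps_nth A n * of_real R ^ n) \<le> (C * (\<sigma> * \<sigma>) ^ n) * R ^ n"
        unfolding norm_mult norm_power
        using \<sigma> R C \<rho> geom_boundedD[OF geom_bounded_mono[OF A \<rho>(1) \<sigma>(3) order_refl C], of n]
        by (intro mult_mono) auto
      also have "\<dots> = C * \<sigma> ^ n" using \<sigma> by (simp add: R_def power_mult_distrib power_divide)
      finally show "norm (fps_nth A n * of_real R ^ n) \<le> C * \<sigma> ^ n" .
    qed
  qed (use \<sigma> in auto)
  from conv_radius_geI[OF this] have rad: "fps_conv_radius A \<ge> R"
    using R by (simp add: fps_conv_radius_def)
  define F where "F = eval_fps A"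
  have F: "F holomorphic_on ball 0 R"
    unfolding F_def by (intro holomorphic_on_eval_fps ball_eball_mono rad)
  have "fps_conv_radius A > 0"
    using R by (intro less_le_trans[OF _ rad]) auto
  hence FA: "F has_fps_expansion A" unfolding F_def by (rule eval_fps_has_fps_expansion)
  define g where "g = (\<lambda>z. exp (F z))"
  define P where "P = fps_expansion g 0"
  have g: "g holomorphic_on ball 0 R" unfolding g_def by (intro holomorphic_intros F)
  have P: "g has_fps_expansion P"
    unfolding P_def by (rule has_fps_expansion_fps_expansion[OF _ _ g]) (use R in auto)
  have P0: "fps_nth P 0 = exp (fps_nth A 0)"
    using fps_nth_fps_expansion[OF P, of 0] by (simp add: g_def F_def eval_fps_at_0)
  have ig: "(\<lambda>z. inverse (g z)) holomorphic_on ball 0 R"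
    by (intro holomorphic_intros g) (auto simp: g_def)
  have iP: "(\<lambda>z. inverse (g z)) has_fps_expansion inverse P"
    by (rule has_fps_expansion_inverse[OF P]) (simp add: P0)
  obtain C1 \<rho>1 where 1: "0 \<le> C1" "0 \<le> \<rho>1" "\<rho>1 < 1" "geom_bounded C1 \<rho>1 (fps_nth P)"
    by (rule holomorphic_coeff_decay[OF g R P]) blast
  obtain C2 \<rho>2 where 2: "0 \<le> C2" "0 \<le> \<rho>2" "\<rho>2 < 1" "geom_bounded C2 \<rho>2 (fps_nth (inverse P))"
    by (rule holomorphic_coeff_decay[OF ig R iP]) blast
  have ev: "eventually (\<lambda>z. z \<in> ball 0 R) (nhds 0)"
    using R by (intro eventually_nhds_in_open) auto
  have dg: "eventually (\<lambda>z. deriv g z = deriv F z * g z) (nhds 0)"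
    using ev
  proof eventually_elim
    case (elim z)
    have "(F has_field_derivative deriv F z) (at z)"
      by (rule holomorphic_derivI[OF F _ elim]) auto
    hence "(g has_field_derivative deriv F z * g z) (at z)"
      unfolding g_def by (auto intro!: derivative_eq_intros)
    thus ?case by (rule DERIV_imp_deriv)
  qed
  \<comment> \<open>Two expansions of g' = F' g are compared, which gives the differential equation
    for the formal series.\<close>
  have "(\<lambda>z. deriv F z * g z) has_fps_expansion fps_deriv P"
    using has_fps_expansion_cong[OF dg refl] has_fps_expansion_deriv[OF P] by blast
  moreover have "(\<lambda>z. deriv F z * g z) has_fps_expansion fps_deriv A * P"
    by (intro has_fps_expansion_mult has_fps_expansion_deriv FA P)
  ultimately have dP: "fps_deriv P = fps_deriv A * P"
    by (rule fps_expansion_unique_complex)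
  have "P * inverse P = 1" by (rule inverse_mult_eq_1') (simp add: P0)
  hence ld: "fps_log_deriv P = fps_X * fps_deriv A"
    by (simp add: fps_log_deriv_def dP mult.assoc)
  have Fz: "F z = (\<Sum>n. fps_nth A n * z ^ n)" for z by (simp add: F_def eval_fps_def)
  show thesis
  proof (rule that[of "max C1 C2" "max \<rho>1 \<rho>2" P])
    show "geom_bounded (max C1 C2) (max \<rho>1 \<rho>2) (fps_nth P)"
      by (rule geom_bounded_mono[OF 1(4)]) (use 1 in auto)
    show "geom_bounded (max C1 C2) (max \<rho>1 \<rho>2) (fps_nth (inverse P))"
      by (rule geom_bounded_mono[OF 2(4)]) (use 2 in auto)
    fix z :: complex assume z: "norm z \<le> 1"
    hence zR: "ereal (norm z) < ereal R" using R by simp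
    show "(\<Sum>n. fps_nth P n * z ^ n) = exp (\<Sum>n. fps_nth A n * z ^ n)"
      using has_fps_expansion_imp_sums_complex[OF P _ zR] g by (simp add: sums_iff g_def Fz)
    show "(\<Sum>n. fps_nth (inverse P) n * z ^ n) = exp (- (\<Sum>n. fps_nth A n * z ^ n))"
      using has_fps_expansion_imp_sums_complex[OF iP _ zR] ig by (simp add: sums_iff g_def Fz exp_minus)
  qed (use 1 2 P0 ld in auto)
qed

lemma fourier_coeff_powi_series:
  fixes a :: "nat \<Rightarrow> complex"
  assumes a: "summable (\<lambda>k. norm (a k))"
  shows "fourier_coeff (\<lambda>z. \<Sum>k. a k * z powi (1 * int k)) n = (if n \<ge> 0 then a (nat n) else 0)"
    and "fourier_coeff (\<lambda>z. \<Sum>k. a k * z powi (- 1 * int k)) n = (if n \<le> 0 then a (nat (- n)) else 0)"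
proof -
  have *: "(\<lambda>k. a k * of_bool (n - s * int k = 0)) sums fourier_coeff (\<lambda>z. \<Sum>k. a k * z powi (s * int k)) n" for s
    using fourier_coeff_powi_series_mult[OF a, of "\<lambda>_. 1" n s]
    by (simp only: fourier_coeff_one mult_1_right) (simp add: continuous_on_const)
  have "(\<lambda>k. a k * of_bool (n - 1 * int k = 0)) = (\<lambda>k. if k = nat n then (if n \<ge> 0 then a (nat n) else 0) else 0)"
    by (rule ext) (cases "n \<ge> 0"; auto)
  hence "(\<lambda>k. a k * of_bool (n - 1 * int k = 0)) sums (if n \<ge> 0 then a (nat n) else 0)"
    using sums_single[of "nat n" "\<lambda>_. if n \<ge> 0 then a (nat n) else 0"] by simp
  thus "fourier_coeff (\<lambda>z. \<Sum>k. a k * z powi (1 * int k)) n = (if n \<ge> 0 then a (nat n) else 0)"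
    using *[of 1] sums_unique2 by blast
  have "(\<lambda>k. a k * of_bool (n - (- 1) * int k = 0)) = (\<lambda>k. if k = nat (- n) then (if n \<le> 0 then a (nat (- n)) else 0) else 0)"
    by (rule ext) (cases "n \<le> 0"; auto)
  hence "(\<lambda>k. a k * of_bool (n - (- 1) * int k = 0)) sums (if n \<le> 0 then a (nat (- n)) else 0)"
    using sums_single[of "nat (- n)" "\<lambda>_. if n \<le> 0 then a (nat (- n)) else 0"] by simp
  thus "fourier_coeff (\<lambda>z. \<Sum>k. a k * z powi (- 1 * int k)) n = (if n \<le> 0 then a (nat (- n)) else 0)"
    using *[of "- 1"] sums_unique2 by blast
qed

lemma powi_series_eq_power_series:
  "(\<Sum>k. a k * (z :: complex) powi (1 * int k)) = (\<Sum>k. a k * z ^ k)"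
  "(\<Sum>k. a k * (z :: complex) powi (- 1 * int k)) = (\<Sum>k. a k * inverse z ^ k)"
  by (simp_all add: power_int_minus power_inverse)

text \<open>Both sides are continuous with equal Fourier coefficients. Index 0 is assigned to the
  series in z, hence b 0 = 0.\<close>

lemma fourier_series_split:
  assumes l: "continuous_on unit_circle l"
    and a: "summable (\<lambda>k. norm (a k))" "\<And>k. a k = fourier_coeff l (int k)"
    and b: "summable (\<lambda>k. norm (b k))" "\<And>k. b k = (if k = 0 then 0 else fourier_coeff l (- int k))"
    and z: "norm z = 1"
  shows "l z = (\<Sum>k. a k * z ^ k) + (\<Sum>k. b k * inverse z ^ k)"
proof -
  have "l z = (\<Sum>k. a k * z powi (1 * int k)) + (\<Sum>k. b k * z powi (- 1 * int k))"
  proof (rule fourier_coeff_unique[OF l _ _ z])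
    show "continuous_on unit_circle (\<lambda>z. (\<Sum>k. a k * z powi (1 * int k)) + (\<Sum>k. b k * z powi (- 1 * int k)))"
      by (intro continuous_on_add continuous_on_powi_series a b)
    fix n
    show "fourier_coeff l n = fourier_coeff (\<lambda>z. (\<Sum>k. a k * z powi (1 * int k)) + (\<Sum>k. b k * z powi (- 1 * int k))) n"
      unfolding fourier_coeff_add[OF continuous_on_powi_series[OF a(1)] continuous_on_powi_series[OF b(1)]]
        fourier_coeff_powi_series[OF a(1)] fourier_coeff_powi_series[OF b(1)]
      by (auto simp: a(2) b(2))
  qed
  thus ?thesis unfolding powi_series_eq_power_series .
qed

lemma fourier_coeff_factorized:
  assumes M: "summable (\<lambda>k. norm (fps_nth M k))" and P: "summable (\<lambda>k. norm (fps_nth P k))"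
    and \<phi>: "\<And>z. norm z = 1 \<Longrightarrow> \<phi> z = (\<Sum>k. fps_nth M k * inverse z ^ k) * (\<Sum>k. fps_nth P k * z ^ k)"
  shows "fourier_coeff \<phi> n = symbol_coeff M P n"
proof -
  have "fourier_coeff \<phi> n = fourier_coeff (\<lambda>z. (\<Sum>k. fps_nth M k * z powi (- 1 * int k)) * (\<Sum>k. fps_nth P k * z powi (1 * int k))) n"
    unfolding powi_series_eq_power_series by (rule fourier_coeff_cong) (rule \<phi>)
  also have "\<dots> = (\<Sum>k. fps_nth M k * fourier_coeff (\<lambda>z. \<Sum>k. fps_nth P k * z powi (1 * int k)) (n - (- 1) * int k))"
    by (rule sums_unique[OF fourier_coeff_powi_series_mult[OF M continuous_on_powi_series[OF P]]])
  also have "\<dots> = symbol_coeff M P n"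
  proof -
    have "n - (- 1) * int k = n + int k" for k by simp
    thus ?thesis
      unfolding symbol_coeff_def fourier_coeff_powi_series(1)[OF P] int_coeff_def by (simp only:)
  qed
  finally show ?thesis .
qed

text \<open>\<phi>p / P and M(1/z) / \<phi>m agree on the circle. The former has no coefficients of
  negative index and the latter none of positive index, so the common function is a constant
  \<open>c\<close>. The two conclusions show \<open>c\<close> as a factor of \<phi>p and of
  1/\<phi>m, where it cancels in F.\<close>

lemma wiener_hopf_unique:
  assumes wh: "canonical_wiener_hopf \<phi> \<phi>m \<phi>p"
    and M: "summable (\<lambda>k. norm (fps_nth M k))" and ip: "summable (\<lambda>k. norm (fps_nth (inverse P) k))"
    and P1: "\<And>z. norm z = 1 \<Longrightarrow> (\<Sum>k. fps_nth (inverse P) k * z ^ k) * (\<Sum>k. fps_nth P k * z ^ k) = 1"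
    and \<phi>: "\<And>z. norm z = 1 \<Longrightarrow> \<phi> z = (\<Sum>k. fps_nth M k * inverse z ^ k) * (\<Sum>k. fps_nth P k * z ^ k)"
  shows "\<exists>c. c \<noteq> 0 \<and> (\<forall>z. norm z = 1 \<longrightarrow> \<phi>p z = c * (\<Sum>k. fps_nth P k * z ^ k) \<and>
           (\<Sum>k. fps_nth M k * inverse z ^ k) * inverse (\<phi>m z) = c)"
proof -
  have \<phi>mp: "\<And>z. norm z = 1 \<Longrightarrow> \<phi> z = \<phi>m z * \<phi>p z" and nz: "\<And>z. norm z = 1 \<Longrightarrow> \<phi>m z \<noteq> 0" "\<And>z. norm z = 1 \<Longrightarrow> \<phi>p z \<noteq> 0"
    and cont: "continuous_on unit_circle \<phi>p" "continuous_on unit_circle (\<lambda>z. inverse (\<phi>m z))"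
    and \<phi>p: "\<And>n. n < 0 \<Longrightarrow> fourier_coeff \<phi>p n = 0"
    and \<phi>m: "\<And>n. n > 0 \<Longrightarrow> fourier_coeff (\<lambda>z. inverse (\<phi>m z)) n = 0"
    using wh unfolding canonical_wiener_hopf_def by auto
  define h where "h = (\<lambda>z. (\<Sum>k. fps_nth (inverse P) k * z powi (1 * int k)) * \<phi>p z)"
  define h' where "h' = (\<lambda>z. (\<Sum>k. fps_nth M k * z powi (- 1 * int k)) * inverse (\<phi>m z))"
  have hh': "h z = h' z" if z: "norm z = 1" for z
  proof -
    let ?M = "\<Sum>k. fps_nth M k * inverse z ^ k" and ?P = "\<Sum>k. fps_nth P k * z ^ k"
      and ?p = "\<Sum>k. fps_nth (inverse P) k * z ^ k"
    have "?M = ?M * (?p * ?P)" by (simp only: P1[OF z] mult_1_right)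
    also have "\<dots> = ?p * (?M * ?P)" by (simp only: mult_ac)
    also have "\<dots> = ?p * (\<phi>m z * \<phi>p z)" by (simp only: \<phi>[OF z, symmetric] \<phi>mp[OF z])
    finally have "?M = ?p * \<phi>p z * \<phi>m z" by (simp only: mult_ac)
    thus ?thesis
      unfolding h_def h'_def powi_series_eq_power_series using nz(1)[OF z] by simp
  qed
  have conth: "continuous_on unit_circle h"
    unfolding h_def by (intro continuous_on_mult continuous_on_powi_series ip cont)
  have hneg: "fourier_coeff h n = 0" if "n < 0" for n
  proof -
    have "fourier_coeff h n = (\<Sum>k. fps_nth (inverse P) k * fourier_coeff \<phi>p (n - 1 * int k))"
      unfolding h_def by (rule sums_unique[OF fourier_coeff_powi_series_mult[OF ip cont(1)]])
    thus ?thesis using that by (simp add: \<phi>p)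
  qed
  have hpos: "fourier_coeff h n = 0" if "n > 0" for n
  proof -
    have "fourier_coeff h n = fourier_coeff h' n" by (rule fourier_coeff_cong) (rule hh')
    also have "\<dots> = (\<Sum>k. fps_nth M k * fourier_coeff (\<lambda>z. inverse (\<phi>m z)) (n - (- 1) * int k))"
      unfolding h'_def by (rule sums_unique[OF fourier_coeff_powi_series_mult[OF M cont(2)]])
    finally show ?thesis using that by (simp add: \<phi>m)
  qed
  define c where "c = fourier_coeff h 0"
  have hc: "h z = c" if "norm z = 1" for z
  proof (rule fourier_coeff_unique[OF conth _ _ that])
    fix n
    have "fourier_coeff (\<lambda>_. c) n = c * of_bool (n = 0)"
      using fourier_coeff_cmult[of c "\<lambda>_. 1" n] by (simp add: fourier_coeff_one)
    thus "fourier_coeff h n = fourier_coeff (\<lambda>_. c) n"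
      using hneg[of n] hpos[of n] by (cases n "0 :: int" rule: linorder_cases) (auto simp: c_def)
  qed auto
  show ?thesis
  proof (intro exI[of _ c] conjI allI impI)
    have P0: "(\<Sum>k. fps_nth (inverse P) k * z ^ k) \<noteq> 0" if "norm z = 1" for z
      using P1[OF that] by auto
    show "c \<noteq> 0"
      using hc[of 1] nz(2)[of 1] P0[of 1] unfolding h_def powi_series_eq_power_series by auto
    fix z :: complex assume z: "norm z = 1"
    have "(\<Sum>k. fps_nth P k * z ^ k) * h z = ((\<Sum>k. fps_nth (inverse P) k * z ^ k) * (\<Sum>k. fps_nth P k * z ^ k)) * \<phi>p z"
      unfolding h_def powi_series_eq_power_series by (simp only: mult_ac)
    hence "(\<Sum>k. fps_nth P k * z ^ k) * c = \<phi>p z"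
      by (simp only: P1[OF z] hc[OF z] mult_1_left)
    from this[symmetric] show "\<phi>p z = c * (\<Sum>k. fps_nth P k * z ^ k)"
      by (simp only: mult.commute)
    show "(\<Sum>k. fps_nth M k * inverse z ^ k) * inverse (\<phi>m z) = c"
      using hh'[OF z] hc[OF z] unfolding h'_def powi_series_eq_power_series by simp
  qed
qed

text \<open>Reversal is conjugation by the exchange matrix \<open>J\<close>, whose square is the
  identity, so its sign cancels.\<close>

lemma det_reverse:
  fixes f :: "nat \<Rightarrow> nat \<Rightarrow> 'a :: idom"
  shows "Determinant.det (Matrix.mat n n (\<lambda>(i, j). f (n - 1 - i) (n - 1 - j))) =
         Determinant.det (Matrix.mat n n (\<lambda>(i, j). f i j))"
proof -
  define A where "A = Matrix.mat n n (\<lambda>(i, j). f i j)"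
  define J :: "'a mat" where "J = Matrix.mat n n (\<lambda>(i, j). if j = n - 1 - i then 1 else 0)"
  have carr: "A \<in> carrier_mat n n" "J \<in> carrier_mat n n" by (auto simp: A_def J_def)
  have JX: "(J * X) $$ (i, j) = X $$ (n - 1 - i, j)" if "X \<in> carrier_mat n n" "i < n" "j < n" for X i j
  proof -
    have "(J * X) $$ (i, j) = (\<Sum>k\<in>{0..<n}. if k = n - 1 - i then X $$ (n - 1 - i, j) else 0)"
      unfolding mult_mat_entry[OF carr(2) that]
      by (rule sum.cong) (use that in \<open>auto simp: J_def\<close>)
    thus ?thesis using that by simp
  qed
  have XJ: "(X * J) $$ (i, j) = X $$ (i, n - 1 - j)" if "X \<in> carrier_mat n n" "i < n" "j < n" for X i j
  proof -
    have "(X * J) $$ (i, j) = (\<Sum>k\<in>{0..<n}. if k = n - 1 - j then X $$ (i, n - 1 - j) else 0)"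
      unfolding mult_mat_entry[OF that(1) carr(2) that(2,3)]
      by (rule sum.cong) (use that in \<open>auto simp: J_def\<close>)
    thus ?thesis using that by simp
  qed
  have JJ: "J * J = 1\<^sub>m n"
    by (rule eq_matI) (use carr in \<open>auto simp: JX simp del: index_mult_mat(1)\<close>, auto simp: J_def)
  have "Matrix.mat n n (\<lambda>(i, j). f (n - 1 - i) (n - 1 - j)) = J * (A * J)"
  proof (rule eq_matI)
    fix i j assume "i < dim_row (J * (A * J))" "j < dim_col (J * (A * J))"
    hence ij: "i < n" "j < n" using carr by auto
    have "(J * (A * J)) $$ (i, j) = A $$ (n - 1 - i, n - 1 - j)"
      using JX[OF mult_carrier_mat[OF carr] ij] XJ[OF carr(1), of "n - 1 - i" j] ij by simp
    thus "Matrix.mat n n (\<lambda>(i, j). f (n - 1 - i) (n - 1 - j)) $$ (i, j) = (J * (A * J)) $$ (i, j)"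
      using ij by (simp add: A_def)
  qed (use carr in auto)
  moreover have "Determinant.det J * Determinant.det J = 1"
    using det_mult[OF carr(2,2)] by (simp add: JJ)
  moreover have "Determinant.det (J * (A * J)) = Determinant.det A * (Determinant.det J * Determinant.det J)"
    using carr by (simp add: det_mult[of _ n] mult_ac)
  ultimately show ?thesis by (simp add: A_def)
qed

text \<open>Under the reversal the last column becomes column 0, the index N - 1 - j of \<psi>
  becomes the row index, and k - j becomes row minus column.\<close>

lemma bordered_toeplitz_det_eq:
  "bordered_toeplitz_det N \<phi> \<psi> = bordered_det (fourier_coeff \<phi>) (\<lambda>i. fourier_coeff \<psi> (int i)) N"
proof -
  define f where "f = (\<lambda>i j. if j = 0 then fourier_coeff \<psi> (int i) else fourier_coeff \<phi> (int i - int j))"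
  have "bordered_toeplitz_det N \<phi> \<psi> = Determinant.det (Matrix.mat N N (\<lambda>(i, j). f (N - 1 - i) (N - 1 - j)))"
    unfolding bordered_toeplitz_det_def
    by (rule arg_cong[of _ _ Determinant.det], rule eq_matI) (auto simp: f_def of_nat_diff algebra_simps)
  also have "\<dots> = Determinant.det (Matrix.mat N N (\<lambda>(i, j). f i j))" by (rule det_reverse)
  finally show ?thesis by (simp add: bordered_det_def f_def)
qed

text \<open>The coefficients of log \<phi> at n \<ge> 0 go into A and those at negative indices into
  B. As the coefficient at 0 belongs to A, exponentiation gives M the constant term 1 and P the
  constant term G.\<close>

lemma wiener_hopf_fps:
  assumes \<phi>: "szego_type \<phi>"
  obtains M P l C \<rho> where "0 \<le> C" "0 \<le> \<rho>" "\<rho> < 1" "admissible C \<rho> M P"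
    "fps_nth P 0 = szego_G \<phi>"
    "summable (\<lambda>n. norm (l n))" "l 0 = 0"
    "\<And>x. norm x < 1 \<Longrightarrow> (\<Sum>b. fps_nth (inverse M) b * x ^ b) = exp (- (\<Sum>n. l n * x ^ n))"
    "szego_E \<phi> = exp (\<Sum>n. l n * fps_nth (fps_log_deriv P) n)"
    "\<And>z. norm z = 1 \<Longrightarrow> \<phi> z = (\<Sum>k. fps_nth M k * inverse z ^ k) * (\<Sum>k. fps_nth P k * z ^ k)"
    "\<And>z. norm z = 1 \<Longrightarrow> (\<Sum>k. fps_nth (inverse P) k * z ^ k) * (\<Sum>k. fps_nth P k * z ^ k) = 1"
    "\<And>z. norm z = 1 \<Longrightarrow> (\<Sum>k. fps_nth (inverse M) k * z ^ k) * (\<Sum>k. fps_nth M k * z ^ k) = 1"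
proof -
  define L where "L = fourier_coeff (log_symbol \<phi>)"
  obtain C \<rho> where C: "0 \<le> C" "0 \<le> \<rho>" "\<rho> < 1" "\<And>n. norm (L n) \<le> C * \<rho> ^ nat \<bar>n\<bar>"
    unfolding L_def by (rule log_symbol_decay[OF \<phi>]) blast
  define A where "A = Abs_fps (\<lambda>n. L (int n))"
  define l where "l n = (if n = 0 then 0 else L (- int n))" for n
  define B where "B = Abs_fps l"
  have A: "geom_bounded C \<rho> (fps_nth A)" and B: "geom_bounded C \<rho> (fps_nth B)"
    using C(4)[of "int _"] C(4)[of "- int _"] C(1-3) by (auto simp: geom_bounded_def A_def B_def l_def)
  obtain P C1 \<rho>1 where P: "0 \<le> C1" "0 \<le> \<rho>1" "\<rho>1 < 1"
    "geom_bounded C1 \<rho>1 (fps_nth P)" "geom_bounded C1 \<rho>1 (fps_nth (inverse P))"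
    "fps_nth P 0 = exp (fps_nth A 0)" "fps_log_deriv P = fps_X * fps_deriv A"
    "\<And>z. norm z \<le> 1 \<Longrightarrow> (\<Sum>n. fps_nth P n * z ^ n) = exp (\<Sum>n. fps_nth A n * z ^ n)"
    "\<And>z. norm z \<le> 1 \<Longrightarrow> (\<Sum>n. fps_nth (inverse P) n * z ^ n) = exp (- (\<Sum>n. fps_nth A n * z ^ n))"
    by (rule fps_exp_decay[OF A C(2,3,1)]) blast
  obtain M C2 \<rho>2 where M: "0 \<le> C2" "0 \<le> \<rho>2" "\<rho>2 < 1"
    "geom_bounded C2 \<rho>2 (fps_nth M)" "geom_bounded C2 \<rho>2 (fps_nth (inverse M))"
    "fps_nth M 0 = exp (fps_nth B 0)" "fps_log_deriv M = fps_X * fps_deriv B"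
    "\<And>z. norm z \<le> 1 \<Longrightarrow> (\<Sum>n. fps_nth M n * z ^ n) = exp (\<Sum>n. fps_nth B n * z ^ n)"
    "\<And>z. norm z \<le> 1 \<Longrightarrow> (\<Sum>n. fps_nth (inverse M) n * z ^ n) = exp (- (\<Sum>n. fps_nth B n * z ^ n))"
    by (rule fps_exp_decay[OF B C(2,3,1)]) blast
  show thesis
  proof (rule that[of "max C1 C2" "max \<rho>1 \<rho>2" M P l])
    show "admissible (max C1 C2) (max \<rho>1 \<rho>2) M P"
      unfolding admissible_def
    proof (intro conjI)
      show "geom_bounded (max C1 C2) (max \<rho>1 \<rho>2) (fps_nth M)"
        "geom_bounded (max C1 C2) (max \<rho>1 \<rho>2) (fps_nth (inverse M))"
        by (rule geom_bounded_mono[OF M(4)] geom_bounded_mono[OF M(5)]; use M(1,2) in simp)+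
      show "geom_bounded (max C1 C2) (max \<rho>1 \<rho>2) (fps_nth P)"
        "geom_bounded (max C1 C2) (max \<rho>1 \<rho>2) (fps_nth (inverse P))"
        by (rule geom_bounded_mono[OF P(4)] geom_bounded_mono[OF P(5)]; use P(1,2) in simp)+
      show "fps_nth M 0 = 1" using M(6) by (simp add: B_def l_def)
      show "fps_nth P 0 \<noteq> 0" using P(6) by simp
    qed
    show "fps_nth P 0 = szego_G \<phi>" using P(6) by (simp add: A_def L_def szego_G_def)
    show "summable (\<lambda>n. norm (l n))"
      using geom_bounded_summable[OF B C(2,3)] by (simp add: B_def)
    show "(\<Sum>b. fps_nth (inverse M) b * x ^ b) = exp (- (\<Sum>n. l n * x ^ n))" if "norm x < 1" for x
      using M(9)[of x] that by (simp add: B_def)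
    \<comment> \<open>The logarithmic derivative z A' supplies the factor \<open>n\<close> of the
      series for E.\<close>
    have "l n * fps_nth (fps_log_deriv P) n = of_nat n * L (int n) * L (- int n)" for n
      unfolding P(7) by (cases n) (auto simp: l_def A_def)
    thus "szego_E \<phi> = exp (\<Sum>n. l n * fps_nth (fps_log_deriv P) n)"
      by (simp add: szego_E_def L_def)
    fix z :: complex assume z: "norm z = 1"
    have "log_symbol \<phi> z = (\<Sum>k. fps_nth A k * z ^ k) + (\<Sum>k. fps_nth B k * inverse z ^ k)"
      by (rule fourier_series_split[OF log_symbol_works(1)[OF \<phi>] geom_bounded_summable[OF A C(2,3)] _
            geom_bounded_summable[OF B C(2,3)] _ z])
         (auto simp: A_def B_def l_def L_def)
    hence "\<phi> z = exp (\<Sum>k. fps_nth A k * z ^ k) * exp (\<Sum>k. fps_nth B k * inverse z ^ k)"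
      using log_symbol_works(2)[OF \<phi> z] by (simp add: exp_add)
    thus "\<phi> z = (\<Sum>k. fps_nth M k * inverse z ^ k) * (\<Sum>k. fps_nth P k * z ^ k)"
      using P(8)[of z] M(8)[of "inverse z"] z by (simp add: norm_inverse mult.commute)
    show "(\<Sum>k. fps_nth (inverse P) k * z ^ k) * (\<Sum>k. fps_nth P k * z ^ k) = 1"
      using P(8)[of z] P(9)[of z] z by (simp add: exp_minus)
    show "(\<Sum>k. fps_nth (inverse M) k * z ^ k) * (\<Sum>k. fps_nth M k * z ^ k) = 1"
      using M(8)[of z] M(9)[of z] z by (simp add: exp_minus)
  qed (use P M in \<open>auto simp: l_def\<close>)
qed

theorem theorem1p2:
  fixes \<phi> \<psi> \<phi>m \<phi>p :: "complex \<Rightarrow> complex"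
  assumes "has_analytic_continuation \<psi>"
    and "szego_type \<phi>"
    and "canonical_wiener_hopf \<phi> \<phi>m \<phi>p"
  shows "\<exists>c::real. c > 0 \<and>
    (\<exists>r :: nat \<Rightarrow> complex. r \<in> O(\<lambda>N. of_real (exp (- c * real N))) \<and>
       (\<forall>N>1. bordered_toeplitz_det N \<phi> \<psi> =
          szego_G \<phi> ^ N * szego_E \<phi> * (bordered_F \<phi>m \<phi>p \<psi> + r N)))"
proof -
  obtain M P l C0 \<rho>0 where C0: "0 \<le> C0" "0 \<le> \<rho>0" "\<rho>0 < 1" and adm0: "admissible C0 \<rho>0 M P"
    and G: "fps_nth P 0 = szego_G \<phi>"
    and l: "summable (\<lambda>n. norm (l n))" "l 0 = 0"
    and Ml: "\<And>x. norm x < 1 \<Longrightarrow> (\<Sum>b. fps_nth (inverse M) b * x ^ b) = exp (- (\<Sum>n. l n * x ^ n))"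
    and E: "szego_E \<phi> = exp (\<Sum>n. l n * fps_nth (fps_log_deriv P) n)"
    and fac: "\<And>z. norm z = 1 \<Longrightarrow> \<phi> z = (\<Sum>k. fps_nth M k * inverse z ^ k) * (\<Sum>k. fps_nth P k * z ^ k)"
    and Pinv: "\<And>z. norm z = 1 \<Longrightarrow> (\<Sum>k. fps_nth (inverse P) k * z ^ k) * (\<Sum>k. fps_nth P k * z ^ k) = 1"
    and Minv: "\<And>z. norm z = 1 \<Longrightarrow> (\<Sum>k. fps_nth (inverse M) k * z ^ k) * (\<Sum>k. fps_nth M k * z ^ k) = 1"
    by (rule wiener_hopf_fps[OF assms(2)]) blast
  obtain C1 \<rho>1 where C1: "0 \<le> C1" "0 \<le> \<rho>1" "\<rho>1 < 1" "\<And>n. norm (fourier_coeff \<psi> n) \<le> C1 * \<rho>1 ^ nat \<bar>n\<bar>"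
    by (rule analytic_fourier_coeff_decay[OF assms(1)]) blast
  define C \<rho> where "C = max C0 C1" and "\<rho> = max \<rho>0 \<rho>1"
  have C: "0 \<le> C" "0 \<le> \<rho>" "\<rho> < 1" "C0 \<le> C" "\<rho>0 \<le> \<rho>" "C1 \<le> C" "\<rho>1 \<le> \<rho>"
    using C0 C1 by (auto simp: C_def \<rho>_def)
  have adm: "admissible C \<rho> M P" by (rule admissible_mono[OF adm0 C0(2) C(5,4) C0(1)])
  define v where "v i = fourier_coeff \<psi> (int i)" for i
  have v: "geom_bounded C \<rho> v"
    by (rule geom_bounded_mono[OF _ C1(2) C(7,6) C1(1)])
       (use C1(4)[of "int _"] in \<open>auto simp: geom_bounded_def v_def\<close>)
  have sums: "summable (\<lambda>k. norm (fps_nth M k))" "summable (\<lambda>k. norm (fps_nth P k))"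
     "summable (\<lambda>k. norm (fps_nth (inverse M) k))" "summable (\<lambda>k. norm (fps_nth (inverse P) k))"
    using adm C by (auto simp: admissible_def intro: geom_bounded_summable)
  have \<phi>_coeff: "fourier_coeff \<phi> = symbol_coeff M P"
    by (rule ext, rule fourier_coeff_factorized[OF sums(1,2) fac])
  define S where "S = (\<Sum>b. fps_nth (inverse M) b * v b)"
  define F where "F = bordered_F \<phi>m \<phi>p \<psi>"
  \<comment> \<open>Both numerator and denominator of F carry the same constant \<open>c\<close>
    from uniqueness of the factors; \<open>S\<close> is the zeroth coefficient of \<psi>(z) /
    M(1/z).\<close>
  have F: "F = inverse (fps_nth P 0) * S"
  proof -
    obtain c where c: "c \<noteq> 0" "\<forall>z. norm z = 1 \<longrightarrow> \<phi>p z = c * (\<Sum>k. fps_nth P k * z ^ k) \<and>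
           (\<Sum>k. fps_nth M k * inverse z ^ k) * inverse (\<phi>m z) = c"
      using wiener_hopf_unique[OF assms(3) sums(1,4) Pinv fac] by blast
    have "fourier_coeff \<phi>p 0 = c * fourier_coeff (\<lambda>z. \<Sum>k. fps_nth P k * z powi (1 * int k)) 0"
      unfolding fourier_coeff_cmult[symmetric] powi_series_eq_power_series
      by (rule fourier_coeff_cong) (use c(2) in blast)
    hence p0: "fourier_coeff \<phi>p 0 = c * fps_nth P 0"
      unfolding fourier_coeff_powi_series(1)[OF sums(2)] by simp
    have "fourier_coeff (\<lambda>z. inverse (\<phi>m z) * \<psi> z) 0 =
          c * fourier_coeff (\<lambda>z. (\<Sum>k. fps_nth (inverse M) k * z powi (- 1 * int k)) * \<psi> z) 0"
      unfolding fourier_coeff_cmult[symmetric] powi_series_eq_power_series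
    proof (rule fourier_coeff_cong)
      fix z :: complex assume z: "norm z = 1"
      let ?M = "\<Sum>k. fps_nth M k * inverse z ^ k" and ?m = "\<Sum>k. fps_nth (inverse M) k * inverse z ^ k"
      have mM: "?m * ?M = 1" using Minv[of "inverse z"] z by (simp add: norm_inverse)
      have "inverse (\<phi>m z) = ?m * ?M * inverse (\<phi>m z)" by (simp only: mM mult_1_left)
      also have "\<dots> = ?m * c" by (simp only: mult.assoc c(2)[rule_format, OF z])
      finally have "inverse (\<phi>m z) = ?m * c" .
      thus "inverse (\<phi>m z) * \<psi> z = c * (?m * \<psi> z)" by (simp only: mult_ac)
    qed
    also have "fourier_coeff (\<lambda>z. (\<Sum>k. fps_nth (inverse M) k * z powi (- 1 * int k)) * \<psi> z) 0 =
               (\<Sum>k. fps_nth (inverse M) k * fourier_coeff \<psi> (0 - (- 1) * int k))"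
      by (rule sums_unique[OF fourier_coeff_powi_series_mult[OF sums(3) has_analytic_continuation_continuous[OF assms(1)]]])
    also have "\<dots> = S" by (simp add: S_def v_def)
    finally show ?thesis using c(1) by (simp add: F_def bordered_F_def p0 divide_inverse mult_ac)
  qed
  obtain K1 \<tau>1 where K1: "K1 \<ge> 0" "0 < \<tau>1" "\<tau>1 < 1"
    "\<And>N. N \<ge> 1 \<Longrightarrow> norm (bordered_det (symbol_coeff M P) v N -
        inverse (fps_nth P 0) * (\<Sum>b. fps_nth (inverse M) b * v b) * toeplitz_det (symbol_coeff M P) N)
       \<le> K1 * \<tau>1 ^ N * norm (fps_nth P 0) ^ N"
    by (rule bordered_det_asymp[OF adm C(2,3,1) v]) blast
  obtain K2 \<tau>2 where K2: "K2 \<ge> 0" "0 < \<tau>2" "\<tau>2 < 1"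
    "\<And>N. norm (toeplitz_det (symbol_coeff M P) N / fps_nth P 0 ^ N -
                exp (\<Sum>n. l n * fps_nth (fps_log_deriv P) n)) \<le> K2 * \<tau>2 ^ N"
    by (rule toeplitz_det_asymp[OF adm C(2,3,1) l Ml]; blast)
  define \<tau> where "\<tau> = max \<tau>1 \<tau>2"
  have \<tau>: "0 < \<tau>" "\<tau> < 1" "\<tau>1 \<le> \<tau>" "\<tau>2 \<le> \<tau>" using K1 K2 by (auto simp: \<tau>_def)
  define g e where "g = szego_G \<phi>" and "e = szego_E \<phi>"
  have ge: "g \<noteq> 0" "e \<noteq> 0" by (auto simp: g_def e_def szego_G_def szego_E_def)
  define T B where "T = toeplitz_det (symbol_coeff M P)" and "B = bordered_det (symbol_coeff M P) v"
  \<comment> \<open>The error is defined by the asserted identity; the division is legitimate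
    because G and E are exponentials. Only the bound remains to be shown.\<close>
  define r where "r N = B N / (g ^ N * e) - F" for N
  have r_le: "norm (r N) \<le> (K1 + norm F * K2) / norm e * \<tau> ^ N" if N: "N \<ge> 1" for N
  proof -
    have "norm (B N - F * T N) \<le> K1 * \<tau>1 ^ N * norm g ^ N"
      using K1(4)[OF N] by (simp add: B_def T_def F S_def G g_def)
    hence "norm ((B N - F * T N) / g ^ N) \<le> K1 * \<tau>1 ^ N"
      using ge by (simp add: norm_divide norm_power divide_simps)
    also have "\<dots> \<le> K1 * \<tau> ^ N"
      using K1 \<tau> by (intro mult_left_mono power_mono) auto
    finally have 1: "norm ((B N - F * T N) / g ^ N) \<le> K1 * \<tau> ^ N" .
    have "norm (T N / g ^ N - e) \<le> K2 * \<tau>2 ^ N"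
      using K2(4)[of N] by (simp add: T_def G g_def e_def E)
    also have "\<dots> \<le> K2 * \<tau> ^ N"
      using K2 \<tau> by (intro mult_left_mono power_mono) auto
    finally have 2: "norm (F * (T N / g ^ N - e)) \<le> norm F * (K2 * \<tau> ^ N)"
      unfolding norm_mult by (intro mult_left_mono) auto
    \<comment> \<open>The error splits into the bordered determinant against F times the Toeplitz
      determinant, and the Toeplitz determinant against its limit.\<close>
    have "r N = ((B N - F * T N) / g ^ N + F * (T N / g ^ N - e)) / e"
      using ge by (simp add: r_def field_simps)
    also have "norm \<dots> \<le> (K1 * \<tau> ^ N + norm F * (K2 * \<tau> ^ N)) / norm e"
      unfolding norm_divide
      by (intro divide_right_mono order_trans[OF norm_triangle_ineq add_mono[OF 1 2]]) auto
    also have "\<dots> = (K1 + norm F * K2) / norm e * \<tau> ^ N"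
      by (simp add: algebra_simps)
    finally show ?thesis .
  qed
  \<comment> \<open>This makes exp(-c N) equal to \<tau>^N, with c > 0 because 0 < \<tau> <
    1.\<close>
  define c where "c = - ln \<tau>"
  have c: "c > 0" using \<tau> by (simp add: c_def)
  have exp_c: "exp (- c * real N) = \<tau> ^ N" for N
  proof -
    have "exp (- c * real N) = exp (ln \<tau>) ^ N"
      by (simp add: c_def exp_of_nat_mult[symmetric] mult.commute)
    thus ?thesis using \<tau> by simp
  qed
  have "r \<in> O(\<lambda>N. of_real (exp (- c * real N)))"
  proof (rule bigoI)
    show "\<forall>\<^sub>F N in at_top. norm (r N) \<le> (K1 + norm F * K2) / norm e * norm (of_real (exp (- c * real N)) :: complex)"
      using eventually_ge_at_top[of 1]
    proof eventually_elim
      case (elim N)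
      have *: "norm (of_real (exp (- c * real N)) :: complex) = \<tau> ^ N"
        unfolding exp_c using \<tau> by (simp add: norm_power)
      show ?case using r_le[OF elim] unfolding * .
    qed
  qed
  moreover have "bordered_toeplitz_det N \<phi> \<psi> = szego_G \<phi> ^ N * szego_E \<phi> * (bordered_F \<phi>m \<phi>p \<psi> + r N)" for N
  proof -
    have "bordered_toeplitz_det N \<phi> \<psi> = B N"
      by (simp add: bordered_toeplitz_det_eq \<phi>_coeff B_def v_def[abs_def])
    also have "\<dots> = g ^ N * e * (F + r N)" using ge by (simp add: r_def)
    finally show ?thesis by (simp add: g_def e_def F_def)
  qed
  ultimately show ?thesis using c by blast
qed

end
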